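(* Let $A$ be a unital, stably finite $C^*$-algebra whose Cuntz semigroup $W(A)$ is almost unperforated. Then $LDF(A)$ is dense in $DF(A)$ in the topology of pointwise convergence.
   Context: For $a,b\in M_\infty(A)_+$, $a\preccurlyeq b$ (Cuntz subequivalence) means there are $r_k\in M_\infty(A)$ with $r_kbr_k^*\to a$ in norm; $a\sim b$ iff $a\preccurlyeq b\preccurlyeq a$. $W(A)=M_\infty(A)_+/\!\sim$ with $\langle a\rangle+\langle b\rangle=\langle a\oplus b\rangle$ and $\langle a\rangle\le\langle b\rangle\iff a\preccurlyeq b$. $W(A)$ is almost unperforated if for all $x,y\in W(A)$ and $k,k'\in\mathbb N$ with $k>k'$, $kx\le k'y$ implies $x\le y$. A dimension function on unital $A$ is $d:M_\infty(A)_+\to[0,\infty)$ with $d(1_A)=1$, $d(a+b)=d(a)+d(b)$ whenever $ab=0$, and $d(a)\le d(b)$ whenever $a\preccurlyeq b$; $DF(A)$ is the set of these with the topology of pointwise convergence. $LDF(A)$ is the subset of lower semicontinuous ones: $d(a)=\sup_{\epsilon>0}d((a-\epsilon)_+)$ for all $a$, where $(a-\epsilon)_+=f_\epsilon(a)$, $f_\epsilon(t)=\max\{t-\epsilon,0\}$. *)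

theory Defs
  imports "HOL-Analysis.Analysis" "HOL-Computational_Algebra.Polynomial"
begin

text \<open>A unital C*-algebra is encoded as a real Banach algebra with unit (type class)
  together with a complex scalar multiplication sc (extending the real one) and an
  involution st satisfying the usual axioms and the C*-identity.\<close>

definition cstar_algebra ::
  "(complex \<Rightarrow> 'a::{real_normed_algebra_1,banach} \<Rightarrow> 'a) \<Rightarrow> ('a \<Rightarrow> 'a) \<Rightarrow> bool" where
  "cstar_algebra sc st \<longleftrightarrow>
     (\<forall>r x. sc (complex_of_real r) x = r *\<^sub>R x) \<and>
     (\<forall>a b x. sc (a * b) x = sc a (sc b x)) \<and>
     (\<forall>a b x. sc (a + b) x = sc a x + sc b x) \<and>
     (\<forall>a x y. sc a (x + y) = sc a x + sc a y) \<and>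
     (\<forall>a x y. sc a (x * y) = sc a x * y \<and> sc a (x * y) = x * sc a y) \<and>
     (\<forall>a x. norm (sc a x) = cmod a * norm x) \<and>
     (\<forall>x. st (st x) = x) \<and>
     (\<forall>x y. st (x + y) = st x + st y) \<and>
     (\<forall>a x. st (sc a x) = sc (cnj a) (st x)) \<and>
     (\<forall>x y. st (x * y) = st y * st x) \<and>
     (\<forall>x. norm (st x * x) = (norm x)\<^sup>2)"

text \<open>M_\<infinity>(A) is the union of the M_n(A), with M_n(A) embedded in the upper left
  corner of M_{n+1}(A). We represent it as matrices nat \<Rightarrow> nat \<Rightarrow> 'a with finite support.\<close>

definition bounded_by :: "nat \<Rightarrow> (nat \<Rightarrow> nat \<Rightarrow> 'a::zero) \<Rightarrow> bool" where
  "bounded_by n x \<longleftrightarrow> (\<forall>i j. n \<le> i \<or> n \<le> j \<longrightarrow> x i j = 0)"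

definition fin_mat :: "(nat \<Rightarrow> nat \<Rightarrow> 'a::zero) \<Rightarrow> bool" where
  "fin_mat x \<longleftrightarrow> (\<exists>n. bounded_by n x)"

definition msize :: "(nat \<Rightarrow> nat \<Rightarrow> 'a::zero) \<Rightarrow> nat" where
  "msize x = (LEAST n. bounded_by n x)"

definition mzero :: "nat \<Rightarrow> nat \<Rightarrow> 'a::zero" where
  "mzero = (\<lambda>i j. 0)"

definition madd :: "(nat \<Rightarrow> nat \<Rightarrow> 'a::plus) \<Rightarrow> (nat \<Rightarrow> nat \<Rightarrow> 'a) \<Rightarrow> nat \<Rightarrow> nat \<Rightarrow> 'a" where
  "madd x y = (\<lambda>i j. x i j + y i j)"

definition mdiff :: "(nat \<Rightarrow> nat \<Rightarrow> 'a::minus) \<Rightarrow> (nat \<Rightarrow> nat \<Rightarrow> 'a) \<Rightarrow> nat \<Rightarrow> nat \<Rightarrow> 'a" where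
  "mdiff x y = (\<lambda>i j. x i j - y i j)"

definition mmul :: "(nat \<Rightarrow> nat \<Rightarrow> 'a::{zero,times,comm_monoid_add}) \<Rightarrow> (nat \<Rightarrow> nat \<Rightarrow> 'a) \<Rightarrow> nat \<Rightarrow> nat \<Rightarrow> 'a" where
  "mmul x y = (\<lambda>i j. \<Sum>k<msize x. x i k * y k j)"

definition mstar :: "('a \<Rightarrow> 'a) \<Rightarrow> (nat \<Rightarrow> nat \<Rightarrow> 'a) \<Rightarrow> nat \<Rightarrow> nat \<Rightarrow> 'a" where
  "mstar st x = (\<lambda>i j. st (x j i))"

definition mscal :: "(complex \<Rightarrow> 'a \<Rightarrow> 'a) \<Rightarrow> complex \<Rightarrow> (nat \<Rightarrow> nat \<Rightarrow> 'a) \<Rightarrow> nat \<Rightarrow> nat \<Rightarrow> 'a" where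
  "mscal sc c x = (\<lambda>i j. sc c (x i j))"

definition eye :: "nat \<Rightarrow> nat \<Rightarrow> nat \<Rightarrow> 'a::{zero,one}" where
  "eye n = (\<lambda>i j. if i = j \<and> i < n then 1 else 0)"

definition invertible_in :: "nat \<Rightarrow> (nat \<Rightarrow> nat \<Rightarrow> 'a::{real_normed_algebra_1}) \<Rightarrow> bool" where
  "invertible_in n y \<longleftrightarrow> (\<exists>z. bounded_by n z \<and> mmul y z = eye n \<and> mmul z y = eye n)"

definition mspec :: "(complex \<Rightarrow> 'a \<Rightarrow> 'a) \<Rightarrow> nat \<Rightarrow> (nat \<Rightarrow> nat \<Rightarrow> 'a::real_normed_algebra_1) \<Rightarrow> complex set" where
  "mspec sc n y = {z. \<not> invertible_in n (mdiff (mscal sc z (eye n)) y)}"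

text \<open>The C*-norm of M_\<infinity>(A): \<parallel>x\<parallel> = sqrt(spectral radius of x*x), computed in M_n(A)
  for any n with x in M_n(A) (we take n = msize x).\<close>
definition mnorm :: "(complex \<Rightarrow> 'a \<Rightarrow> 'a) \<Rightarrow> ('a \<Rightarrow> 'a) \<Rightarrow> (nat \<Rightarrow> nat \<Rightarrow> 'a::real_normed_algebra_1) \<Rightarrow> real" where
  "mnorm sc st x = sqrt (Sup ({0} \<union> cmod ` mspec sc (msize x) (mmul (mstar st x) x)))"

definition mpos :: "('a \<Rightarrow> 'a) \<Rightarrow> (nat \<Rightarrow> nat \<Rightarrow> 'a::real_normed_algebra_1) \<Rightarrow> bool" where
  "mpos st a \<longleftrightarrow> fin_mat a \<and> (\<exists>b. fin_mat b \<and> a = mmul (mstar st b) b)"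

fun mpow :: "(nat \<Rightarrow> nat \<Rightarrow> 'a::real_normed_algebra_1) \<Rightarrow> nat \<Rightarrow> nat \<Rightarrow> nat \<Rightarrow> 'a" where
  "mpow a 0 = mzero"
| "mpow a (Suc n) = (if n = 0 then a else mmul a (mpow a n))"

text \<open>p(a) for a real polynomial p with p(0) = 0.\<close>
definition peval :: "real poly \<Rightarrow> (nat \<Rightarrow> nat \<Rightarrow> 'a::real_normed_algebra_1) \<Rightarrow> nat \<Rightarrow> nat \<Rightarrow> 'a" where
  "peval p a = (\<lambda>i j. \<Sum>k\<in>{1..degree p}. coeff p k *\<^sub>R mpow a k i j)"

definition f_eps :: "real \<Rightarrow> real \<Rightarrow> real" where
  "f_eps \<epsilon> t = max (t - \<epsilon>) 0"

text \<open>(a - \<epsilon>)_+ = f_\<epsilon>(a) via continuous functional calculus: the norm limit of p(a)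
  for polynomials p (vanishing at 0) converging uniformly to f_\<epsilon> on [0, \<parallel>a\<parallel>]
  (which contains the spectrum of the positive element a).\<close>
definition fpos :: "(complex \<Rightarrow> 'a \<Rightarrow> 'a) \<Rightarrow> ('a \<Rightarrow> 'a) \<Rightarrow> real \<Rightarrow> (nat \<Rightarrow> nat \<Rightarrow> 'a::real_normed_algebra_1) \<Rightarrow> nat \<Rightarrow> nat \<Rightarrow> 'a" where
  "fpos sc st \<epsilon> a = (THE c. fin_mat c \<and>
     (\<forall>\<delta>>0. \<exists>\<eta>>0. \<forall>p::real poly. poly p 0 = 0 \<and>
        (\<forall>t\<in>{0..mnorm sc st a}. \<bar>poly p t - f_eps \<epsilon> t\<bar> < \<eta>) \<longrightarrow>
        mnorm sc st (mdiff (peval p a) c) < \<delta>))"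

definition cuntz_le :: "(complex \<Rightarrow> 'a \<Rightarrow> 'a) \<Rightarrow> ('a \<Rightarrow> 'a) \<Rightarrow> (nat \<Rightarrow> nat \<Rightarrow> 'a::real_normed_algebra_1) \<Rightarrow> (nat \<Rightarrow> nat \<Rightarrow> 'a) \<Rightarrow> bool" where
  "cuntz_le sc st a b \<longleftrightarrow> (\<exists>r::nat \<Rightarrow> nat \<Rightarrow> nat \<Rightarrow> 'a. (\<forall>k. fin_mat (r k)) \<and>
      (\<lambda>k. mnorm sc st (mdiff (mmul (mmul (r k) b) (mstar st (r k))) a)) \<longlonglongrightarrow> 0)"

definition mdsum :: "(nat \<Rightarrow> nat \<Rightarrow> 'a::zero) \<Rightarrow> (nat \<Rightarrow> nat \<Rightarrow> 'a) \<Rightarrow> nat \<Rightarrow> nat \<Rightarrow> 'a" where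
  "mdsum a b = (\<lambda>i j. if i < msize a \<and> j < msize a then a i j
                      else if msize a \<le> i \<and> msize a \<le> j then b (i - msize a) (j - msize a)
                      else 0)"

fun mrep :: "nat \<Rightarrow> (nat \<Rightarrow> nat \<Rightarrow> 'a::zero) \<Rightarrow> nat \<Rightarrow> nat \<Rightarrow> 'a" where
  "mrep 0 a = mzero"
| "mrep (Suc k) a = mdsum a (mrep k a)"

text \<open>W(A) almost unperforated, unfolded on representatives:
  k\<langle>a\<rangle> \<le> k'\<langle>b\<rangle> with k > k' implies \<langle>a\<rangle> \<le> \<langle>b\<rangle>.\<close>
definition W_almost_unperforated :: "(complex \<Rightarrow> 'a \<Rightarrow> 'a) \<Rightarrow> ('a \<Rightarrow> 'a) \<Rightarrow> ('a::real_normed_algebra_1) itself \<Rightarrow> bool" where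
  "W_almost_unperforated sc st _ \<longleftrightarrow>
     (\<forall>a b :: nat \<Rightarrow> nat \<Rightarrow> 'a. \<forall>k k' :: nat. mpos st a \<and> mpos st b \<and> k' < k \<and>
        cuntz_le sc st (mrep k a) (mrep k' b) \<longrightarrow> cuntz_le sc st a b)"

definition stably_finite :: "('a \<Rightarrow> 'a) \<Rightarrow> ('a::real_normed_algebra_1) itself \<Rightarrow> bool" where
  "stably_finite st _ \<longleftrightarrow>
     (\<forall>n. \<forall>v :: nat \<Rightarrow> nat \<Rightarrow> 'a. bounded_by n v \<and> mmul (mstar st v) v = eye n \<longrightarrow>
        mmul v (mstar st v) = eye n)"

text \<open>A dimension function is a map M_\<infinity>(A)_+ \<rightarrow> [0,\<infinity>); it is represented as a total
  function whose values off M_\<infinity>(A)_+ are irrelevant (only values on positive elements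
  enter the definitions and the topology below).\<close>
definition is_dimfun :: "(complex \<Rightarrow> 'a \<Rightarrow> 'a) \<Rightarrow> ('a \<Rightarrow> 'a) \<Rightarrow> ((nat \<Rightarrow> nat \<Rightarrow> 'a::real_normed_algebra_1) \<Rightarrow> real) \<Rightarrow> bool" where
  "is_dimfun sc st d \<longleftrightarrow>
     (\<forall>a. mpos st a \<longrightarrow> 0 \<le> d a) \<and>
     d (eye 1) = 1 \<and>
     (\<forall>a b. mpos st a \<and> mpos st b \<and> mmul a b = mzero \<longrightarrow> d (madd a b) = d a + d b) \<and>
     (\<forall>a b. mpos st a \<and> mpos st b \<and> cuntz_le sc st a b \<longrightarrow> d a \<le> d b)"

definition DF :: "(complex \<Rightarrow> 'a \<Rightarrow> 'a) \<Rightarrow> ('a \<Rightarrow> 'a) \<Rightarrow> ((nat \<Rightarrow> nat \<Rightarrow> 'a::real_normed_algebra_1) \<Rightarrow> real) set" where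
  "DF sc st = {d. is_dimfun sc st d}"

definition LDF :: "(complex \<Rightarrow> 'a \<Rightarrow> 'a) \<Rightarrow> ('a \<Rightarrow> 'a) \<Rightarrow> ((nat \<Rightarrow> nat \<Rightarrow> 'a::real_normed_algebra_1) \<Rightarrow> real) set" where
  "LDF sc st = {d \<in> DF sc st. \<forall>a. mpos st a \<longrightarrow> d a = (SUP \<epsilon>\<in>{0<..}. d (fpos sc st \<epsilon> a))}"

text \<open>Density in the topology of pointwise convergence on M_\<infinity>(A)_+: every basic
  neighbourhood (finitely many positive elements, tolerance e) of a point of
  S meets T.\<close>
definition pointwise_dense_in :: "('a \<Rightarrow> 'a) \<Rightarrow> ((nat \<Rightarrow> nat \<Rightarrow> 'a::real_normed_algebra_1) \<Rightarrow> real) set \<Rightarrow> ((nat \<Rightarrow> nat \<Rightarrow> 'a) \<Rightarrow> real) set \<Rightarrow> bool" where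
  "pointwise_dense_in st T S \<longleftrightarrow>
     (\<forall>d\<in>S. \<forall>F. \<forall>e>0. finite F \<and> (\<forall>a\<in>F. mpos st a) \<longrightarrow>
        (\<exists>d'\<in>T. \<forall>a\<in>F. \<bar>d' a - d a\<bar> < e))"

end

theory Submission
  imports Defs "HOL-Library.Multiset"
begin

text \<open>
  If some \<open>d \<in> DF(A)\<close> is not in the closure of the convex set \<open>LDF(A)\<close>, then a separating
  functional with integer coefficients, shifted by a multiple of \<open>\<langle>1\<rangle>\<close>, yields finite direct sums
  \<open>x\<close>, \<open>y\<close> of positive elements with \<open>d(y) < d(x)\<close> but \<open>f(x) < f(y)\<close> for all
  \<open>f \<in> LDF(A)\<close>. The lower semicontinuous regularization \<open>a \<mapsto> sup\<^sub>\<epsilon> g((a - \<epsilon>)\<^sub>+)\<close> of a state \<open>g\<close>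
  lies in \<open>LDF(A)\<close>, hence \<open>g((x - \<epsilon>)\<^sub>+) < g(y)\<close> for every state \<open>g\<close> and every \<open>\<epsilon> > 0\<close>. By almost
  unperforation \<open>(x - \<epsilon>)\<^sub>+ \<oplus> 1 \<precsim> y \<oplus> 1\<close>, and \<open>\<epsilon> \<rightarrow> 0\<close> gives \<open>x \<oplus> 1 \<precsim> y \<oplus> 1\<close>, so
  \<open>d(x) \<le> d(y)\<close>, a contradiction.

  The norm of a matrix \<open>x\<close> over \<open>A\<close> is handled through the cone of matrices \<open>h\<close> with
  \<open>v\<^sup>* h v \<ge> 0\<close> in \<open>A\<close> for all columns \<open>v\<close>, as the least \<open>c \<ge> 0\<close> with \<open>x\<^sup>* x \<le> c\<^sup>2\<close>.
  The bound \<open>\<parallel>p(h)\<parallel> \<le> sup |p|\<close> for \<open>h \<ge> 0\<close> follows from Bernstein's theorem that a polynomial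
  positive on \<open>[0, M]\<close> is a positive combination of the \<open>t\<^sup>i (M - t)\<^sup>j\<close>, without spectral theory.
\<close>

section \<open>The positive cone of the algebra\<close>

text \<open>The prescribed norm of a matrix is a spectral radius, for which not even the triangle
  inequality is evident, and the abstract algebra comes with no Hilbert space to act on. Hence a
  norm read off from an order is built first. That it is a C*-norm is elementary once
  \<open>st b * b\<close> is known to be positive, and \<open>mnorm_ent\<close> identifies the two
  norms; from there on all estimates use the order norm. The cut-down of x is the price of testing
  on LDF only: if h is the regularization of a state g, then g((x - \<epsilon>)_+) \<le> h(x) < h(y)
  \<le> g(y), while g(x) itself may exceed h(x). Cuntz comparison is closed under norm limits of its
  left side, so the cut-down can be undone. The summand 1 on both sides makes the right side
  dominate the order unit, which absorbs the error term in the comparison of states; it cancels in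
  d(x) + 1 \<le> d(y) + 1. Integer coefficients are needed because classes can only be added: the
  real functional is scaled and rounded, and negative terms change sides.\<close>

locale cstar =
  fixes sc :: "complex \<Rightarrow> 'a::{real_normed_algebra_1,banach} \<Rightarrow> 'a"
    and st :: "'a \<Rightarrow> 'a"
  assumes cstar: "cstar_algebra sc st"
begin

lemma
  shows sc_of_real: "sc (complex_of_real r) x = r *\<^sub>R x"
    and sc_mult: "sc (a * b) x = sc a (sc b x)"

    and sc_add_right: "sc a (x + y) = sc a x + sc a y"
    and sc_mult_left: "sc a (x * y) = sc a x * y"
    and sc_mult_right: "sc a (x * y) = x * sc a y"
    and norm_sc: "norm (sc a x) = cmod a * norm x"
    and st_st [simp]: "st (st x) = x"
    and st_add: "st (x + y) = st x + st y"
    and st_sc: "st (sc a x) = sc (cnj a) (st x)"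
    and st_mult: "st (x * y) = st y * st x"
    and norm_st_mult: "norm (st x * x) = (norm x)\<^sup>2"
  using cstar unfolding cstar_algebra_def by - metis+

lemma st_scaleR: "st (r *\<^sub>R x) = r *\<^sub>R st x"
  by (metis st_sc sc_of_real complex_cnj_complex_of_real)

lemma st_0 [simp]: "st 0 = 0"
  using st_scaleR[of 0 0] by simp

lemma st_uminus: "st (- x) = - st x"
  using st_scaleR[of "-1" x] by simp

lemma st_diff: "st (x - y) = st x - st y"
  using st_add[of x "- y"] by (simp add: st_uminus)

lemma st_1 [simp]: "st 1 = 1"
proof -
  have "st 1 = st 1 * st (st 1)" by simp
  also have "\<dots> = st (st 1 * 1)" by (simp only: st_mult)
  finally show ?thesis by simp
qed

lemma st_sum: "st (sum f A) = (\<Sum>i\<in>A. st (f i))"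
  by (induction A rule: infinite_finite_induct) (auto simp: st_add)

lemma norm_st: "norm (st x) = norm x"
proof -
  have "norm x \<le> norm (st x)" for x
  proof (cases "x = 0")
    case False
    have "norm x * norm x \<le> norm (st x) * norm x"
      using norm_st_mult[of x] norm_mult_ineq[of "st x" x] by (simp add: power2_eq_square)
    then show ?thesis using False by simp
  qed auto
  from this[of x] this[of "st x"] show ?thesis by simp
qed

text \<open>The imaginary unit as a central element: the type class has real scalars only, so
  complex arithmetic becomes ring arithmetic with an element of square -1.\<close>

definition iu :: 'a where "iu = sc \<i> 1"

lemma iu_commute: "iu * x = x * iu"
  unfolding iu_def by (metis sc_mult_left sc_mult_right mult_1 mult_1_right)

lemma iu_sq: "iu * iu = - 1"
proof -
  have "iu * iu = sc (\<i> * \<i>) 1"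
    unfolding iu_def by (metis sc_mult sc_mult_left mult_1)
  also have "\<dots> = sc (complex_of_real (-1)) 1" by simp
  finally show ?thesis by (simp only: sc_of_real) simp
qed

lemma iu_assoc: "iu * (iu * x) = - x"
  by (simp add: mult.assoc[symmetric] iu_sq)

lemma st_iu: "st iu = - iu"
proof -
  have "st iu = sc (complex_of_real (-1) * \<i>) 1" by (simp add: iu_def st_sc)
  then show ?thesis by (simp only: sc_mult sc_of_real iu_def) simp
qed

lemma norm_sa_sq: "st h = h \<Longrightarrow> norm (h * h) = (norm h)\<^sup>2"
  using norm_st_mult[of h] by simp

text \<open>The C*-identity controls only squares, so the exponents are powers of two; this suffices
  for the root arguments below.\<close>

lemma norm_sa_power_two: "st h = h \<Longrightarrow> norm (h ^ (2 ^ j)) = norm h ^ (2 ^ j)"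
proof (induction j)
  case (Suc j)
  have s: "st (h ^ n) = h ^ n" for n
    by (induction n) (use Suc.prems in \<open>auto simp: st_mult power_commutes\<close>)
  have "norm (h ^ 2 ^ Suc j) = norm (h ^ 2 ^ j * h ^ 2 ^ j)"
    by (metis mult_2 power_Suc power_add)
  also have "\<dots> = (norm h ^ 2 ^ j)\<^sup>2"
    using norm_sa_sq[OF s] Suc by simp
  finally show ?case by (metis power_Suc2 power_mult)
qed auto

text \<open>Here \<open>r\<close> is the real part of \<open>r + i s\<close>, and \<open>(r + i s)\<^sup>* (r + i s) = r\<^sup>2 + s\<^sup>2\<close>.\<close>
lemma norm_sq_le_sum_sq:
  assumes "st r = r" "st s = s" "r * s = s * r"
  shows "norm (r * r) \<le> norm (r * r + s * s)"
proof -
  define u where "u = r + iu * s"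
  have su: "st u = r - iu * s"
    using assms by (simp add: u_def st_add st_mult st_iu iu_commute)
  have "st u * u = r * r + r * (iu * s) - iu * s * r - iu * s * (iu * s)"
    by (simp add: su) (simp add: u_def algebra_simps)
  also have "r * (iu * s) = iu * s * r"
    using assms(3) by (metis iu_commute mult.assoc)
  also have "iu * s * (iu * s) = - (s * s)"
    by (metis iu_commute iu_assoc mult.assoc mult_minus_right)
  finally have "(norm u)\<^sup>2 = norm (r * r + s * s)"
    using norm_st_mult[of u] by simp
  moreover have "norm r \<le> norm u"
  proof -
    have "u + st u = 2 *\<^sub>R r" unfolding su by (simp add: u_def scaleR_2)
    then have "norm (2 *\<^sub>R r) = norm (u + st u)" by simp
    also have "\<dots> \<le> 2 * norm u" using norm_triangle_ineq[of u "st u"] by (simp add: norm_st)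
    finally show ?thesis by simp
  qed
  ultimately show ?thesis
    using norm_sa_sq[OF assms(1)] by (metis norm_ge_zero power_mono)
qed

text \<open>The root is \<open>1 - y\<close>, where \<open>y\<close> is the fixed point of the contraction
  \<open>y \<mapsto> (x + y\<^sup>2) / 2\<close> of the ball of radius \<open>\<parallel>x\<parallel>\<close>.\<close>
lemma sqrt_one_minus:
  assumes "st x = x" "norm x < 1"
  obtains s where "st s = s" "s * s = 1 - x" "\<And>z. z * x = x * z \<Longrightarrow> z * s = s * z"
proof -
  define q where "q = norm x"
  define S where "S = {y. norm y \<le> q \<and> st y = y \<and> (\<forall>z. z * x = x * z \<longrightarrow> z * y = y * z)}"
  define f where "f y = (1/2) *\<^sub>R (x + y * y)" for y
  have cst: "continuous_on UNIV st"
  proof (rule continuous_on_iff[THEN iffD2], intro ballI allI impI)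
    fix y e assume "e > (0::real)"
    then show "\<exists>d>0. \<forall>y'\<in>UNIV. dist y' y < d \<longrightarrow> dist (st y') (st y) < e"
      by (intro exI[of _ e]) (auto simp: dist_norm st_diff[symmetric] norm_st)
  qed
  have "closed S"
  proof -
    have "S = cball 0 q \<inter> {y. st y = y} \<inter> (\<Inter>z\<in>{z. z * x = x * z}. {y. z * y = y * z})"
      by (auto simp: S_def)
    also have "closed \<dots>"
      by (intro closed_Int closed_INT closed_Collect_eq ballI cst continuous_intros) auto
    finally show ?thesis .
  qed
  then have "complete S" by (simp add: complete_eq_closed)
  moreover have "S \<noteq> {}" using q_def by (auto simp: S_def intro!: exI[of _ 0])
  moreover have "f ` S \<subseteq> S"
  proof (rule image_subsetI)
    fix y assume "y \<in> S"
    then have y: "norm y \<le> q" "st y = y" "\<And>z. z * x = x * z \<Longrightarrow> z * y = y * z"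
      by (auto simp: S_def)
    have "norm (y * y) \<le> q * q"
      using y(1) by (intro order.trans[OF norm_mult_ineq] mult_mono) (auto simp: q_def)
    also have "\<dots> \<le> q" using assms by (simp add: q_def mult_left_le)
    finally have "norm (f y) \<le> q"
      using norm_triangle_ineq[of x "y * y"] by (simp add: f_def q_def)
    moreover have "st (f y) = f y"
      using y(2) assms by (simp add: f_def st_scaleR st_add st_mult)
    moreover have "z * f y = f y * z" if "z * x = x * z" for z
    proof -
      have "z * y = y * z" using y(3) that by blast
      then have "z * (y * y) = y * y * z" by (metis mult.assoc)
      then show ?thesis using that by (simp add: f_def algebra_simps)
    qed
    ultimately show "f y \<in> S" by (simp add: S_def)
  qed
  moreover have "dist (f y) (f z) \<le> q * dist y z" if "y \<in> S" "z \<in> S" for y z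
  proof -
    have nq: "norm y \<le> q" "norm z \<le> q" using that unfolding S_def by blast+
    have "f y - f z = (1/2) *\<^sub>R (y * (y - z) + (y - z) * z)"
      by (simp add: f_def algebra_simps)
    then have "norm (f y - f z) \<le> (1/2) * (norm (y * (y - z)) + norm ((y - z) * z))"
      using norm_triangle_ineq[of "y * (y - z)" "(y - z) * z"] by simp
    also have "norm (y * (y - z)) \<le> q * norm (y - z)"
      using nq by (intro order.trans[OF norm_mult_ineq] mult_right_mono) auto
    also have "norm ((y - z) * z) \<le> norm (y - z) * q"
      using nq by (intro order.trans[OF norm_mult_ineq] mult_left_mono) auto
    finally show ?thesis by (simp add: dist_norm mult.commute)
  qed
  ultimately have "\<exists>!y. y \<in> S \<and> f y = y"
    using assms by (intro Banach_fix[of S q]) (auto simp: q_def)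
  then obtain y where y: "y \<in> S" "f y = y" by auto
  have "2 *\<^sub>R f y = x + y * y" by (simp add: f_def)
  then have "y + y = x + y * y" using y by (simp add: scaleR_2)
  then have "(1 - y) * (1 - y) = 1 - x" by (simp add: algebra_simps)
  moreover have "st (1 - y) = 1 - y"
  proof -
    have "st y = y" using y(1) unfolding S_def by blast
    then show ?thesis by (simp add: st_diff)
  qed
  moreover have "z * (1 - y) = (1 - y) * z" if "z * x = x * z" for z
  proof -
    have "z * y = y * z" using y(1) that unfolding S_def by blast
    then show ?thesis by (simp add: algebra_simps)
  qed
  ultimately show thesis using that by blast
qed

text \<open>For norm less than 1 take s with s^2 = 1 - k^2; it commutes with k, and the norm of s^2
  is at most that of s^2 + k^2 = 1. The boundary case is reached by scaling k.\<close>

lemma norm_one_minus_sq_le: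
  assumes "st k = k" "norm k \<le> 1"
  shows "norm (1 - k * k) \<le> 1"
proof -
  have strict: "norm (1 - k * k) \<le> 1" if "st k = k" "norm k < 1" for k
  proof -
    have "st (k * k) = k * k" using that by (simp add: st_mult)
    moreover have "norm (k * k) < 1"
      using that by (simp add: norm_sa_sq power_less_one_iff abs_square_less_1)
    ultimately obtain s where s: "st s = s" "s * s = 1 - k * k"
      "\<And>z. z * (k * k) = (k * k) * z \<Longrightarrow> z * s = s * z"
      by (rule sqrt_one_minus) blast
    have "s * k = k * s" using s(3)[of k] by (simp add: mult.assoc)
    from norm_sq_le_sum_sq[OF s(1) that(1) this] show ?thesis using s(2) by simp
  qed
  show ?thesis
  proof (rule field_le_epsilon)
    fix e :: real assume e: "e > 0"
    \<comment> \<open>With this \<open>r\<close> the scaled element has norm below 1, and the defect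
      \<open>1 - r\<^sup>2\<close> is at most e.\<close>
    define r where "r = (if e < 1 then sqrt (1 - e) else 0)"
    have r: "0 \<le> r" "r < 1" "1 - r\<^sup>2 \<le> e" using e by (auto simp: r_def)
    have "norm (1 - (r *\<^sub>R k) * (r *\<^sub>R k)) \<le> 1"
      using assms r by (intro strict) (auto simp: st_scaleR mult_le_one intro: le_less_trans[OF mult_left_le])
    moreover have "1 - k * k = (1 - (r *\<^sub>R k) * (r *\<^sub>R k)) + (r\<^sup>2 - 1) *\<^sub>R (k * k)"
      by (simp add: algebra_simps power2_eq_square)
    then have "norm (1 - k * k) \<le> norm (1 - (r *\<^sub>R k) * (r *\<^sub>R k)) + norm ((r\<^sup>2 - 1) *\<^sub>R (k * k))"
      by (metis norm_triangle_ineq)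
    moreover have "norm ((r\<^sup>2 - 1) *\<^sub>R (k * k)) \<le> e"
    proof -
      have "r\<^sup>2 \<le> 1" using r by (simp add: power_le_one)
      moreover have "norm (k * k) \<le> 1" using assms by (simp add: norm_sa_sq power_le_one)
      ultimately have "(1 - r\<^sup>2) * norm (k * k) \<le> 1 - r\<^sup>2" by (simp add: mult_left_le)
      then show ?thesis using r \<open>r\<^sup>2 \<le> 1\<close> by simp
    qed
    ultimately show "norm (1 - k * k) \<le> 1 + e" by linarith
  qed
qed

text \<open>Nonnegativity of the spectrum, stated without spectra: a real t with |t| \<le> norm h is
  nonnegative iff its distance from norm h is at most norm h.\<close>

definition pos :: "'a \<Rightarrow> bool" where
  "pos h \<longleftrightarrow> st h = h \<and> norm (norm h *\<^sub>R 1 - h) \<le> norm h"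

lemma norm_minus_sq_le:
  assumes "st k = k"
  shows "norm (norm (k * k) *\<^sub>R 1 - k * k) \<le> norm (k * k)"
proof (cases "k = 0")
  case False
  define l where "l = (1 / norm k) *\<^sub>R k"
  have "norm (1 - l * l) \<le> 1"
    using assms False by (intro norm_one_minus_sq_le) (auto simp: l_def st_scaleR)
  moreover have "norm (k * k) *\<^sub>R 1 - k * k = (norm k)\<^sup>2 *\<^sub>R (1 - l * l)"
    using False by (simp add: l_def norm_sa_sq[OF assms] scaleR_diff_right power2_eq_square)
  ultimately show ?thesis
    by (simp add: norm_sa_sq[OF assms] mult_left_le)
qed auto

text \<open>\<open>sqrt_one_minus\<close> needs a norm strictly below 1, so (c - h)/c is shrunk by 1
  - d. The square obtained is h + d (c - h), hence only an approximation of h.\<close>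

lemma approx_sq:
  assumes "st h = h" "norm (c *\<^sub>R 1 - h) \<le> c" "e > 0"
  obtains s where "st s = s" "norm (h - s * s) \<le> e" "\<And>z. z * h = h * z \<Longrightarrow> z * s = s * z"
proof (cases "c = 0")
  case True
  then have "h = 0" using assms by simp
  then show ?thesis using that[of 0] assms by simp
next
  case False
  then have c: "c > 0" using assms(2) norm_ge_zero[of "c *\<^sub>R 1 - h"] by linarith
  define d where "d = min (1/2) (e / c)"
  have d: "0 < d" "d < 1" "d * c \<le> e"
    using c assms(3) by (auto simp: d_def min_def field_simps)
  define x where "x = ((1 - d) / c) *\<^sub>R (c *\<^sub>R 1 - h)"
  have "norm x = (1 - d) / c * norm (c *\<^sub>R 1 - h)" using c d by (simp add: x_def)
  also have "\<dots> \<le> (1 - d) / c * c" using c d assms(2) by (intro mult_left_mono) auto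
  also have "\<dots> < 1" using c d by simp
  finally have nx: "norm x < 1" .
  have sx: "st x = x" using assms by (simp add: x_def st_scaleR st_diff)
  obtain s where s: "st s = s" "s * s = 1 - x" "\<And>z. z * x = x * z \<Longrightarrow> z * s = s * z"
    using sqrt_one_minus[OF sx nx] by blast
  define t where "t = sqrt c *\<^sub>R s"
  have "t * t = c *\<^sub>R (1 - x)" using c s(2) by (simp add: t_def)
  also have "c *\<^sub>R x = (1 - d) *\<^sub>R (c *\<^sub>R 1 - h)" using c by (simp add: x_def)
  then have "c *\<^sub>R (1 - x) = h + d *\<^sub>R (c *\<^sub>R 1 - h)"
    by (simp add: algebra_simps)
  finally have "h - t * t = - (d *\<^sub>R (c *\<^sub>R 1 - h))" by simp
  then have "norm (h - t * t) = d * norm (c *\<^sub>R 1 - h)" using d by simp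
  also have "\<dots> \<le> d * c" using d assms by (intro mult_left_mono) auto
  finally have "norm (h - t * t) \<le> e" using d by linarith
  moreover have "z * t = t * z" if "z * h = h * z" for z
  proof -
    have "z * x = x * z" using that by (simp add: x_def algebra_simps)
    then show ?thesis using s(3) by (simp add: t_def)
  qed
  moreover have "st t = t" using s(1) by (simp add: t_def st_scaleR)
  ultimately show thesis using that by blast
qed

text \<open>Any c serves in place of \<open>norm h\<close>: h is a limit of squares, for which
  \<open>norm_minus_sq_le\<close> has the right constant, and the condition in \<open>pos\<close> is
  continuous. This freedom gives closure under sums, where the constants simply add up.\<close>

lemma posI:
  assumes "st h = h" "norm (c *\<^sub>R 1 - h) \<le> c"
  shows "pos h"
  unfolding pos_def
proof (intro conjI assms(1), rule field_le_epsilon)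
  fix e :: real assume "e > 0"
  then obtain s where s: "st s = s" "norm (h - s * s) \<le> e / 3"
    by (metis approx_sq[OF assms, of "e/3"] divide_pos_pos zero_less_numeral)
  have 1: "\<bar>norm h - norm (s * s)\<bar> \<le> e / 3"
    using s norm_triangle_ineq3[of h "s * s"] by linarith
  have "norm h *\<^sub>R 1 - h =
    (norm h - norm (s * s)) *\<^sub>R 1 + ((norm (s * s) *\<^sub>R 1 - s * s) - (h - s * s))"
    by (simp add: algebra_simps)
  also have "norm \<dots> \<le> \<bar>norm h - norm (s * s)\<bar> + (norm (norm (s * s) *\<^sub>R 1 - s * s) + norm (h - s * s))"
    by (intro order.trans[OF norm_triangle_ineq] add_mono norm_triangle_ineq4) auto
  also have "\<dots> \<le> norm h + e"
    using 1 s norm_minus_sq_le[OF s(1)] by linarith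
  finally show "norm (norm h *\<^sub>R 1 - h) \<le> norm h + e" .
qed

lemma pos_approx:
  assumes "pos h" "e > 0"
  obtains s where "st s = s" "norm (h - s * s) \<le> e" "\<And>z. z * h = h * z \<Longrightarrow> z * s = s * z"
  using approx_sq[of h "norm h" e] assms by (metis pos_def)

lemma pos_sq: "st k = k \<Longrightarrow> pos (k * k)"
  by (rule posI[of _ "norm (k * k)"]) (auto simp: st_mult norm_minus_sq_le)

lemma pos_closed:
  assumes "\<And>e. e > 0 \<Longrightarrow> \<exists>y. pos y \<and> norm (x - y) \<le> e"
  shows "pos x"
proof -
  have nb: "norm (st x - x) \<le> e" if "e > 0" for e
  proof -
    have "e / 2 > 0" using that by simp
    from assms[OF this] obtain y where y: "pos y" "norm (x - y) \<le> e / 2" by blast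
    have "norm (st x - x) = norm (st (x - y) - (x - y))" using y by (simp add: st_diff pos_def)
    also have "\<dots> \<le> norm (st (x - y)) + norm (x - y)" by (rule norm_triangle_ineq4)
    finally show ?thesis using y by (simp add: norm_st)
  qed
  have "norm (norm x *\<^sub>R 1 - x) \<le> norm x"
  proof (rule field_le_epsilon)
    fix e :: real assume "e > 0"
    then have "e / 3 > 0" by simp
    from assms[OF this] obtain y where y: "pos y" "norm (x - y) \<le> e / 3" by blast
    have 1: "\<bar>norm x - norm y\<bar> \<le> e / 3" using y norm_triangle_ineq3[of x y] by linarith
    have "norm x *\<^sub>R 1 - x = (norm x - norm y) *\<^sub>R 1 + ((norm y *\<^sub>R 1 - y) - (x - y))"
      by (simp add: algebra_simps)
    also have "norm \<dots> \<le> \<bar>norm x - norm y\<bar> + (norm (norm y *\<^sub>R 1 - y) + norm (x - y))"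
      by (intro order.trans[OF norm_triangle_ineq] add_mono norm_triangle_ineq4) auto
    also have "\<dots> \<le> norm x + e" using 1 y unfolding pos_def by linarith
    finally show "norm (norm x *\<^sub>R 1 - x) \<le> norm x + e" .
  qed
  moreover have "norm (st x - x) \<le> 0" by (rule field_le_epsilon) (use nb in simp)
  ultimately show ?thesis by (simp add: pos_def)
qed

lemma pos_0 [simp]: "pos 0"
  by (simp add: pos_def)

lemma pos_add:
  assumes "pos a" "pos b" shows "pos (a + b)"
proof (rule posI[of _ "norm a + norm b"])
  have "(norm a + norm b) *\<^sub>R 1 - (a + b) = (norm a *\<^sub>R 1 - a) + (norm b *\<^sub>R 1 - b)"
    by (simp add: algebra_simps)
  also have "norm \<dots> \<le> norm a + norm b"
    using assms by (intro order.trans[OF norm_triangle_ineq] add_mono) (auto simp: pos_def)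
  finally show "norm ((norm a + norm b) *\<^sub>R 1 - (a + b)) \<le> norm a + norm b" .
qed (use assms in \<open>auto simp: pos_def st_add\<close>)

lemma pos_scaleR:
  assumes "pos a" "r \<ge> 0" shows "pos (r *\<^sub>R a)"
proof (rule posI[of _ "r * norm a"])
  have "(r * norm a) *\<^sub>R 1 - r *\<^sub>R a = r *\<^sub>R (norm a *\<^sub>R 1 - a)" by (simp add: algebra_simps)
  then show "norm ((r * norm a) *\<^sub>R 1 - r *\<^sub>R a) \<le> r * norm a"
    using assms by (simp add: pos_def mult_left_mono)
qed (use assms in \<open>auto simp: pos_def st_scaleR\<close>)

lemma pos_1: "pos 1"
  using pos_sq[of 1] by simp

lemma pos_sum: "(\<And>i. i \<in> A \<Longrightarrow> pos (f i)) \<Longrightarrow> pos (sum f A)"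
  by (induction A rule: infinite_finite_induct) (auto intro: pos_add)

lemma pos_norm_le: "st a = a \<Longrightarrow> norm a \<le> c \<Longrightarrow> pos (c *\<^sub>R 1 - a)"
  by (rule posI[of _ c]) (auto simp: st_diff st_scaleR)

text \<open>Approximate a by s^2 and b by t^2. Each root commutes with whatever commutes with its
  square's limit, hence s with t, and ab is close to (st)^2.\<close>

lemma pos_mult_commute:
  assumes "pos a" "pos b" "a * b = b * a"
  shows "pos (a * b)"
proof (rule pos_closed)
  fix e :: real assume e: "e > 0"
  \<comment> \<open>The bound 1 keeps the norm of t * t below norm b + 1, the factor that
    \<open>e2\<close> compensates.\<close>
  define e1 where "e1 = min 1 (e / (2 * (norm a + 1)))"
  have e1: "e1 > 0" "e1 \<le> 1" "norm a * e1 \<le> e / 2"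
  proof -
    have "norm a * e1 \<le> norm a * (e / (2 * (norm a + 1)))" by (intro mult_left_mono) (auto simp: e1_def)
    also have "\<dots> = (norm a / (norm a + 1)) * (e / 2)" by simp
    also have "norm a / (norm a + 1) \<le> 1"
      by (rule divide_le_eq_1_pos[THEN iffD2]) (use norm_ge_zero[of a] in linarith)+
    then have "(norm a / (norm a + 1)) * (e / 2) \<le> 1 * (e / 2)" using e by (intro mult_right_mono) auto
    also have "\<dots> = e / 2" by simp
    finally show "norm a * e1 \<le> e / 2" .
    show "e1 > 0" using e by (simp add: e1_def add_nonneg_pos)
  qed (auto simp: e1_def)
  obtain t where t: "st t = t" "norm (b - t * t) \<le> e1" "\<And>z. z * b = b * z \<Longrightarrow> z * t = t * z"
    using pos_approx[OF assms(2) e1(1)] by metis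
  define e2 where "e2 = e / (2 * (norm b + 1))"
  have e2: "e2 > 0" using e by (simp add: e2_def add_nonneg_pos)
  obtain s where s: "st s = s" "norm (a - s * s) \<le> e2" "\<And>z. z * a = a * z \<Longrightarrow> z * s = s * z"
    using pos_approx[OF assms(1) e2] by metis
  have "b * s = s * b" using s(3)[of b] assms(3) by simp
  then have st: "s * t = t * s" using t(3)[of s] by simp
  have "pos ((s * t) * (s * t))" by (rule pos_sq) (use s(1) t(1) st in \<open>simp add: st_mult\<close>)
  moreover have "norm (a * b - (s * t) * (s * t)) \<le> e"
  proof -
    have "(s * t) * (s * t) = (s * s) * (t * t)" using st by (metis mult.assoc)
    then have "a * b - (s * t) * (s * t) = a * (b - t * t) + (a - s * s) * (t * t)"
      by (simp add: algebra_simps)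
    also have "norm \<dots> \<le> norm a * norm (b - t * t) + norm (a - s * s) * norm (t * t)"
      by (intro order.trans[OF norm_triangle_ineq] add_mono norm_mult_ineq)
    also have "norm a * norm (b - t * t) \<le> norm a * e1" using t(2) by (intro mult_left_mono) auto
    also have "norm (t * t) \<le> norm b + 1"
      using t(2) e1 norm_triangle_ineq3[of b "t * t"] by linarith
    also have "norm (a - s * s) * (norm b + 1) \<le> e2 * (norm b + 1)" using s(2) by (intro mult_right_mono) auto
    also have "e2 * (norm b + 1) = e / 2"
      using norm_ge_zero[of b] by (simp add: e2_def divide_simps) (smt (verit) norm_ge_zero)
    finally show ?thesis using e1 by (simp add: mult_left_mono)
  qed
  ultimately show "\<exists>y. pos y \<and> norm (a * b - y) \<le> e" by blast
qed

text \<open>Commuting approximate roots r of a and s of c - a have r^2 + s^2 close to c, and the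
  norm of r^2 is at most that of the sum.\<close>

lemma pos_norm_bound:
  assumes "pos a" "pos (c *\<^sub>R 1 - a)"
  shows "norm a \<le> c"
proof (rule field_le_epsilon)
  fix e :: real assume e: "e > 0"
  obtain r where r: "st r = r" "norm (a - r * r) \<le> e / 3" "\<And>z. z * a = a * z \<Longrightarrow> z * r = r * z"
    using pos_approx[OF assms(1), of "e/3"] e by (metis divide_pos_pos zero_less_numeral)
  obtain s where s: "st s = s" "norm ((c *\<^sub>R 1 - a) - s * s) \<le> e / 3"
     "\<And>z. z * (c *\<^sub>R 1 - a) = (c *\<^sub>R 1 - a) * z \<Longrightarrow> z * s = s * z"
    using pos_approx[OF assms(2), of "e/3"] e by (metis divide_pos_pos zero_less_numeral)
  have "a * r = r * a" using r(3)[of a] by simp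
  then have "r * s = s * r" using s(3)[of r] by (simp add: algebra_simps)
  then have 1: "norm (r * r) \<le> norm (r * r + s * s)" using r(1) s(1) by (intro norm_sq_le_sum_sq)
  \<comment> \<open>As a sum, c times 1 is positive; for c < 0 this would say 2|c| \<le>
    |c|.\<close>
  have "c \<ge> 0"
  proof -
    have "pos (a + (c *\<^sub>R 1 - a))" using assms by (rule pos_add)
    then have "norm (\<bar>c\<bar> *\<^sub>R 1 - c *\<^sub>R (1::'a)) \<le> \<bar>c\<bar>" by (simp add: pos_def)
    then have "\<bar>\<bar>c\<bar> - c\<bar> \<le> \<bar>c\<bar>" by (simp flip: scaleR_left_diff_distrib)
    then show ?thesis by linarith
  qed
  have "r * r + s * s = c *\<^sub>R 1 - (a - r * r) - ((c *\<^sub>R 1 - a) - s * s)" by simp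
  also have "norm \<dots> \<le> norm (c *\<^sub>R (1::'a)) + norm (a - r * r) + norm ((c *\<^sub>R 1 - a) - s * s)"
    by (meson norm_triangle_ineq4 add_right_mono order.trans)
  finally have "norm (r * r) \<le> c + 2 * e / 3" using r(2) s(2) 1 \<open>c \<ge> 0\<close> by simp
  moreover have "norm a \<le> norm (r * r) + norm (a - r * r)" by (metis norm_triangle_sub)
  ultimately show "norm a \<le> c + e" using r(2) by linarith
qed

text \<open>Positivity of (c - a)(c + a) = c^2 - a^2 bounds a^2, and the C*-identity returns to
  a.\<close>

lemma sa_norm_bound:
  assumes "st a = a" "pos (c *\<^sub>R 1 - a)" "pos (c *\<^sub>R 1 + a)" "c \<ge> 0"
  shows "norm a \<le> c"
proof -
  have "pos ((c *\<^sub>R 1 - a) * (c *\<^sub>R 1 + a))"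
    using assms by (intro pos_mult_commute) (auto simp: algebra_simps)
  then have "pos (c\<^sup>2 *\<^sub>R 1 - a * a)" by (simp add: algebra_simps power2_eq_square)
  then have "norm (a * a) \<le> c\<^sup>2" using assms(1) by (intro pos_norm_bound pos_sq)
  then show ?thesis using assms by (simp add: norm_sa_sq power2_le_iff_abs_le)
qed

end

text \<open>For z > 1 Bernoulli's inequality, squared once, makes z^(2^(j+1)) grow at least like
  4^j, which beats a multiple of 2^j.\<close>

lemma power_bound_le_one:
  fixes z :: real
  assumes "z \<ge> 0" "\<And>j::nat. z ^ (2 ^ j) \<le> 1 + C * 2 ^ j"
  shows "z \<le> 1"
proof (rule ccontr)
  assume "\<not> z \<le> 1"
  then have d: "z - 1 > 0" by simp
  have "((z - 1) * 2 ^ j)\<^sup>2 \<le> 1 + C * 2 ^ Suc j" for j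
  proof -
    have "1 + (z - 1) * 2 ^ j \<le> z ^ (2 ^ j)"
      using Bernoulli_inequality[of "z - 1" "2 ^ j"] d by (simp add: mult.commute)
    then have "(z - 1) * 2 ^ j \<le> z ^ (2 ^ j)" by simp
    then have "((z - 1) * 2 ^ j)\<^sup>2 \<le> (z ^ (2 ^ j))\<^sup>2" using d by (intro power_mono) auto
    also have "\<dots> = z ^ (2 ^ Suc j)" by (metis power_Suc2 power_mult)
    finally show ?thesis using assms(2)[of "Suc j"] by linarith
  qed
  then have "(z - 1)\<^sup>2 * 2 ^ j \<le> 1 + 2 * C" if "C \<ge> 0" for j
  proof -
    have "((z - 1)\<^sup>2 * 2 ^ j) * 2 ^ j \<le> 1 + C * 2 ^ Suc j"
      using \<open>((z - 1) * 2 ^ j)\<^sup>2 \<le> _\<close> by (simp add: power2_eq_square algebra_simps)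
    also have "\<dots> \<le> (1 + 2 * C) * 2 ^ j" by (simp add: algebra_simps)
    finally show ?thesis by (simp add: mult_right_le_imp_le)
  qed
  moreover have "C \<ge> 0"
  proof -
    have "1 \<le> z ^ (2 ^ 0)" using d by simp
    then show ?thesis using assms(2)[of 0] by simp
  qed
  moreover obtain j where "(1 + 2 * C) / (z - 1)\<^sup>2 < 2 ^ j"
    using real_arch_pow[of 2] by auto
  then have "1 + 2 * C < (z - 1)\<^sup>2 * 2 ^ j" using d by (simp add: field_simps)
  ultimately show False by (meson not_less)
qed

section \<open>Positivity of \<open>st b * b\<close>\<close>

context cstar begin

text \<open>\<open>(M + y y\<^sup>*)\<^sup>k = M\<^sup>k + y q y\<^sup>*\<close> with \<open>q\<close> a polynomial in \<open>y\<^sup>* y\<close> of norm at most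
  \<open>k L\<^sup>k\<^sup>-\<^sup>1\<close>; now take \<open>2\<^sup>j\<close>-th roots.\<close>
lemma norm_shift_swap:
  assumes M: "M \<ge> 0" "L \<ge> M" and le: "norm (M *\<^sub>R 1 + st y * y) \<le> L"
  shows "norm (M *\<^sub>R 1 + y * st y) \<le> L"
proof (cases "L = 0")
  case True
  then have "y = 0" using M le norm_st_mult[of y] by simp
  then show ?thesis using True M by simp
next
  case False
  then have L: "L > 0" using M by simp
  define X where "X = M *\<^sub>R 1 + y * st y"
  define W where "W = M *\<^sub>R 1 + st y * y"
  have ex: "\<exists>q. X ^ Suc k = M ^ Suc k *\<^sub>R 1 + y * q * st y \<and> norm q \<le> real (Suc k) * L ^ k" for k
  proof (induction k)
    case 0
    show ?case by (rule exI[of _ 1]) (simp add: X_def)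
  next
    case (Suc k)
    then obtain q where q: "X ^ Suc k = M ^ Suc k *\<^sub>R 1 + y * q * st y" "norm q \<le> real (Suc k) * L ^ k"
      by blast
    define q' where "q' = W * q + M ^ Suc k *\<^sub>R 1"
    have "X ^ Suc (Suc k) = X * (M ^ Suc k *\<^sub>R 1 + y * q * st y)" by (simp only: power_Suc[of _ "Suc k"] q)
    also have "\<dots> = M ^ Suc (Suc k) *\<^sub>R 1 + y * q' * st y"
      by (simp add: X_def W_def q'_def algebra_simps)
    finally have 1: "X ^ Suc (Suc k) = M ^ Suc (Suc k) *\<^sub>R 1 + y * q' * st y" .
    have "norm q' \<le> norm W * norm q + M ^ Suc k"
      unfolding q'_def using M
      by (intro order.trans[OF norm_triangle_ineq] add_mono norm_mult_ineq) (simp add: abs_mult)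
    also have "norm W * norm q \<le> L * (real (Suc k) * L ^ k)"
      using le q L by (intro mult_mono) (auto simp: W_def)
    also have "M ^ Suc k \<le> L ^ Suc k" using M by (intro power_mono) auto
    finally have "norm q' \<le> real (Suc (Suc k)) * L ^ Suc k" by (simp add: algebra_simps)
    with 1 show ?case by blast
  qed
  have sX: "st X = X" by (simp add: X_def st_add st_mult st_scaleR)
  define z where "z = norm X / L"
  have "z ^ (2 ^ j) \<le> 1 + ((norm y)\<^sup>2 / L) * 2 ^ j" for j
  proof -
    obtain k where k: "2 ^ j = Suc k" by (metis Suc_pred zero_less_numeral zero_less_power)
    obtain q where q: "X ^ Suc k = M ^ Suc k *\<^sub>R 1 + y * q * st y" "norm q \<le> real (Suc k) * L ^ k"
      using ex by blast
    have "norm X ^ Suc k = norm (X ^ Suc k)" using norm_sa_power_two[OF sX, of j] by (simp only: k)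
    also have "\<dots> \<le> M ^ Suc k + norm (y * q * st y)"
      unfolding q(1) by (rule order.trans[OF norm_triangle_ineq]) (use M in \<open>simp add: abs_mult\<close>)
    also have "norm (y * q * st y) \<le> norm y * norm q * norm y"
      by (metis norm_mult_ineq norm_st mult_right_mono norm_ge_zero order.trans)
    also have "\<dots> \<le> norm y * (real (Suc k) * L ^ k) * norm y"
      using q by (intro mult_mono) (auto simp: L less_imp_le)
    also have "M ^ Suc k \<le> L ^ Suc k" using M by (intro power_mono) auto
    finally have "norm X ^ Suc k \<le> L ^ Suc k + norm y * (real (Suc k) * L ^ k) * norm y" by simp
    also have "\<dots> = L ^ Suc k * (1 + ((norm y)\<^sup>2 / L) * real (Suc k))"
      using L by (simp add: distrib_left power2_eq_square del: of_nat_Suc)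
    finally have "norm X ^ Suc k \<le> L ^ Suc k * (1 + ((norm y)\<^sup>2 / L) * real (Suc k))" .
    then have "z ^ Suc k \<le> 1 + ((norm y)\<^sup>2 / L) * real (Suc k)"
      using L by (simp add: z_def power_divide pos_divide_le_eq mult.commute del: power_Suc)
    moreover have "real (Suc k) = 2 ^ j" by (metis k of_nat_numeral of_nat_power)
    ultimately show ?thesis by (simp add: k)
  qed
  from power_bound_le_one[OF _ this] have "z \<le> 1" using L by (simp add: z_def)
  then show ?thesis using L by (simp add: z_def X_def)
qed

text \<open>Adding M turns the order bound into the norm bound M + d for a positive element, to
  which \<open>norm_shift_swap\<close> applies; \<open>posI\<close> with the constant M + d turns it
  back.\<close>

lemma pos_swap:
  assumes "pos (d *\<^sub>R 1 - st y * y)" "d \<ge> 0"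
  shows "pos (d *\<^sub>R 1 - y * st y)"
proof -
  define M where "M = norm (st y * y)"
  have sa: "st (st y * y) = st y * y" by (simp add: st_mult)
  have "pos (M *\<^sub>R 1 + st y * y)"
    using pos_norm_le[of "- (st y * y)" M] sa by (simp add: M_def st_uminus)
  moreover have "pos ((M + d) *\<^sub>R 1 - (M *\<^sub>R 1 + st y * y))"
    using assms by (simp add: algebra_simps)
  ultimately have "norm (M *\<^sub>R 1 + st y * y) \<le> M + d" by (rule pos_norm_bound)
  then have "norm (M *\<^sub>R 1 + y * st y) \<le> M + d"
    using assms by (intro norm_shift_swap) (auto simp: M_def)
  then show ?thesis
    by (intro posI[of _ "M + d"]) (auto simp: st_diff st_scaleR st_mult algebra_simps)
qed

text \<open>Twice the sum is h^2 + k^2 for the selfadjoint elements h = y + st y and k = iu (y - st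
  y).\<close>

lemma pos_sym_sum: "pos (st y * y + y * st y)"
proof -
  define h where "h = y + st y"
  define k where "k = iu * (y - st y)"
  have "st h = h" by (simp add: h_def st_add add.commute)
  moreover have "st k = k" by (simp add: k_def st_mult st_diff st_iu iu_commute algebra_simps)
  ultimately have "pos (h * h + k * k)" by (intro pos_add pos_sq)
  moreover have "k * k = - ((y - st y) * (y - st y))"
    unfolding k_def by (metis iu_commute iu_assoc mult.assoc)
  then have "h * h + k * k = 2 *\<^sub>R (st y * y + y * st y)"
    by (simp add: h_def algebra_simps scaleR_2)
  ultimately show ?thesis using pos_scaleR[of "2 *\<^sub>R (st y * y + y * st y)" "1/2"] by simp
qed

lemma st_power: "st (g ^ n) = st g ^ n"
  by (induction n) (auto simp: st_mult power_commutes)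

lemma pos_power: "pos g \<Longrightarrow> pos (g ^ n)"
  by (induction n) (auto intro!: pos_mult_commute simp: pos_1 power_commutes)

text \<open>Certificate for (1 - t) t^n \<le> 1/(n+1) on all of t \<ge> 0: the right side is visibly
  nonnegative there. It covers t > 1 as well, as it must, since norm g \<le> 1 is still to be proved
  in \<open>pos_st_mult\<close>.\<close>

lemma one_minus_power_identity:
  fixes g :: 'a
  shows "1 - real (Suc n) *\<^sub>R ((1 - g) * g ^ n) =
    (1 - g) * (1 - g) * (\<Sum>i<n. real (Suc i) *\<^sub>R g ^ i) + g ^ Suc n"
proof (induction n)
  case (Suc n)
  have "(1 - g) * (1 - g) * (\<Sum>i<Suc n. real (Suc i) *\<^sub>R g ^ i) + g ^ Suc (Suc n) =
     ((1 - g) * (1 - g) * (\<Sum>i<n. real (Suc i) *\<^sub>R g ^ i) + g ^ Suc n)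
     + real (Suc n) *\<^sub>R ((1 - g) * (1 - g) * g ^ n) + g ^ Suc (Suc n) - g ^ Suc n"
    by (simp add: algebra_simps)
  also have "\<dots> = 1 - real (Suc n) *\<^sub>R ((1 - g) * g ^ n)
     + real (Suc n) *\<^sub>R ((1 - g) * (1 - g) * g ^ n) + g ^ Suc (Suc n) - g ^ Suc n"
    by (simp only: Suc)
  also have "\<dots> = 1 - real (Suc (Suc n)) *\<^sub>R ((1 - g) * g ^ Suc n)"
    by (simp add: algebra_simps scaleR_2)
  finally show ?case by simp
qed auto

lemma pos_power_bound:
  assumes "pos g"
  shows "pos ((1 / real (Suc n)) *\<^sub>R 1 - (1 - g) * g ^ n)"
proof -
  have s: "st (1 - g) = 1 - g" using assms by (simp add: pos_def st_diff)
  have cm: "(1 - g) * g ^ i = g ^ i * (1 - g)" for i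
    by (simp add: algebra_simps power_commutes)
  have "pos ((1 - g) * (1 - g) * g ^ i)" for i
  proof (rule pos_mult_commute[OF pos_sq[OF s] pos_power[OF assms]])
    have "(1 - g) * (1 - g) * g ^ i = (1 - g) * (g ^ i * (1 - g))" by (simp only: mult.assoc cm)
    also have "\<dots> = g ^ i * ((1 - g) * (1 - g))" by (simp only: mult.assoc[symmetric] cm)
    finally show "(1 - g) * (1 - g) * g ^ i = g ^ i * ((1 - g) * (1 - g))" .
  qed
  then have "pos (\<Sum>i<n. real (Suc i) *\<^sub>R ((1 - g) * (1 - g) * g ^ i))"
    by (intro pos_sum pos_scaleR) auto
  then have "pos ((1 - g) * (1 - g) * (\<Sum>i<n. real (Suc i) *\<^sub>R g ^ i) + g ^ Suc n)"
    by (intro pos_add pos_power assms) (simp add: sum_distrib_left)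
  then have "pos ((1 / real (Suc n)) *\<^sub>R (1 - real (Suc n) *\<^sub>R ((1 - g) * g ^ n)))"
    unfolding one_minus_power_identity by (rule pos_scaleR) simp
  then show ?thesis by (simp add: scaleR_diff_right del: of_nat_Suc)
qed

text \<open>Let \<open>g = 1 - b\<^sup>* b\<close> and \<open>y = b g\<^sup>m\<close>. Then \<open>y\<^sup>* y = (1 - g) g\<^sup>2\<^sup>m\<close> is bounded above by
  \<open>1/(2m+1)\<close>, hence so is \<open>y y\<^sup>*\<close>, and \<open>y\<^sup>* y + y y\<^sup>* \<ge> 0\<close> bounds \<open>y\<^sup>* y\<close> from below. So
  \<open>\<parallel>g\<^sup>n - g\<^sup>n\<^sup>+\<^sup>1\<parallel> = O(1/n)\<close>, which is incompatible with \<open>\<parallel>g\<parallel> > 1\<close>.\<close>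
theorem pos_st_mult: "pos (st b * b)"
proof -
  have main: "pos (st b * b)" if nb: "norm b \<le> 1" for b
  proof -
    define h where "h = st b * b"
    define g where "g = 1 - h"
    have sh: "st h = h" by (simp add: h_def st_mult)
    have nh: "norm h \<le> 1" using nb by (simp add: h_def norm_st_mult power_le_one)
    have sg: "st g = g" using sh by (simp add: g_def st_diff)
    have pg: "pos g" using nh sg by (intro posI[of _ 1]) (auto simp: g_def)
    have bound: "norm ((1 - g) * g ^ (2 * m)) \<le> 1 / real (Suc (2 * m))" for m
    proof -
      define y where "y = b * g ^ m"
      define d where "d = 1 / real (Suc (2 * m))"
      have "st y * y = g ^ m * (1 - g) * g ^ m"
        using sg by (simp add: y_def st_mult st_power g_def h_def mult.assoc)
      also have "g ^ m * (1 - g) = (1 - g) * g ^ m" by (simp add: algebra_simps power_commutes)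
      finally have yy: "st y * y = (1 - g) * g ^ (2 * m)"
        by (simp add: mult.assoc mult_2 power_add)
      have p1: "pos (d *\<^sub>R 1 - st y * y)"
        unfolding yy d_def by (rule pos_power_bound[OF pg])
      then have "pos (d *\<^sub>R 1 - y * st y)" by (rule pos_swap) (simp add: d_def)
      from pos_add[OF this pos_sym_sum[of y]] have p2: "pos (d *\<^sub>R 1 + st y * y)"
        by (simp add: algebra_simps)
      show ?thesis unfolding yy[symmetric] d_def[symmetric]
        using p1 p2 by (intro sa_norm_bound) (auto simp: st_mult d_def)
    qed
    \<comment> \<open>An odd exponent costs one more factor of norm g \<le> 2, which accounts for
      the 4.\<close>
    have bound': "norm ((1 - g) * g ^ k) \<le> 4 / real (Suc k)" for k
    proof (cases "even k")
      case True
      then obtain m where "k = 2 * m" by blast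
      have "1 / real (Suc k) \<le> 4 / real (Suc k)" by (intro divide_right_mono) auto
      then show ?thesis using bound[of m] \<open>k = 2 * m\<close> by simp
    next
      case False
      then obtain m where m: "k = Suc (2 * m)" by (metis oddE Suc_eq_plus1)
      have "norm g \<le> 2" using norm_triangle_ineq4[of 1 h] nh by (simp add: g_def)
      have "norm ((1 - g) * g ^ k) = norm (((1 - g) * g ^ (2 * m)) * g)"
        unfolding m power_Suc2 by (simp add: mult.assoc)
      also have "\<dots> \<le> (1 / real (Suc (2 * m))) * 2"
        by (intro order.trans[OF norm_mult_ineq] mult_mono bound \<open>norm g \<le> 2\<close>) auto
      also have "\<dots> \<le> 4 / real (Suc k)" by (simp add: m divide_simps)
      finally show ?thesis .
    qed
    have tele: "norm (g ^ (n + k) - g ^ n) \<le> real k * (4 / real (Suc n))" for n k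
    proof (induction k)
      case (Suc k)
      have "g ^ (n + Suc k) - g ^ n = (g ^ (n + k) - g ^ n) - (1 - g) * g ^ (n + k)"
        by (simp add: algebra_simps power_commutes)
      also have "norm \<dots> \<le> real k * (4 / real (Suc n)) + 4 / real (Suc n)"
      proof (rule order.trans[OF norm_triangle_ineq4], rule add_mono[OF Suc.IH])
        have "norm ((1 - g) * g ^ (n + k)) \<le> 4 / real (Suc (n + k))" by (rule bound')
        also have "\<dots> \<le> 4 / real (Suc n)" by (intro divide_left_mono) auto
        finally show "norm ((1 - g) * g ^ (n + k)) \<le> 4 / real (Suc n)" .
      qed
      finally show ?case by (simp add: algebra_simps add_divide_distrib)
    qed auto
    \<comment> \<open>From exponent 2^j to 2^(j+1) there are 2^j steps of size at most 4/(2^j + 1),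
      so doubling the exponent adds at most 4 to the norm.\<close>
    have gap: "norm g ^ (2 ^ Suc j) \<le> norm g ^ (2 ^ j) + 4" for j
    proof -
      have "norm (g ^ (2 ^ j + 2 ^ j) - g ^ (2 ^ j)) \<le> real (2 ^ j) * (4 / real (Suc (2 ^ j)))" by (rule tele)
      also have "\<dots> = (real (2 ^ j) / real (Suc (2 ^ j))) * 4" by simp
      also have "real (2 ^ j) / real (Suc (2 ^ j)) \<le> 1"
        by (rule divide_le_eq_1_pos[THEN iffD2], rule of_nat_0_less_iff[THEN iffD2], simp,
            rule of_nat_le_iff[THEN iffD2], simp)
      then have "(real (2 ^ j) / real (Suc (2 ^ j))) * 4 \<le> 1 * 4" by (rule mult_right_mono) simp
      also have "\<dots> = (4::real)" by simp
      finally have "norm (g ^ (2 ^ Suc j) - g ^ (2 ^ j)) \<le> 4" by (simp add: mult_2)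
      then have "norm (g ^ (2 ^ Suc j)) - norm (g ^ (2 ^ j)) \<le> 4"
        using norm_triangle_ineq2 order.trans by blast
      then show ?thesis by (simp only: norm_sa_power_two[OF sg])
    qed
    have "norm g ^ (2 ^ j) \<le> 1 + (norm g + 4) * 2 ^ j" for j
    proof (induction j)
      case (Suc j)
      have "4 * 1 \<le> (norm g + 4) * 2 ^ j" by (rule mult_mono) auto
      moreover have "(norm g + 4) * 2 ^ Suc j = 2 * ((norm g + 4) * 2 ^ j)" by simp
      ultimately show ?case using gap[of j] Suc by linarith
    qed auto
    then have "norm g \<le> 1" by (intro power_bound_le_one) auto
    then show ?thesis using sh by (intro posI[of _ 1]) (auto simp: g_def h_def)
  qed
  show ?thesis
  proof (cases "b = 0")
    case False
    have "pos (st ((1 / norm b) *\<^sub>R b) * ((1 / norm b) *\<^sub>R b))"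
      using False by (intro main) auto
    from pos_scaleR[OF this, of "(norm b)\<^sup>2"] False show ?thesis
      by (simp add: st_scaleR power2_eq_square)
  qed auto
qed

text \<open>With a close to s^2, the conjugate is close to \<open>st (s * t) * (s * t)\<close>,
  which \<open>pos_st_mult\<close> covers.\<close>

lemma pos_conj:
  assumes "pos a" shows "pos (st t * a * t)"
proof (rule pos_closed)
  fix e :: real assume e: "e > 0"
  define d where "d = e / (norm t * norm t + 1)"
  have n: "norm t * norm t + 1 > 0" by (simp add: add_nonneg_pos)
  have d: "d > 0" using e n by (simp add: d_def)
  then obtain s where s: "st s = s" "norm (a - s * s) \<le> d" using pos_approx[OF assms] by metis
  have "pos (st (s * t) * (s * t))" by (rule pos_st_mult)
  moreover have "st (s * t) * (s * t) = st t * (s * s) * t" using s by (simp add: st_mult mult.assoc)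
  moreover have "norm (st t * a * t - st t * (s * s) * t) \<le> e"
  proof -
    have "st t * a * t - st t * (s * s) * t = st t * (a - s * s) * t" by (simp add: algebra_simps)
    also have "norm \<dots> \<le> norm t * d * norm t"
      using s by (intro order.trans[OF norm_mult_ineq] mult_right_mono) (auto simp: norm_st intro: order.trans[OF norm_mult_ineq] mult_left_mono)
    also have "\<dots> \<le> d * (norm t * norm t + 1)" using d by (simp add: algebra_simps)
    also have "\<dots> = e" using n by (simp add: d_def)
    finally show ?thesis .
  qed
  ultimately show "\<exists>y. pos y \<and> norm (st t * a * t - y) \<le> e" by metis
qed

end

section \<open>Finite matrices and their order norm\<close>

text \<open>\<open>mmul\<close> sums up to the size of the left factor, so the ring laws rely on
  finite support. A type of its own turns them into a class instance; the missing unit is replaced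
  by the corner units \<open>fE n\<close>.\<close>

typedef (overloaded) ('a::zero) fmat = "{x :: nat \<Rightarrow> nat \<Rightarrow> 'a. fin_mat x}"
  morphisms ent Fmat
  by (rule exI[of _ mzero]) (simp add: fin_mat_def bounded_by_def mzero_def)

setup_lifting type_definition_fmat

lemma bounded_by_mono: "bounded_by n x \<Longrightarrow> n \<le> m \<Longrightarrow> bounded_by m x"
  unfolding bounded_by_def by (meson order.trans)

lemma bounded_by_msize: "fin_mat x \<Longrightarrow> bounded_by (msize x) x"
  unfolding msize_def fin_mat_def by (rule LeastI_ex)

lemma msize_le: "bounded_by n x \<Longrightarrow> msize x \<le> n"
  unfolding msize_def by (rule Least_le)

lemma mmul_eq:
  fixes x y :: "nat \<Rightarrow> nat \<Rightarrow> 'a::semiring_0"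
  assumes "bounded_by n x"
  shows "mmul x y i j = (\<Sum>k<n. x i k * y k j)"
proof -
  have "bounded_by (msize x) x" using assms by (intro bounded_by_msize) (auto simp: fin_mat_def)
  then show ?thesis unfolding mmul_def using msize_le[OF assms]
    by (intro sum.mono_neutral_left) (auto simp: bounded_by_def)
qed

lemma bounded_by_mmul:
  fixes x y :: "nat \<Rightarrow> nat \<Rightarrow> 'a::semiring_0"
  shows "bounded_by n x \<Longrightarrow> bounded_by n y \<Longrightarrow> bounded_by n (mmul x y)"
  by (subst bounded_by_def) (auto simp: mmul_eq[of n] bounded_by_def)

lemma fin_mat_mmul:
  fixes x y :: "nat \<Rightarrow> nat \<Rightarrow> 'a::semiring_0"
  assumes "fin_mat x" "fin_mat y" shows "fin_mat (mmul x y)"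
proof -
  obtain n m where "bounded_by n x" "bounded_by m y" using assms by (auto simp: fin_mat_def)
  then have "bounded_by (max n m) (mmul x y)"
    by (intro bounded_by_mmul) (auto intro: bounded_by_mono)
  then show ?thesis by (auto simp: fin_mat_def)
qed

lemma fin_mat_binary:
  assumes "fin_mat x" "fin_mat y" "f 0 0 = 0"
  shows "fin_mat (\<lambda>i j. f (x i j) (y i j))"
proof -
  obtain n m where "bounded_by n x" "bounded_by m y" using assms by (auto simp: fin_mat_def)
  then have "bounded_by (max n m) (\<lambda>i j. f (x i j) (y i j))"
    using assms(3) by (auto simp: bounded_by_def)
  then show ?thesis by (auto simp: fin_mat_def)
qed

lemma fin_mat_unary:
  assumes "fin_mat x" "f 0 = 0" shows "fin_mat (\<lambda>i j. f (x i j))"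
  using fin_mat_binary[OF assms(1,1), of "\<lambda>a b. f a"] assms(2) by simp

instantiation fmat :: (real_algebra) real_algebra
begin

lift_definition zero_fmat :: "'a fmat" is "mzero"
  by (simp add: fin_mat_def bounded_by_def mzero_def)
lift_definition plus_fmat :: "'a fmat \<Rightarrow> 'a fmat \<Rightarrow> 'a fmat" is madd
  unfolding madd_def by (rule fin_mat_binary) auto
lift_definition minus_fmat :: "'a fmat \<Rightarrow> 'a fmat \<Rightarrow> 'a fmat" is mdiff
  unfolding mdiff_def by (rule fin_mat_binary) auto
lift_definition uminus_fmat :: "'a fmat \<Rightarrow> 'a fmat" is "\<lambda>x i j. - x i j"
  by (rule fin_mat_unary) auto
lift_definition scaleR_fmat :: "real \<Rightarrow> 'a fmat \<Rightarrow> 'a fmat" is "\<lambda>r x i j. r *\<^sub>R x i j"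
  by (rule fin_mat_unary) auto
lift_definition times_fmat :: "'a fmat \<Rightarrow> 'a fmat \<Rightarrow> 'a fmat" is mmul
  by (rule fin_mat_mmul)

instance
proof
  fix a b c :: "'a fmat" and r s :: real
  show "a * b * c = a * (b * c)"
  proof transfer
    fix a b c :: "nat \<Rightarrow> nat \<Rightarrow> 'a"
    assume "fin_mat a" "fin_mat b" "fin_mat c"
    then obtain n m where nm: "bounded_by n a" "bounded_by m b" by (auto simp: fin_mat_def)
    define k where "k = max n m"
    have k: "bounded_by k a" "bounded_by k b"
      using nm by (auto simp: k_def intro: bounded_by_mono)
    show "mmul (mmul a b) c = mmul a (mmul b c)"
    proof (intro ext)
      fix i j
      have "mmul (mmul a b) c i j = (\<Sum>q<k. \<Sum>p<k. a i p * b p q * c q j)"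
        by (simp add: mmul_eq[OF bounded_by_mmul[OF k]] mmul_eq[OF k(1)] sum_distrib_right)
      also have "\<dots> = (\<Sum>p<k. \<Sum>q<k. a i p * b p q * c q j)" by (rule sum.swap)
      also have "\<dots> = mmul a (mmul b c) i j"
        by (simp add: mmul_eq[OF k(1)] mmul_eq[OF k(2)] sum_distrib_left mult.assoc)
      finally show "mmul (mmul a b) c i j = mmul a (mmul b c) i j" .
    qed
  qed
  show "(a + b) * c = a * c + b * c"
  proof transfer
    fix a b c :: "nat \<Rightarrow> nat \<Rightarrow> 'a"
    assume "fin_mat a" "fin_mat b" "fin_mat c"
    then obtain n m where nm: "bounded_by n a" "bounded_by m b" by (auto simp: fin_mat_def)
    define k where "k = max n m"
    have k: "bounded_by k a" "bounded_by k b"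
      using nm by (auto simp: k_def intro: bounded_by_mono)
    then have "bounded_by k (madd a b)" by (auto simp: bounded_by_def madd_def)
    with k show "mmul (madd a b) c = madd (mmul a c) (mmul b c)"
      by (intro ext) (simp add: mmul_eq[of k] madd_def distrib_right sum.distrib)
  qed
  show "a * (b + c) = a * b + a * c"
    by transfer (simp add: mmul_def madd_def fun_eq_iff distrib_left sum.distrib)
  show "(r *\<^sub>R a) * b = r *\<^sub>R (a * b)"
  proof transfer
    fix a b :: "nat \<Rightarrow> nat \<Rightarrow> 'a" and r :: real
    assume "fin_mat a"
    then obtain k where k: "bounded_by k a" by (auto simp: fin_mat_def)
    then have "bounded_by k (\<lambda>i j. r *\<^sub>R a i j)" by (auto simp: bounded_by_def)
    with k show "mmul (\<lambda>i j. r *\<^sub>R a i j) b = (\<lambda>i j. r *\<^sub>R mmul a b i j)"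
      by (intro ext) (simp add: mmul_eq[of k] scaleR_sum_right)
  qed
  show "a * (r *\<^sub>R b) = r *\<^sub>R (a * b)"
    by transfer (simp add: mmul_def fun_eq_iff scaleR_sum_right)
qed (transfer; simp add: madd_def mdiff_def mzero_def fun_eq_iff algebra_simps)+

end

section \<open>Entries, corners and matrix units\<close>

lemma fin_ent: "fin_mat (ent x)" using ent by simp

lemma ent_Fmat: "fin_mat x \<Longrightarrow> ent (Fmat x) = x" by (simp add: Fmat_inverse)

lemma fmat_eqI: "(\<And>i j. ent x i j = ent y i j) \<Longrightarrow> x = y"
  by (simp add: ent_inject[symmetric] fun_eq_iff)

lemma ent_0 [simp]: "ent 0 i j = 0"
  and ent_add: "ent (x + y) i j = ent x i j + ent y i j"
  and ent_diff: "ent (x - y) i j = ent x i j - ent y i j"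
  and ent_minus: "ent (- x) i j = - ent x i j"
  and ent_scaleR: "ent (r *\<^sub>R x) i j = r *\<^sub>R ent x i j"
  by (transfer; simp add: mzero_def madd_def mdiff_def)+

lemma ent_sum: "ent (sum f A) i j = (\<Sum>a\<in>A. ent (f a) i j)"
  by (induction A rule: infinite_finite_induct) (auto simp: ent_add)

definition inM :: "nat \<Rightarrow> 'a::zero fmat \<Rightarrow> bool" where
  "inM n x \<longleftrightarrow> bounded_by n (ent x)"

lemma inM_ex: "\<exists>n. inM n x" using fin_ent[of x] unfolding fin_mat_def inM_def .

lemma inM_mono: "inM n x \<Longrightarrow> n \<le> m \<Longrightarrow> inM m x"
  unfolding inM_def by (rule bounded_by_mono)

lemma inM_ex2: obtains n where "inM n x" "inM n y"
  by (metis inM_ex inM_mono nle_le)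

lemma ent_mult: "inM n x \<Longrightarrow> ent (x * y) i j = (\<Sum>k<n. ent x i k * ent y k j)"
  unfolding inM_def by transfer (rule mmul_eq)

lemma inM_0 [simp]: "inM n 0"
  and inM_add: "inM n x \<Longrightarrow> inM n y \<Longrightarrow> inM n (x + y)"
  and inM_diff: "inM n x \<Longrightarrow> inM n y \<Longrightarrow> inM n (x - y)"
  and inM_minus: "inM n x \<Longrightarrow> inM n (- x)"
  and inM_scaleR: "inM n x \<Longrightarrow> inM n (r *\<^sub>R x)"
  by (auto simp: inM_def bounded_by_def ent_add ent_diff ent_minus ent_scaleR)

lemma inM_mult: "inM n x \<Longrightarrow> inM n y \<Longrightarrow> inM n (x * y)"
  unfolding inM_def by transfer (rule bounded_by_mmul)

lift_definition fE :: "nat \<Rightarrow> 'a::{real_algebra_1} fmat" is eye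
  unfolding fin_mat_def bounded_by_def eye_def by (metis leD)

lemma ent_fE: "ent (fE n) i j = (if i = j \<and> i < n then 1 else 0)"
  by transfer (simp add: eye_def)

lemma inM_fE [simp]: "inM n (fE n)"
  by (auto simp: inM_def bounded_by_def ent_fE)

lemma fE_left: "inM n x \<Longrightarrow> fE n * x = x"
proof (rule fmat_eqI)
  fix i j assume n: "inM n x"
  have "ent (fE n * x) i j = (\<Sum>k<n. (if i = k \<and> i < n then 1 else 0) * ent x k j)"
    by (simp add: ent_mult[OF inM_fE] ent_fE)
  also have "\<dots> = (\<Sum>k<n. if k = i then ent x k j else 0)"
    by (rule sum.cong) auto
  also have "\<dots> = ent x i j" using n by (auto simp: inM_def bounded_by_def)
  finally show "ent (fE n * x) i j = ent x i j" .
qed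

lemma fE_right: "inM n x \<Longrightarrow> x * fE n = x"
proof (rule fmat_eqI)
  fix i j assume n: "inM n x"
  have "ent (x * fE n) i j = (\<Sum>k<n. ent x i k * (if k = j \<and> k < n then 1 else 0))"
    by (simp add: ent_mult[OF n] ent_fE)
  also have "\<dots> = (\<Sum>k<n. if k = j then ent x i k else 0)"
    by (rule sum.cong) auto
  also have "\<dots> = ent x i j" using n by (auto simp: inM_def bounded_by_def)
  finally show "ent (x * fE n) i j = ent x i j" .
qed

lemma fE_fE [simp]: "fE n * fE n = fE n"
  by (rule fE_left) simp

lift_definition single :: "nat \<Rightarrow> nat \<Rightarrow> 'a::zero \<Rightarrow> 'a fmat" is
  "\<lambda>p q a i j. if i = p \<and> j = q then a else 0"
proof -
  fix p q :: nat and a :: 'a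
  have "bounded_by (Suc (p + q)) (\<lambda>i j. if i = p \<and> j = q then a else 0)"
    by (auto simp: bounded_by_def)
  then show "fin_mat (\<lambda>i j. if i = p \<and> j = q then a else 0)" by (auto simp: fin_mat_def)
qed

lemma ent_single: "ent (single p q a) i j = (if i = p \<and> j = q then a else 0)"
  by transfer simp

lemma inM_single: "p < n \<Longrightarrow> q < n \<Longrightarrow> inM n (single p q a)"
  by (auto simp: inM_def bounded_by_def ent_single)

lemma fmat_eq_sum_single: "inM n x \<Longrightarrow> x = (\<Sum>p<n. \<Sum>q<n. single p q (ent x p q))"
proof (rule fmat_eqI)
  fix i j assume n: "inM n x"
  have "ent (\<Sum>p<n. \<Sum>q<n. single p q (ent x p q)) i j =
    (\<Sum>p<n. \<Sum>q<n. if q = j then (if p = i then ent x p q else 0) else 0)"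
    unfolding ent_sum ent_single by (intro sum.cong refl) auto
  also have "\<dots> = (\<Sum>p<n. if p = i then (if j < n then ent x p j else 0) else 0)"
    by (rule sum.cong) auto
  also have "\<dots> = ent x i j" using n by (auto simp: inM_def bounded_by_def)
  finally show "ent x i j = ent (\<Sum>p<n. \<Sum>q<n. single p q (ent x p q)) i j" by simp
qed

section \<open>Involution and positive cone of finite matrices\<close>

context cstar begin

lemma sc_0_right [simp]: "sc z 0 = 0"
  using norm_sc[of z 0] by simp

definition star :: "'a fmat \<Rightarrow> 'a fmat" where "star x = Fmat (mstar st (ent x))"
definition cs :: "complex \<Rightarrow> 'a fmat \<Rightarrow> 'a fmat" where "cs z x = Fmat (mscal sc z (ent x))"

lemma fin_mstar: "fin_mat x \<Longrightarrow> fin_mat (mstar st x)"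
  unfolding fin_mat_def bounded_by_def mstar_def by (metis st_0)

lemma ent_star: "ent (star x) = mstar st (ent x)"
  unfolding star_def by (intro ent_Fmat fin_mstar fin_ent)

lemma ent_star': "ent (star x) i j = st (ent x j i)"
  by (simp add: ent_star mstar_def)

lemma ent_cs: "ent (cs z x) = mscal sc z (ent x)"
  unfolding cs_def mscal_def by (rule ent_Fmat, rule fin_mat_unary[OF fin_ent]) simp

lemma ent_cs': "ent (cs z x) i j = sc z (ent x i j)"
  by (simp add: ent_cs mscal_def)

lemma inM_star: "inM n x \<Longrightarrow> inM n (star x)"
  by (auto simp: inM_def bounded_by_def ent_star')

lemma inM_cs: "inM n x \<Longrightarrow> inM n (cs z x)"
  by (auto simp: inM_def bounded_by_def ent_cs')

lemma star_star [simp]: "star (star x) = x"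
  and star_0 [simp]: "star 0 = 0"
  and star_add: "star (x + y) = star x + star y"
  and star_diff: "star (x - y) = star x - star y"
  and star_minus: "star (- x) = - star x"
  and star_scaleR: "star (r *\<^sub>R x) = r *\<^sub>R star x"
  by (rule fmat_eqI; simp add: ent_star' ent_add ent_diff ent_minus ent_scaleR
      st_add st_diff st_uminus st_scaleR)+

lemma star_fE [simp]: "star (fE n) = fE n"
  by (rule fmat_eqI) (auto simp: ent_star' ent_fE)

lemma star_mult: "star (x * y) = star y * star x"
proof -
  obtain n where "inM n x" "inM n y" by (rule inM_ex2)
  then show ?thesis
    by (intro fmat_eqI) (simp add: ent_star' ent_mult[of n] inM_star st_sum st_mult)
qed

lemma sc_sum: "sc z (sum f A) = (\<Sum>a\<in>A. sc z (f a))"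
  by (induction A rule: infinite_finite_induct) (auto simp: sc_add_right)

lemma cs_mult_left: "cs z x * y = cs z (x * y)"
proof -
  obtain n where "inM n x" by (metis inM_ex)
  then show ?thesis
    by (intro fmat_eqI) (simp add: ent_cs' ent_mult[of n] inM_cs sc_mult_left sc_sum)
qed

lemma cs_mult_right: "x * cs z y = cs z (x * y)"
proof -
  obtain n where "inM n x" by (metis inM_ex)
  moreover have "a * sc z b = sc z (a * b)" for a b by (metis sc_mult_right)
  ultimately show ?thesis
    by (intro fmat_eqI) (simp add: ent_cs' ent_mult[of n] sc_sum)
qed

lemma star_cs: "star (cs z x) = cs (cnj z) (star x)"
  by (rule fmat_eqI) (simp add: ent_star' ent_cs' st_sc)

lemma cs_cs: "cs z (cs w x) = cs (z * w) x"
  by (rule fmat_eqI) (simp add: ent_cs' sc_mult)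

lemma cs_of_real: "cs (complex_of_real r) x = r *\<^sub>R x"
  by (rule fmat_eqI) (simp add: ent_cs' sc_of_real ent_scaleR)

lemma cs_diff: "cs z (x - y) = cs z x - cs z y"
proof -
  have "sc z (a - b) = sc z a - sc z b" for a b
    using sc_add_right[of z "a - b" b] by (simp add: algebra_simps)
  then show ?thesis by (intro fmat_eqI) (simp add: ent_cs' ent_diff)
qed

text \<open>The positive cone of \<open>M\<^sub>\<infinity>(A)\<close>: positivity is tested on the columns \<open>v\<close>, of which only
  the zeroth one enters the \<open>(0, 0)\<close> entry of \<open>v\<^sup>* x v\<close>.\<close>
definition K :: "'a fmat \<Rightarrow> bool" where
  "K x \<longleftrightarrow> star x = x \<and> (\<forall>v. pos (ent (star v * x * v) 0 0))"

lemma K_sa: "K x \<Longrightarrow> star x = x" by (simp add: K_def)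

lemma K_0 [simp]: "K 0" by (simp add: K_def)

lemma K_add: "K x \<Longrightarrow> K y \<Longrightarrow> K (x + y)"
  by (simp add: K_def star_add distrib_left distrib_right ent_add pos_add)

lemma K_sum: "(\<And>i. i \<in> A \<Longrightarrow> K (f i)) \<Longrightarrow> K (sum f A)"
  by (induction A rule: infinite_finite_induct) (auto intro: K_add)

lemma K_scaleR: "K x \<Longrightarrow> r \<ge> 0 \<Longrightarrow> K (r *\<^sub>R x)"
  by (simp add: K_def star_scaleR ent_scaleR pos_scaleR)

lemma K_scaleR_cancel: "K (r *\<^sub>R x) \<Longrightarrow> r > 0 \<Longrightarrow> K x"
  using K_scaleR[of "r *\<^sub>R x" "1 / r"] by simp

lemma K_conj: "K x \<Longrightarrow> K (star k * x * k)"
proof -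
  assume K: "K x"
  have "pos (ent (star v * (star k * x * k) * v) 0 0)" for v
  proof -
    have "star v * (star k * x * k) * v = star (k * v) * x * (k * v)"
      by (simp add: star_mult mult.assoc)
    then show ?thesis using K by (simp add: K_def)
  qed
  moreover have "star (star k * x * k) = star k * x * k"
    using K by (simp add: K_def star_mult mult.assoc)
  ultimately show ?thesis by (simp add: K_def)
qed

lemma K_conj': "K x \<Longrightarrow> K (k * x * star k)"
  using K_conj[of x "star k"] by simp

text \<open>With w = b v, the tested entry of \<open>star w * w\<close> is the sum of the
  \<open>st (ent w k 0) * ent w k 0\<close>, to which \<open>pos_st_mult\<close> applies.\<close>

lemma K_sq: "K (star b * b)"
proof -
  have "pos (ent (star v * (star b * b) * v) 0 0)" for v
  proof -
    define w where "w = b * v"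
    obtain n where n: "inM n w" by (metis inM_ex)
    have "star v * (star b * b) * v = star w * w" by (simp add: w_def star_mult mult.assoc)
    then show ?thesis
      by (simp add: ent_mult[OF inM_star[OF n]] ent_star' pos_sum pos_st_mult)
  qed
  then show ?thesis by (simp add: K_def star_mult)
qed

lemma K_sa_sq: "star h = h \<Longrightarrow> K (h * h)" using K_sq[of h] by simp

lemma K_fE [simp]: "K (fE n)" using K_sq[of "fE n"] by simp

text \<open>The tested entries of x + e u differ from those of x by e times a fixed element, and
  \<open>pos\<close> is closed. Approximation along one ray is what the later proofs use, so no norm
  on matrices is presupposed.\<close>

lemma K_closed:
  assumes "\<And>e. e > 0 \<Longrightarrow> K (x + e *\<^sub>R u)" "star u = u"
  shows "K x"
proof -
  have "star (x + u) = x + u" using assms(1)[of 1] by (simp add: K_def)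
  then have "star x = x" using assms(2) by (simp add: star_add)
  moreover have "pos (ent (star v * x * v) 0 0)" for v
  proof (rule pos_closed)
    fix e :: real assume e: "e > 0"
    define a where "a = ent (star v * u * v) 0 0"
    define d where "d = e / (norm a + 1)"
    have n: "norm a + 1 > 0" by (simp add: add_nonneg_pos)
    have d: "d > 0" using e n by (simp add: d_def)
    have "pos (ent (star v * (x + d *\<^sub>R u) * v) 0 0)" using assms(1)[OF d] by (simp add: K_def)
    moreover have "ent (star v * (x + d *\<^sub>R u) * v) 0 0 = ent (star v * x * v) 0 0 + d *\<^sub>R a"
      by (simp add: distrib_left distrib_right ent_add ent_scaleR a_def)
    moreover have "norm (d *\<^sub>R a) \<le> e"
    proof -
      have "d * norm a \<le> d * (norm a + 1)" using d by simp
      also have "\<dots> = e" using n by (simp add: d_def)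
      finally show ?thesis using d by simp
    qed
    ultimately show "\<exists>y. pos y \<and> norm (ent (star v * x * v) 0 0 - y) \<le> e"
      by (intro exI[of _ "ent (star v * x * v) 0 0 + d *\<^sub>R a"]) simp
  qed
  ultimately show ?thesis by (simp add: K_def)
qed

section \<open>Order bounds and the order norm\<close>

definition B :: "nat \<Rightarrow> real \<Rightarrow> 'a fmat \<Rightarrow> bool" where
  "B n c x \<longleftrightarrow> K (c\<^sup>2 *\<^sub>R fE n - star x * x)"

lemma K_fE_diff: "n \<le> m \<Longrightarrow> K (fE m - fE n)"
proof -
  assume le: "n \<le> m"
  have nm: "fE m * fE n = (fE n :: 'a fmat)" "fE n * fE m = (fE n :: 'a fmat)"
    using inM_mono[OF inM_fE le] by (auto intro: fE_left fE_right)
  have "(fE m - fE n) * (fE m - fE n) = (fE m - fE n :: 'a fmat)"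
    by (simp add: algebra_simps nm)
  then show ?thesis using K_sa_sq[of "fE m - fE n"] by (simp add: star_diff)
qed

text \<open>Enlarging the corner adds a multiple of the projection \<open>fE m - fE n\<close>;
  compressing by \<open>fE n\<close> goes back.\<close>

lemma B_indep:
  assumes "inM n x" "n \<le> m" shows "B n c x \<longleftrightarrow> B m c x"
proof
  assume "B n c x"
  then have "K ((c\<^sup>2 *\<^sub>R fE n - star x * x) + c\<^sup>2 *\<^sub>R (fE m - fE n))"
    unfolding B_def using assms by (intro K_add K_scaleR K_fE_diff) auto
  then show "B m c x" by (simp add: B_def algebra_simps)
next
  assume "B m c x"
  then have "K (star (fE n) * (c\<^sup>2 *\<^sub>R fE m - star x * x) * fE n)"
    unfolding B_def by (rule K_conj)
  moreover have "fE n * fE m = (fE n :: 'a fmat)"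
    using inM_mono[OF inM_fE assms(2)] by (rule fE_right)
  moreover have "x * fE n = x" "fE n * star x = star x"
    using assms(1) by (auto intro: fE_left fE_right inM_star)
  moreover have "fE n * (star x * x) * fE n = star x * x"
    using calculation(3,4) by (metis mult.assoc)
  ultimately show "B n c x" by (simp add: B_def algebra_simps)
qed

lemma B_mono: "B n c x \<Longrightarrow> 0 \<le> c \<Longrightarrow> c \<le> d \<Longrightarrow> B n d x"
proof -
  assume *: "B n c x" "0 \<le> c" "c \<le> d"
  have "K ((c\<^sup>2 *\<^sub>R fE n - star x * x) + (d\<^sup>2 - c\<^sup>2) *\<^sub>R fE n)"
    using * unfolding B_def by (intro K_add K_scaleR) (auto intro: power_mono)
  then show ?thesis by (simp add: B_def algebra_simps)
qed

lemma B_closed: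
  assumes "\<And>e. e > 0 \<Longrightarrow> B n (c + e) x" "c \<ge> 0"
  shows "B n c x"
  unfolding B_def
proof (rule K_closed)
  fix e :: real assume e: "e > 0"
  define d where "d = sqrt (c\<^sup>2 + e) - c"
  have "sqrt (c\<^sup>2) < sqrt (c\<^sup>2 + e)" using e by (intro real_sqrt_less_mono) simp
  then have "d > 0" using assms(2) by (simp add: d_def)
  then have "B n (c + d) x" by (rule assms(1))
  moreover have "(c + d)\<^sup>2 = c\<^sup>2 + e" using e by (simp add: d_def add_nonneg_nonneg less_imp_le)
  ultimately show "K (c\<^sup>2 *\<^sub>R fE n - star x * x + e *\<^sub>R fE n)"
    by (simp add: B_def algebra_simps)
qed simp

text \<open>With \<open>t = d / c\<close>: \<open>(x + y)\<^sup>*(x + y) \<le> (1 + t) x\<^sup>*x + (1 + 1/t) y\<^sup>*y\<close>.\<close>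
lemma B_add:
  assumes "B n c x" "B n d y" "c > 0" "d > 0"
  shows "B n (c + d) (x + y)"
proof -
  define z where "z = d *\<^sub>R x - c *\<^sub>R y"
  have "K ((1 / (c * d)) *\<^sub>R (star z * z) + (1 + d / c) *\<^sub>R (c\<^sup>2 *\<^sub>R fE n - star x * x)
     + (1 + c / d) *\<^sub>R (d\<^sup>2 *\<^sub>R fE n - star y * y))"
    using assms unfolding B_def by (intro K_add K_scaleR K_sq) auto
  also have "(1 / (c * d)) *\<^sub>R (star z * z) = (d / c) *\<^sub>R (star x * x) + (c / d) *\<^sub>R (star y * y)
     - star x * y - star y * x"
    using assms by (simp add: z_def star_diff star_scaleR algebra_simps)
  also have "(d / c) *\<^sub>R (star x * x) + (c / d) *\<^sub>R (star y * y) - star x * y - star y * x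
     + (1 + d / c) *\<^sub>R (c\<^sup>2 *\<^sub>R fE n - star x * x) + (1 + c / d) *\<^sub>R (d\<^sup>2 *\<^sub>R fE n - star y * y)
     = ((1 + d / c) * c\<^sup>2 + (1 + c / d) * d\<^sup>2) *\<^sub>R fE n - star (x + y) * (x + y)"
    by (simp add: algebra_simps star_add)
  also have "(1 + d / c) * c\<^sup>2 + (1 + c / d) * d\<^sup>2 = (c + d)\<^sup>2"
    using assms by (simp add: field_simps power2_eq_square)
  finally show ?thesis by (simp add: B_def)
qed

lemma B_0: "B n c 0" by (simp add: B_def K_scaleR)

text \<open>The difference splits into a multiple of the projection onto the other coordinates and
  the positive element r = c - st a * a in position (q, q).\<close>

lemma B_single:
  assumes "p < n" "q < n" shows "B n (norm a) (single p q a)"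
proof -
  have e: "star (single p q a) * single p q a = single q q (st a * a)"
  proof (rule fmat_eqI)
    fix i j
    have n: "inM n (star (single p q a))" using assms by (intro inM_star inM_single)
    have "ent (star (single p q a) * single p q a) i j =
      (\<Sum>k<n. if k = p then (if i = q \<and> j = q then st a * a else 0) else 0)"
      unfolding ent_mult[OF n] by (intro sum.cong refl) (auto simp: ent_star' ent_single)
    also have "\<dots> = ent (single q q (st a * a)) i j" using assms by (simp add: ent_single)
    finally show "ent (star (single p q a) * single p q a) i j = ent (single q q (st a * a)) i j" .
  qed
  define c where "c = (norm a)\<^sup>2"
  define r where "r = c *\<^sub>R 1 - st a * a"
  have sr: "st r = r" by (simp add: r_def st_diff st_scaleR st_mult)
  have "pos r" unfolding r_def c_def norm_st_mult[symmetric]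
    by (rule pos_norm_le) (auto simp: st_mult)
  have split: "c *\<^sub>R fE n - single q q (st a * a) = c *\<^sub>R (fE n - single q q 1) + single q q r"
    by (rule fmat_eqI) (auto simp: ent_diff ent_scaleR ent_single ent_add r_def scaleR_diff_right)
  have "K (fE n - single q q 1)"
  proof -
    have "single q q 1 * single q q 1 = (single q q 1 :: 'a fmat)"
      using assms by (intro fmat_eqI) (auto simp: ent_mult[OF inM_single[of q n q]] ent_single
         if_distrib[of "\<lambda>x. x * _"] sum.If_cases intro!: sum.neutral)
    moreover have "fE n * single q q 1 = (single q q 1 :: 'a fmat)"
       "single q q 1 * fE n = (single q q 1 :: 'a fmat)"
      using assms by (auto intro!: fE_left fE_right inM_single)
    moreover have "star (single q q 1) = single q q 1"
      by (rule fmat_eqI) (auto simp: ent_star' ent_single)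
    ultimately show ?thesis
      using K_sa_sq[of "fE n - single q q 1"] by (simp add: star_diff algebra_simps)
  qed
  moreover have "K (single q q r)"
    unfolding K_def
  proof (intro conjI allI)
    show "star (single q q r) = single q q r"
      by (rule fmat_eqI) (auto simp: ent_star' ent_single sr)
    fix v :: "'a fmat"
    obtain m where m: "inM m v" "inM m (single q q r)" by (rule inM_ex2)
    define k where "k = max m (Suc q)"
    have k: "inM k v" "inM k (single q q r)" "q < k"
      using m by (auto simp: k_def intro: inM_mono)
    have s: "ent (single q q r * v) i 0 = (if i = q then r * ent v q 0 else 0)" for i
    proof -
      have "ent (single q q r * v) i 0 = (\<Sum>p<k. if p = q then (if i = q then r * ent v q 0 else 0) else 0)"
        unfolding ent_mult[OF k(2)] by (intro sum.cong refl) (auto simp: ent_single)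
      then show ?thesis using k by simp
    qed
    have "ent (star v * single q q r * v) 0 0 = ent (star v * (single q q r * v)) 0 0"
      by (simp only: mult.assoc)
    also have "\<dots> = (\<Sum>p<k. if p = q then st (ent v q 0) * (r * ent v q 0) else 0)"
      unfolding ent_mult[OF inM_star[OF k(1)]] s ent_star' by (intro sum.cong refl) auto
    also have "\<dots> = st (ent v q 0) * r * ent v q 0" using k by (simp add: mult.assoc)
    finally show "pos (ent (star v * single q q r * v) 0 0)"
      using pos_conj[OF \<open>pos r\<close>] by simp
  qed
  ultimately have "K (c *\<^sub>R fE n - single q q (st a * a))"
    unfolding split by (intro K_add K_scaleR) (auto simp: c_def)
  then show ?thesis by (simp add: B_def e c_def)
qed

text \<open>The best constant in \<open>B\<close>, which \<open>N_set\<close> frees from the choice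
  of corner. It is the operator norm for the action on columns over the algebra.\<close>

definition N :: "'a fmat \<Rightarrow> real" where
  "N x = Inf {c. c \<ge> 0 \<and> (\<exists>n. inM n x \<and> B n c x)}"

text \<open>\<open>B_add\<close> needs positive constants, so each bound is enlarged a little and
  \<open>B_closed\<close> removes the excess.\<close>

lemma B_sum:
  assumes "finite A" "\<And>i. i \<in> A \<Longrightarrow> B n (c i) (f i)" "\<And>i. i \<in> A \<Longrightarrow> c i \<ge> 0"
  shows "B n (sum c A) (sum f A)"
proof (rule B_closed)
  show "0 \<le> sum c A" using assms by (intro sum_nonneg)
  have *: "e > 0 \<Longrightarrow> B n (sum c A + e) (sum f A)" for e
    using assms
  proof (induction A arbitrary: e rule: finite_induct)
    case (insert i A)
    have "B n (sum c A + e / 2) (sum f A)" by (rule insert.IH) (use insert.prems in auto)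
    moreover have "B n (c i + e / 2) (f i)"
      by (rule B_mono[of n "c i"]) (use insert.prems in auto)
    moreover have "c i + e / 2 > 0" "sum c A + e / 2 > 0"
      using insert.prems by (auto intro!: add_nonneg_pos sum_nonneg)
    ultimately have "B n ((c i + e / 2) + (sum c A + e / 2)) (f i + sum f A)" by (intro B_add)
    then show ?case using insert.hyps by (simp add: algebra_simps)
  qed (simp add: B_0)
  then show "e > 0 \<Longrightarrow> B n (sum c A + e) (sum f A)" for e .
qed

text \<open>Makes the infimum in \<open>N\<close> one over a nonempty set, and later lets entrywise
  convergence imply norm convergence.\<close>

lemma B_entries:
  assumes "inM n x" shows "B n (\<Sum>i<n. \<Sum>j<n. norm (ent x i j)) x"
proof -
  have "B n (\<Sum>i<n. \<Sum>j<n. norm (ent x i j)) (\<Sum>p<n. \<Sum>q<n. single p q (ent x p q))"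
    by (intro B_sum B_single sum_nonneg) auto
  then show ?thesis using fmat_eq_sum_single[OF assms] by simp
qed

lemma N_set:
  assumes "inM n x"
  shows "{c. c \<ge> 0 \<and> (\<exists>n. inM n x \<and> B n c x)} = {c. c \<ge> 0 \<and> B n c x}"
proof -
  have "B n c x" if "inM m x" "B m c x" for m c
    using that assms B_indep[of m x n c] B_indep[of n x m c] by (cases "m \<le> n") auto
  then show ?thesis using assms by blast
qed

lemma N_nonneg [simp]: "N x \<ge> 0"
proof -
  obtain n where n: "inM n x" by (metis inM_ex)
  show ?thesis unfolding N_def N_set[OF n]
    by (rule cInf_greatest) (use B_entries[OF n] in \<open>auto intro!: exI[of _ "\<Sum>i<n. \<Sum>j<n. norm (ent x i j)"] sum_nonneg\<close>)
qed

lemma N_le_iff: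
  assumes n: "inM n x" and c: "c \<ge> 0" shows "N x \<le> c \<longleftrightarrow> B n c x"
proof
  assume "B n c x"
  then show "N x \<le> c" unfolding N_def N_set[OF n] using c
    by (intro cInf_lower bdd_belowI[of _ 0]) auto
next
  assume le: "N x \<le> c"
  show "B n c x"
  proof (rule B_closed[OF _ c])
    fix e :: real assume "e > 0"
    with le have lt: "Inf {c. c \<ge> 0 \<and> B n c x} < c + e" unfolding N_def N_set[OF n] by linarith
    have ne: "{c. c \<ge> 0 \<and> B n c x} \<noteq> {}"
      using B_entries[OF n] by (auto intro!: exI[of _ "\<Sum>i<n. \<Sum>j<n. norm (ent x i j)"] sum_nonneg)
    obtain d where "d \<ge> 0" "B n d x" "d < c + e"
      using cInf_lessD[OF ne lt] by blast
    then show "B n (c + e) x" by (auto intro: B_mono[of n d])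
  qed
qed

lemma N_B: "inM n x \<Longrightarrow> B n (N x) x"
  using N_le_iff[of n x "N x"] by simp

lemma N_le_entries: "inM n x \<Longrightarrow> N x \<le> (\<Sum>i<n. \<Sum>j<n. norm (ent x i j))"
  by (subst N_le_iff) (auto intro: B_entries intro!: sum_nonneg)

lemma N_triangle: "N (x + y) \<le> N x + N y"
proof (rule field_le_epsilon)
  fix e :: real assume e: "e > 0"
  obtain n where n: "inM n x" "inM n y" by (rule inM_ex2)
  have "B n ((N x + e / 2) + (N y + e / 2)) (x + y)"
    using e n by (intro B_add B_mono[OF N_B] add_nonneg_pos) auto
  moreover have "0 \<le> (N x + e / 2) + (N y + e / 2)"
    using e N_nonneg[of x] N_nonneg[of y] by linarith
  ultimately show "N (x + y) \<le> N x + N y + e"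
    using N_le_iff[OF inM_add[OF n], of "(N x + e / 2) + (N y + e / 2)"] by simp
qed

text \<open>Tested on the unit column j, the order bound controls the sum over k of the
  \<open>st (ent x k j) * ent x k j\<close>; only the term k = i is kept. This yields definiteness
  of \<open>N\<close> and Cauchy sequences of entries.\<close>

lemma ent_le_N: "norm (ent x i j) \<le> N x"
proof -
  obtain n0 where "inM n0 x" by (metis inM_ex)
  define n where "n = max n0 (Suc (i + j))"
  have n: "inM n x" using \<open>inM n0 x\<close> by (auto simp: n_def intro: inM_mono)
  have ij: "i < n" "j < n" by (auto simp: n_def)
  define v where "v = single j 0 (1::'a)"
  have v: "inM n v" using ij by (simp add: v_def inM_single)
  have xv: "ent (x * v) k 0 = ent x k j" for k
  proof -
    have "ent (x * v) k 0 = (\<Sum>p<n. if p = j then ent x k p else 0)"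
      unfolding ent_mult[OF n] by (rule sum.cong) (auto simp: v_def ent_single)
    then show ?thesis using ij by simp
  qed
  have "ent (star v * v) 0 0 = (\<Sum>p<n. if p = j then 1 else 0)"
    unfolding ent_mult[OF inM_star[OF v]] by (rule sum.cong) (auto simp: v_def ent_single ent_star')
  then have vv: "ent (star v * v) 0 0 = 1" using ij by simp
  have "K ((N x)\<^sup>2 *\<^sub>R fE n - star x * x)" using N_B[OF n] by (simp add: B_def)
  then have "pos (ent (star v * ((N x)\<^sup>2 *\<^sub>R fE n - star x * x) * v) 0 0)" by (simp add: K_def)
  also have "star v * ((N x)\<^sup>2 *\<^sub>R fE n - star x * x) * v =
     (N x)\<^sup>2 *\<^sub>R (star v * v) - star (x * v) * (x * v)"
    using fE_right[OF inM_star[OF v]] by (simp add: algebra_simps star_mult)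
  finally have 1: "pos ((N x)\<^sup>2 *\<^sub>R 1 - (\<Sum>k<n. st (ent x k j) * ent x k j))"
    using n v by (simp add: ent_diff ent_scaleR vv ent_mult[OF inM_star[OF inM_mult]] ent_star' xv)
  have "(\<Sum>k<n. st (ent x k j) * ent x k j) = st (ent x i j) * ent x i j
       + (\<Sum>k\<in>{..<n} - {i}. st (ent x k j) * ent x k j)"
    using ij by (intro sum.remove) auto
  with 1 have "pos (((N x)\<^sup>2 *\<^sub>R 1 - st (ent x i j) * ent x i j
      - (\<Sum>k\<in>{..<n} - {i}. st (ent x k j) * ent x k j))
      + (\<Sum>k\<in>{..<n} - {i}. st (ent x k j) * ent x k j))"
    by (intro pos_add pos_sum pos_st_mult) (simp add: algebra_simps)
  then have "pos ((N x)\<^sup>2 *\<^sub>R 1 - st (ent x i j) * ent x i j)" by simp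
  then have "norm (st (ent x i j) * ent x i j) \<le> (N x)\<^sup>2"
    by (intro pos_norm_bound pos_st_mult)
  then show ?thesis by (simp add: norm_st_mult power2_le_iff_abs_le)
qed

lemma N_0 [simp]: "N 0 = 0"
  using N_le_iff[of 0 0 0] N_nonneg[of 0] B_0 by auto

lemma N_eq_0: "N x = 0 \<Longrightarrow> x = 0"
proof (rule fmat_eqI)
  fix i j assume "N x = 0"
  then have "norm (ent x i j) \<le> 0" using ent_le_N[of x i j] by linarith
  then show "ent x i j = ent 0 i j" by simp
qed

lemma N_mult: "N (x * y) \<le> N x * N y"
proof -
  obtain n where n: "inM n x" "inM n y" by (rule inM_ex2)
  have "K (star y * ((N x)\<^sup>2 *\<^sub>R fE n - star x * x) * y + (N x)\<^sup>2 *\<^sub>R ((N y)\<^sup>2 *\<^sub>R fE n - star y * y))"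
    using N_B[OF n(1)] N_B[OF n(2)] by (intro K_add K_conj K_scaleR) (auto simp: B_def)
  also have "star y * ((N x)\<^sup>2 *\<^sub>R fE n - star x * x) * y + (N x)\<^sup>2 *\<^sub>R ((N y)\<^sup>2 *\<^sub>R fE n - star y * y)
     = (N x * N y)\<^sup>2 *\<^sub>R fE n - star (x * y) * (x * y)"
    using fE_right[OF inM_star[OF n(2)]]
    by (simp add: algebra_simps star_mult power_mult_distrib)
  finally show ?thesis using N_le_iff[OF inM_mult[OF n], of "N x * N y"] by (simp add: B_def)
qed

lemma N_scaleC: "N (cs z x) = cmod z * N x"
proof (rule antisym)
  have le: "N (cs z x) \<le> cmod z * N x" for z x
  proof -
    obtain n where n: "inM n x" by (metis inM_ex)
    have "z * cnj z = complex_of_real ((cmod z)\<^sup>2)" by (rule complex_norm_square[symmetric])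
    then have "star (cs z x) * cs z x = (cmod z)\<^sup>2 *\<^sub>R (star x * x)"
      by (simp only: star_cs cs_mult_left cs_mult_right cs_cs cs_of_real)
    then have "(cmod z * N x)\<^sup>2 *\<^sub>R fE n - star (cs z x) * cs z x
      = (cmod z)\<^sup>2 *\<^sub>R ((N x)\<^sup>2 *\<^sub>R fE n - star x * x)"
      by (simp add: scaleR_diff_right power_mult_distrib)
    then have "B n (cmod z * N x) (cs z x)"
      using N_B[OF n] unfolding B_def by (simp add: K_scaleR)
    then show ?thesis by (subst N_le_iff[OF inM_cs[OF n]]) auto
  qed
  show "N (cs z x) \<le> cmod z * N x" by (rule le)
  show "cmod z * N x \<le> N (cs z x)"
  proof (cases "z = 0")
    case False
    have "cs (1 / z) (cs z x) = cs (complex_of_real 1) x" using False by (simp add: cs_cs)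
    then have "N x \<le> cmod (1 / z) * N (cs z x)" using le[of "1 / z" "cs z x"] by (simp only: cs_of_real) simp
    then show ?thesis using False by (simp add: norm_divide field_simps)
  qed auto
qed

lemma N_scaleR: "N (r *\<^sub>R x) = \<bar>r\<bar> * N x"
  using N_scaleC[of "complex_of_real r" x] by (simp only: cs_of_real norm_of_real)

lemma N_minus: "N (- x) = N x" using N_scaleR[of "-1" x] by simp

lemma N_diff: "N (x - y) \<le> N x + N y"
  using N_triangle[of x "- y"] by (simp add: N_minus)

lemma N_diff_commute: "N (x - y) = N (y - x)"
  using N_minus[of "x - y"] by simp

lemma N_diff_triangle: "N (x - z) \<le> N (x - y) + N (y - z)"
  using N_triangle[of "x - y" "y - z"] by simp

text \<open>For h = x * star x, conjugating the bound on \<open>star x * x\<close> by x gives c^2 h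
  - h^2 \<ge> 0; adding (c^2 - h)^2 leaves c^2 (c^2 - h).\<close>

lemma N_star: "N (star x) = N x"
proof -
  have le: "N (star x) \<le> N x" for x
  proof (rule field_le_epsilon)
    fix e :: real assume e: "e > 0"
    obtain n where n: "inM n x" by (metis inM_ex)
    define c where "c = N x + e"
    have c: "c > 0" using e by (simp add: c_def add_nonneg_pos)
    have B: "B n c x" by (rule B_mono[OF N_B[OF n]]) (use e in \<open>auto simp: c_def\<close>)
    define h where "h = x * star x"
    have hn: "inM n h" using n by (simp add: h_def inM_mult inM_star)
    have sh: "star h = h" by (simp add: h_def star_mult)
    have 1: "K (c\<^sup>2 *\<^sub>R h - h * h)"
    proof -
      have "K (x * (c\<^sup>2 *\<^sub>R fE n - star x * x) * star x)" using B unfolding B_def by (rule K_conj')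
      also have "x * (c\<^sup>2 *\<^sub>R fE n - star x * x) * star x = c\<^sup>2 *\<^sub>R h - h * h"
        using fE_right[OF n] by (simp add: h_def algebra_simps)
      finally show ?thesis .
    qed
    define w where "w = c\<^sup>2 *\<^sub>R fE n - h"
    have "K (w * w)" by (rule K_sa_sq) (simp add: w_def star_diff star_scaleR sh)
    then have "K (w * w + (c\<^sup>2 *\<^sub>R h - h * h))" using 1 by (rule K_add)
    also have "w * w + (c\<^sup>2 *\<^sub>R h - h * h) = c\<^sup>2 *\<^sub>R (c\<^sup>2 *\<^sub>R fE n - h)"
      using fE_left[OF hn] fE_right[OF hn] by (simp add: w_def algebra_simps)
    finally have "K (c\<^sup>2 *\<^sub>R fE n - h)" by (rule K_scaleR_cancel) (use c in simp)
    then have "B n c (star x)" by (simp add: B_def h_def)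
    then have "N (star x) \<le> c" using c by (subst N_le_iff[OF inM_star[OF n]]) auto
    then show "N (star x) \<le> N x + e" by (simp add: c_def)
  qed
  from le[of x] le[of "star x"] show ?thesis by simp
qed

text \<open>Both d^2 - h^2 and (d - h)^2 are positive, and their sum is 2 d (d - h).\<close>

lemma K_norm_minus:
  assumes "star h = h" "inM n h" "N h \<le> c" shows "K (c *\<^sub>R fE n - h)"
proof (rule K_closed[where u = "fE n"])
  fix e :: real assume e: "e > 0"
  define d where "d = c + e"
  have d: "d > 0" using e assms(3) N_nonneg[of h] unfolding d_def by linarith
  have "B n d h" using N_le_iff[OF assms(2), of d] d assms(3) e by (simp add: d_def)
  then have "K (d\<^sup>2 *\<^sub>R fE n - h * h)" using assms(1) by (simp add: B_def)
  moreover have "K ((d *\<^sub>R fE n - h) * (d *\<^sub>R fE n - h))"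
    by (rule K_sa_sq) (simp add: star_diff star_scaleR assms)
  ultimately have "K ((d\<^sup>2 *\<^sub>R fE n - h * h) + (d *\<^sub>R fE n - h) * (d *\<^sub>R fE n - h))" by (rule K_add)
  also have "(d\<^sup>2 *\<^sub>R fE n - h * h) + (d *\<^sub>R fE n - h) * (d *\<^sub>R fE n - h) = (2 * d) *\<^sub>R (d *\<^sub>R fE n - h)"
    using fE_left[OF assms(2)] fE_right[OF assms(2)]
    by (simp add: algebra_simps power2_eq_square scaleR_2 flip: scaleR_scaleR)
  finally have "K (d *\<^sub>R fE n - h)" by (rule K_scaleR_cancel) (use d in simp)
  then show "K (c *\<^sub>R fE n - h + e *\<^sub>R fE n)" by (simp add: d_def algebra_simps)
qed simp

text \<open>With a = d - h and b = d + h one has a b a + b a b = 2 d (d^2 - h^2); conjugations stand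
  in for the product of commuting positive elements.\<close>

lemma N_sa_le:
  assumes "inM n h" "K (c *\<^sub>R fE n - h)" "K (c *\<^sub>R fE n + h)" "c \<ge> 0"
  shows "N h \<le> c"
proof (rule field_le_epsilon)
  fix e :: real assume e: "e > 0"
  define d where "d = c + e"
  have d: "d > 0" using e assms(4) by (simp add: d_def)
  have "star (c *\<^sub>R fE n - h) = c *\<^sub>R fE n - h" by (rule K_sa[OF assms(2)])
  then have sh: "star h = h" by (simp add: star_diff star_scaleR)
  have "K (e *\<^sub>R fE n)" using e by (simp add: K_scaleR)
  define a where "a = d *\<^sub>R fE n - h"
  define b where "b = d *\<^sub>R fE n + h"
  have "K a" using K_add[OF assms(2) \<open>K (e *\<^sub>R fE n)\<close>] by (simp add: a_def d_def algebra_simps)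
  have "K b" using K_add[OF assms(3) \<open>K (e *\<^sub>R fE n)\<close>] by (simp add: b_def d_def algebra_simps)
  have "K (star a * b * a + star b * a * b)" using \<open>K a\<close> \<open>K b\<close> by (intro K_add K_conj)
  also have "star a * b * a + star b * a * b = (2 * d) *\<^sub>R (d\<^sup>2 *\<^sub>R fE n - star h * h)"
    using fE_left[OF assms(1)] fE_right[OF assms(1)]
    by (simp add: K_sa[OF \<open>K a\<close>] K_sa[OF \<open>K b\<close>] sh)
       (simp add: a_def b_def algebra_simps power2_eq_square scaleR_2 flip: scaleR_scaleR)
  finally have "K (d\<^sup>2 *\<^sub>R fE n - star h * h)" by (rule K_scaleR_cancel) (use d in simp)
  then show "N h \<le> c + e" using N_le_iff[OF assms(1), of d] d by (simp add: B_def d_def)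
qed

lemma N_cstar: "N (star x * x) = (N x)\<^sup>2"
proof (rule antisym)
  show "N (star x * x) \<le> (N x)\<^sup>2" using N_mult[of "star x" x] by (simp add: N_star power2_eq_square)
  obtain n where n: "inM n x" by (metis inM_ex)
  have "K (N (star x * x) *\<^sub>R fE n - star x * x)"
    using n by (intro K_norm_minus) (auto simp: star_mult inM_mult inM_star)
  then have "B n (sqrt (N (star x * x))) x" by (simp add: B_def)
  then have "N x \<le> sqrt (N (star x * x))" by (subst N_le_iff[OF n]) auto
  then show "(N x)\<^sup>2 \<le> N (star x * x)"
    by (metis N_nonneg power_mono real_sqrt_pow2)
qed

lemma N_K_bound: "inM n h \<Longrightarrow> K h \<Longrightarrow> K (c *\<^sub>R fE n - h) \<Longrightarrow> c \<ge> 0 \<Longrightarrow> N h \<le> c"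
  by (rule N_sa_le) (auto intro!: K_add K_scaleR)

text \<open>The limit is taken entrywise within one corner, since the union of all corners is not
  complete.\<close>

lemma N_complete:
  assumes "\<And>k. inM n (x k)" "\<And>e. e > 0 \<Longrightarrow> \<exists>m. \<forall>k\<ge>m. \<forall>l\<ge>m. N (x k - x l) < e"
  obtains y where "inM n y" "(\<lambda>k. N (x k - y)) \<longlonglongrightarrow> 0"
proof -
  have "Cauchy (\<lambda>k. ent (x k) i j)" for i j
  proof (rule CauchyI)
    fix e :: real assume "e > 0"
    then obtain m where "\<forall>k\<ge>m. \<forall>l\<ge>m. N (x k - x l) < e" using assms(2) by blast
    then show "\<exists>m. \<forall>k\<ge>m. \<forall>l\<ge>m. norm (ent (x k) i j - ent (x l) i j) < e"
      using ent_le_N by (metis ent_diff le_less_trans)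
  qed
  then have "\<exists>y. (\<lambda>k. ent (x k) i j) \<longlonglongrightarrow> y" for i j
    by (metis Cauchy_convergent convergent_def)
  then obtain y where y: "\<And>i j. (\<lambda>k. ent (x k) i j) \<longlonglongrightarrow> y i j" by metis
  have bdy: "bounded_by n y"
    unfolding bounded_by_def
  proof (intro allI impI)
    fix i j assume "n \<le> i \<or> n \<le> j"
    then have "(\<lambda>k. ent (x k) i j) = (\<lambda>k. 0)"
      using assms(1) by (auto simp: inM_def bounded_by_def)
    with y[of i j] show "y i j = 0" by (simp add: LIMSEQ_const_iff)
  qed
  define z where "z = Fmat y"
  have ez: "ent z = y" unfolding z_def using bdy by (intro ent_Fmat) (auto simp: fin_mat_def)
  have zn: "inM n z" using bdy by (simp add: inM_def ez)
  have lim: "(\<lambda>k. \<Sum>i<n. \<Sum>j<n. norm (ent (x k - z) i j)) \<longlonglongrightarrow> (\<Sum>i<n. \<Sum>j<n. norm (y i j - y i j))"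
    unfolding ent_diff ez by (intro tendsto_intros y)
  have "(\<lambda>k. N (x k - z)) \<longlonglongrightarrow> 0"
    by (rule tendsto_sandwich[OF _ _ tendsto_const lim[simplified]])
       (auto intro!: always_eventually N_le_entries inM_diff assms(1) zn)
  then show thesis using that zn by blast
qed

end

section \<open>Polynomial calculus and the spectral radius norm\<close>

text \<open>The ratio is the Bernstein coefficient of t^j in degree m, and uniformity in i is the
  point. The induction compares the new factors (i - j)/(m - j) and i/m, which differ by at most
  j/(m - j).\<close>

lemma binomial_ratio_tendsto:
  assumes "e > 0"
  shows "\<exists>m0>j. \<forall>m\<ge>m0. \<forall>i\<le>m. \<bar>real (i choose j) / real (m choose j) - (real i / real m) ^ j\<bar> \<le> e"
  using assms
proof (induction j arbitrary: e)
  case 0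
  then show ?case by (intro exI[of _ 1]) auto
next
  case (Suc j)
  obtain m1 where m1: "m1 > j" "\<And>m i. m \<ge> m1 \<Longrightarrow> i \<le> m \<Longrightarrow>
      \<bar>real (i choose j) / real (m choose j) - (real i / real m) ^ j\<bar> \<le> e / 2"
    using Suc.IH[of "e / 2"] Suc.prems by auto
  obtain m2 :: nat where m2: "real j / (e / 2) < real m2" using reals_Archimedean2 by blast
  \<comment> \<open>The summand \<open>m2\<close> makes j/(m - j) at most e/2.\<close>
  define m0 where "m0 = m1 + m2 + j + 1"
  have "\<bar>real (i choose Suc j) / real (m choose Suc j) - (real i / real m) ^ Suc j\<bar> \<le> e"
    if m: "m \<ge> m0" "i \<le> m" for m i
  proof -
    have mm: "m \<ge> m1" "m > j" "m > 0" using m by (auto simp: m0_def)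
    define R where "R = real (i choose j) / real (m choose j)"
    define x where "x = real i / real m"
    have x: "0 \<le> x" "x \<le> 1" using m by (auto simp: x_def divide_le_eq_1)
    have 1: "\<bar>R - x ^ j\<bar> \<le> e / 2" unfolding R_def x_def using m1(2) mm m by blast
    have abs: "real (Suc j) * real (k choose Suc j) = (real k - real j) * real (k choose j)" for k
      using gbinomial_mult_1[of "real k" j] by (simp add: binomial_gbinomial algebra_simps)
    have eq: "real (i choose Suc j) / real (m choose Suc j) = R * ((real i - real j) / (real m - real j))"
    proof -
      have "real (i choose Suc j) / real (m choose Suc j) =
        (real (Suc j) * real (i choose Suc j)) / (real (Suc j) * real (m choose Suc j))"
        by (subst mult_divide_mult_cancel_left) auto
      also have "\<dots> = R * ((real i - real j) / (real m - real j))"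
        unfolding abs R_def by (simp only: times_divide_times_eq mult.commute)
      finally show ?thesis .
    qed
    show ?thesis
    proof (cases "i < j")
      case True
      \<comment> \<open>Below j the binomial coefficients vanish, so the inductive bound says
        directly that x^j is small.\<close>
      then have "R = 0" by (simp add: R_def)
      then have "x ^ j \<le> e / 2" using 1 x by simp
      moreover have "x ^ Suc j \<le> x ^ j" using x by (simp add: mult_left_le_one_le)
      moreover have "0 \<le> x ^ Suc j" using x by simp
      ultimately show ?thesis unfolding eq x_def[symmetric] using \<open>R = 0\<close> Suc.prems by simp
    next
      case False
      have "0 \<le> R" by (simp add: R_def)
      have "R \<le> 1"
        using m mm binomial_right_mono[of i m j] by (auto simp: R_def divide_le_eq_1)
      define y where "y = (real i - real j) / (real m - real j)"
      have "x - y = real j * (real m - real i) / (real m * (real m - real j))"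
        using mm by (simp add: x_def y_def field_simps)
      also have "\<dots> = (real j / (real m - real j)) * ((real m - real i) / real m)" using mm by simp
      finally have xy: "x - y = (real j / (real m - real j)) * ((real m - real i) / real m)" .
      have r: "0 \<le> (real m - real i) / real m" "(real m - real i) / real m \<le> 1"
        using m mm by (auto simp: divide_le_eq_1)
      have j0: "0 \<le> real j / (real m - real j)" using mm by simp
      have "0 \<le> x - y" unfolding xy using r j0 by (intro mult_nonneg_nonneg)
      moreover have "x - y \<le> real j / (real m - real j)" unfolding xy
        by (rule mult_left_le[OF r(2) j0])
      moreover have "real j / (real m - real j) \<le> e / 2"
      proof -
        have "real j < real m2 * (e / 2)" using m2 Suc.prems by (simp add: field_simps)
        also have "\<dots> \<le> (real m - real j) * (e / 2)" using m Suc.prems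
          by (intro mult_right_mono) (auto simp: m0_def)
        finally show ?thesis using mm by (simp add: divide_le_eq mult.commute)
      qed
      ultimately have y: "\<bar>y - x\<bar> \<le> e / 2" by linarith
      have "R * y - x ^ Suc j = R * (y - x) + x * (R - x ^ j)" by (simp add: algebra_simps)
      also have "\<bar>\<dots>\<bar> \<le> \<bar>R * (y - x)\<bar> + \<bar>x * (R - x ^ j)\<bar>" by (rule abs_triangle_ineq)
      also have "\<bar>R * (y - x)\<bar> \<le> 1 * (e / 2)" unfolding abs_mult
        using \<open>0 \<le> R\<close> \<open>R \<le> 1\<close> y by (intro mult_mono) auto
      also have "\<bar>x * (R - x ^ j)\<bar> \<le> 1 * (e / 2)" unfolding abs_mult
        using x 1 by (intro mult_mono) auto
      finally show ?thesis unfolding eq x_def[symmetric] y_def[symmetric] by simp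
    qed
  qed
  moreover have "m0 > Suc j" using m1(1) by (simp add: m0_def)
  ultimately show ?case by blast
qed

text \<open>The Bernstein expansion of t^j on [0, M]: \<open>choose_mult\<close> cancels the
  denominators, and what remains is the binomial theorem for t + (M - t).\<close>

lemma bernstein_identity:
  fixes t M :: real
  assumes "j \<le> m"
  shows "(\<Sum>i\<le>m. real (m choose i) * (real (i choose j) / real (m choose j)) * t ^ i * (M - t) ^ (m - i))
    = t ^ j * M ^ (m - j)"
proof -
  have mj: "real (m choose j) \<noteq> 0" using assms by simp
  have "(\<Sum>i\<le>m. real (m choose i) * (real (i choose j) / real (m choose j)) * t ^ i * (M - t) ^ (m - i))
    = (\<Sum>i\<in>{j..m}. real (m choose i) * (real (i choose j) / real (m choose j)) * t ^ i * (M - t) ^ (m - i))"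
    by (rule sum.mono_neutral_right) (auto simp: not_le)
  also have "\<dots> = (\<Sum>i\<in>{j..m}. real ((m - j) choose (i - j)) * t ^ i * (M - t) ^ (m - i))"
  proof (rule sum.cong[OF refl])
    fix i assume i: "i \<in> {j..m}"
    have "real (m choose i) * real (i choose j) = real (m choose j) * real ((m - j) choose (i - j))"
      using choose_mult[of j i m] i by (metis atLeastAtMost_iff of_nat_mult)
    then have "real (m choose i) * (real (i choose j) / real (m choose j)) = real ((m - j) choose (i - j))"
      using mj by (simp add: field_simps)
    then show "real (m choose i) * (real (i choose j) / real (m choose j)) * t ^ i * (M - t) ^ (m - i) =
      real ((m - j) choose (i - j)) * t ^ i * (M - t) ^ (m - i)" by simp
  qed
  also have "\<dots> = (\<Sum>i\<le>m - j. real ((m - j) choose i) * t ^ (i + j) * (M - t) ^ (m - (i + j)))"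
    using assms by (intro sum.reindex_bij_witness[of _ "\<lambda>i. i + j" "\<lambda>i. i - j"]) auto
  also have "\<dots> = t ^ j * (\<Sum>i\<le>m - j. real ((m - j) choose i) * t ^ i * (M - t) ^ (m - j - i))"
    by (simp add: sum_distrib_left power_add algebra_simps)
  also have "(\<Sum>i\<le>m - j. real ((m - j) choose i) * t ^ i * (M - t) ^ (m - j - i)) = (t + (M - t)) ^ (m - j)"
    by (rule binomial_ring[symmetric])
  finally show ?thesis by simp
qed

text \<open>Up to positive factors, the Bernstein coefficients of p in degree m are close to the
  values p(M i/m), uniformly in i, so for large m they inherit positivity from the minimum of
  p.\<close>

lemma bernstein_positive:
  fixes p :: "real poly"
  assumes M: "M > 0" and p: "\<And>t. 0 \<le> t \<Longrightarrow> t \<le> M \<Longrightarrow> poly p t > 0"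
  shows "\<exists>m c. (\<forall>i\<le>m. c i \<ge> 0) \<and>
    p = (\<Sum>i\<le>m. smult (c i) ([:0, 1:] ^ i * [:M, - 1:] ^ (m - i)))"
proof -
  define k where "k = degree p"
  define a where "a = coeff p"
  have "continuous_on {0..M} (poly p)" by (intro continuous_intros)
  then obtain t0 where t0: "t0 \<in> {0..M}" "\<And>t. t \<in> {0..M} \<Longrightarrow> poly p t0 \<le> poly p t"
    using continuous_attains_inf[of "{0..M}" "poly p"] M by auto
  define d where "d = poly p t0"
  have d: "d > 0" using p t0 by (auto simp: d_def)
  define A where "A = (\<Sum>j\<le>k. \<bar>a j\<bar> * M ^ j)"
  have A: "A \<ge> 0" unfolding A_def using M by (intro sum_nonneg) auto
  \<comment> \<open>Makes the total error A e of a coefficient at most the minimum d.\<close>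
  define e where "e = d / (A + 1)"
  have e: "e > 0" "A * e \<le> d" using d A by (auto simp: e_def field_simps)
  have "\<forall>j. \<exists>m0>j. \<forall>m\<ge>m0. \<forall>i\<le>m. \<bar>real (i choose j) / real (m choose j) - (real i / real m) ^ j\<bar> \<le> e"
    using binomial_ratio_tendsto[OF e(1)] by blast
  then obtain f where f: "\<And>j. f j > j" "\<And>j m i. m \<ge> f j \<Longrightarrow> i \<le> m \<Longrightarrow>
     \<bar>real (i choose j) / real (m choose j) - (real i / real m) ^ j\<bar> \<le> e"
    by metis
  \<comment> \<open>The sum is a common upper bound for the finitely many thresholds.\<close>
  define m where "m = (\<Sum>j\<le>k. f j)"
  have m: "m \<ge> f j" if "j \<le> k" for j
    unfolding m_def using that by (intro member_le_sum) auto
  have mk: "j \<le> m" if "j \<le> k" for j using m[OF that] f(1)[of j] by linarith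
  have m0: "m > 0" using m[of 0] f(1)[of 0] by linarith
  define c where "c i = real (m choose i) * (\<Sum>j\<le>k. a j * M ^ j * (real (i choose j) / real (m choose j))) / M ^ m" for i
  have "c i \<ge> 0" if i: "i \<le> m" for i
  proof -
    define t where "t = M * (real i / real m)"
    have "real i / real m \<le> 1" using i m0 by (simp add: divide_le_eq_1)
    then have t: "t \<in> {0..M}" unfolding t_def using M mult_left_le[of "real i / real m" M] by simp
    have "poly p t - (\<Sum>j\<le>k. a j * M ^ j * (real (i choose j) / real (m choose j)))
      = (\<Sum>j\<le>k. a j * M ^ j * ((real i / real m) ^ j - real (i choose j) / real (m choose j)))"
      unfolding poly_altdef k_def a_def t_def power_mult_distrib right_diff_distrib sum_subtractf
      by (simp only: mult.assoc)
    also have "\<dots> \<le> (\<Sum>j\<le>k. \<bar>a j\<bar> * M ^ j * e)"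
    proof (rule sum_mono)
      fix j assume "j \<in> {..k}"
      then have "\<bar>real (i choose j) / real (m choose j) - (real i / real m) ^ j\<bar> \<le> e"
        using f(2)[OF m i] by simp
      then have "\<bar>a j * M ^ j * ((real i / real m) ^ j - real (i choose j) / real (m choose j))\<bar> \<le> \<bar>a j\<bar> * M ^ j * e"
        unfolding abs_mult using M by (intro mult_mono) (auto simp: abs_minus_commute power_abs)
      then show "a j * M ^ j * ((real i / real m) ^ j - real (i choose j) / real (m choose j)) \<le> \<bar>a j\<bar> * M ^ j * e"
        by linarith
    qed
    also have "\<dots> = A * e" by (simp add: A_def sum_distrib_right)
    also have "\<dots> \<le> d" by (rule e(2))
    also have "d \<le> poly p t" unfolding d_def using t0(2) t by blast
    finally have "(\<Sum>j\<le>k. a j * M ^ j * (real (i choose j) / real (m choose j))) \<ge> 0" by simp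
    then show ?thesis unfolding c_def using M by simp
  qed
  moreover have "p = (\<Sum>i\<le>m. smult (c i) ([:0, 1:] ^ i * [:M, - 1:] ^ (m - i)))"
  proof (rule poly_eq_poly_eq_iff[THEN iffD1], rule ext)
    fix t
    have "poly (\<Sum>i\<le>m. smult (c i) ([:0, 1:] ^ i * [:M, - 1:] ^ (m - i))) t
      = (\<Sum>i\<le>m. \<Sum>j\<le>k. a j * M ^ j / M ^ m *
          (real (m choose i) * (real (i choose j) / real (m choose j)) * t ^ i * (M - t) ^ (m - i)))"
      unfolding c_def by (simp add: poly_sum sum_distrib_left sum_distrib_right sum_divide_distrib algebra_simps)
    also have "\<dots> = (\<Sum>j\<le>k. \<Sum>i\<le>m. a j * M ^ j / M ^ m *
          (real (m choose i) * (real (i choose j) / real (m choose j)) * t ^ i * (M - t) ^ (m - i)))"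
      by (rule sum.swap)
    also have "\<dots> = (\<Sum>j\<le>k. a j * M ^ j / M ^ m * (t ^ j * M ^ (m - j)))"
      unfolding sum_distrib_left[symmetric] using bernstein_identity[OF mk] by (intro sum.cong[OF refl]) simp
    also have "\<dots> = (\<Sum>j\<le>k. a j * t ^ j)"
    proof (rule sum.cong[OF refl])
      fix j assume "j \<in> {..k}"
      then have "M ^ j * M ^ (m - j) = M ^ m" using mk by (simp flip: power_add)
      then show "a j * M ^ j / M ^ m * (t ^ j * M ^ (m - j)) = a j * t ^ j"
        using M by (simp add: field_simps)
    qed
    also have "\<dots> = poly p t" by (simp add: poly_altdef k_def a_def)
    finally show "poly p t = poly (\<Sum>i\<le>m. smult (c i) ([:0, 1:] ^ i * [:M, - 1:] ^ (m - i))) t" by simp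
  qed
  ultimately show ?thesis by blast
qed

text \<open>Horner evaluation in the corner n, with \<open>fE n\<close> for the constant term.
  Unlike \<open>peval\<close> it accepts p(0) \<noteq> 0, as Bernstein's theorem requires; for p(0)
  = 0 the corner does not matter (\<open>pev_indep\<close>) and the two agree
  (\<open>peval_pev\<close>).\<close>

definition pev :: "nat \<Rightarrow> real poly \<Rightarrow> 'a::real_algebra_1 fmat \<Rightarrow> 'a fmat" where
  "pev n p h = fold_coeffs (\<lambda>c acc. c *\<^sub>R fE n + h * acc) p 0"

lemma pev_0 [simp]: "pev n 0 h = 0" by (simp add: pev_def)

lemma pev_pCons [simp]: "pev n (pCons a p) h = a *\<^sub>R fE n + h * pev n p h"
  by (cases "p = 0 \<and> a = 0") (auto simp: pev_def)

lemma inM_pev: "inM n h \<Longrightarrow> inM n (pev n p h)"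
  by (induction p) (auto intro!: inM_add inM_scaleR inM_mult)

lemma pev_add: "pev n (p + q) h = pev n p h + pev n q h"
  by (induction p q rule: poly_induct2) (auto simp: algebra_simps)

lemma pev_smult: "pev n (smult c p) h = c *\<^sub>R pev n p h"
  by (induction p) (auto simp: algebra_simps)

lemma pev_minus: "pev n (- p) h = - pev n p h"
  using pev_smult[of n "-1" p h] by simp

lemma pev_diff: "pev n (p - q) h = pev n p h - pev n q h"
  using pev_add[of n p "- q" h] by (simp add: pev_minus)

lemma pev_sum: "pev n (sum f A) h = (\<Sum>i\<in>A. pev n (f i) h)"
  by (induction A rule: infinite_finite_induct) (auto simp: pev_add)

lemma pev_mult:
  assumes "inM n h" shows "pev n (p * q) h = pev n p h * pev n q h"
proof (induction p)
  case (pCons a p)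
  then show ?case
    using fE_left[OF inM_pev[OF assms, of q]]
    by (simp add: pev_add pev_smult distrib_right mult.assoc)
qed auto

lemma pev_X: "inM n h \<Longrightarrow> pev n [:0, 1:] h = h"
  by (simp add: fE_right)

lemma pev_1: "pev n 1 h = fE n"
  by (simp add: one_pCons)

lemma pev_zero: "pev n p 0 = poly p 0 *\<^sub>R fE n"
  by (cases p) auto

lemma pev_commute: "inM n h \<Longrightarrow> pev n p h * pev n q h = pev n q h * pev n p h"
  by (metis pev_mult mult.commute)

lemma pev_indep:
  assumes "inM n h" "n \<le> m" "poly p 0 = 0" shows "pev n p h = pev m p h"
proof -
  have "h * pev n q h = h * pev m q h" for q
  proof (induction q)
    case (pCons a q)
    then show ?case using fE_right[OF assms(1)] fE_right[OF inM_mono[OF assms(1,2)]]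
      by (simp add: distrib_left)
  qed auto
  moreover obtain q where "p = pCons 0 q" using assms(3) by (cases p) auto
  ultimately show ?thesis by simp
qed

lemma pev_monom_Suc: "inM n h \<Longrightarrow> ent (pev n (monom 1 (Suc k)) h) = mpow (ent h) (Suc k)"
proof (induction k)
  case 0
  then show ?case by (simp add: monom_Suc fE_right pev_1)
next
  case (Suc k)
  then show ?case by (simp add: monom_Suc[of _ "Suc k"] times_fmat.rep_eq)
qed

lemma peval_pev:
  assumes "inM n h" "poly p 0 = 0"
  shows "peval p (ent h) = ent (pev n p h)"
proof (intro ext)
  fix i j
  have "p = (\<Sum>k\<le>degree p. smult (coeff p k) (monom 1 k))"
    using poly_as_sum_of_monoms[of p] by (simp add: smult_monom)
  then have "pev n p h = pev n (\<Sum>k\<le>degree p. smult (coeff p k) (monom 1 k)) h" by simp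
  also have "\<dots> = (\<Sum>k\<le>degree p. coeff p k *\<^sub>R pev n (monom 1 k) h)"
    by (simp add: pev_sum pev_smult)
  also have "\<dots> = (\<Sum>k\<in>{1..degree p}. coeff p k *\<^sub>R pev n (monom 1 k) h)"
    using assms(2) by (intro sum.mono_neutral_right) (auto simp: poly_0_coeff_0 not_le)
  finally have e: "pev n p h = (\<Sum>k\<in>{1..degree p}. coeff p k *\<^sub>R pev n (monom 1 k) h)" .
  have "ent (pev n (monom 1 k) h) = mpow (ent h) k" if "k \<ge> 1" for k
    using pev_monom_Suc[OF assms(1), of "k - 1"] that by simp
  then show "peval p (ent h) i j = ent (pev n p h) i j"
    unfolding e peval_def by (auto simp: ent_sum ent_scaleR intro!: sum.cong)
qed

section \<open>Polynomials of a positive matrix\<close>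

context cstar begin

lemma star_pev:
  assumes "inM n h" "star h = h" shows "star (pev n p h) = pev n p h"
proof (induction p)
  case (pCons a p)
  have "pev n p h * h = h * pev n p h"
    using pev_commute[OF assms(1), of p "[:0, 1:]"] by (simp add: pev_X[OF assms(1)] del: pev_pCons)
  then show ?case using pCons assms by (simp add: star_add star_scaleR star_mult)
qed auto

lemma N_fE_le: "N (fE n) \<le> 1"
  by (subst N_le_iff[of n]) (auto simp: B_def)

text \<open>Modulo squares, \<open>X\<^sup>i (M - X)\<^sup>j\<close> is one of \<open>1\<close>, \<open>X\<close>, \<open>M - X\<close>, and
  \<open>M X (M - X) = (M - X) X (M - X) + X (M - X) X\<close>.\<close>
lemma K_pev_monomial:
  assumes h: "inM n h" "K h" "K (M *\<^sub>R fE n - h)" and M: "M > 0"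
  shows "K (pev n ([:0, 1:] ^ i * [:M, - 1:] ^ j) h)"
proof -
  let ?X = "[:0, 1:] :: real poly" and ?Y = "[:M, - 1:]"
  have sq: "K (pev n (p * p * q) h)" if "K (pev n q h)" for p q
  proof -
    have "K (star (pev n p h) * pev n q h * pev n p h)" using that by (rule K_conj)
    also have "star (pev n p h) * pev n q h * pev n p h = pev n (p * q * p) h"
      using h by (simp add: star_pev[OF h(1) K_sa[OF h(2)]] pev_mult)
    finally show ?thesis by (simp add: ac_simps)
  qed
  have X: "K (pev n ?X h)" using h by (simp add: fE_right)
  have Y: "K (pev n ?Y h)" using h by (simp add: fE_right)
  have XY: "K (pev n (?X * ?Y) h)"
  proof -
    have "K (pev n (?Y * ?Y * ?X) h + pev n (?X * ?X * ?Y) h)" by (intro K_add sq X Y)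
    also have "pev n (?Y * ?Y * ?X) h + pev n (?X * ?X * ?Y) h = pev n ((?Y + ?X) * (?X * ?Y)) h"
      unfolding pev_add[symmetric] by (simp only: algebra_simps)
    also have "?Y + ?X = [:M:]" by simp
    also have "[:M:] * (?X * ?Y) = smult M (?X * ?Y)" by simp
    finally show ?thesis unfolding pev_smult by (rule K_scaleR_cancel[OF _ M])
  qed
  define p where "p = ?X ^ (i div 2) * ?Y ^ (j div 2)"
  have e: "Z ^ k = Z ^ (k div 2) * Z ^ (k div 2) * Z ^ (k mod 2)" for Z :: "real poly" and k
    by (metis div_mult_mod_eq mult_2_right power_add)
  have "?X ^ i * ?Y ^ j = p * p * (?X ^ (i mod 2) * ?Y ^ (j mod 2))"
    unfolding p_def by (subst e[of ?X i], subst e[of ?Y j]) (simp only: ac_simps)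
  moreover have "K (pev n (?X ^ (i mod 2) * ?Y ^ (j mod 2)) h)"
    using X Y XY by (cases "even i"; cases "even j") (auto simp: pev_1 even_iff_mod_2_eq_zero odd_iff_mod_2_eq_one simp del: pev_pCons)
  ultimately show ?thesis using sq by simp
qed

text \<open>Adding e makes p strictly positive, so that Bernstein's theorem writes it as a positive
  combination of products of powers of h and M - h; \<open>K_closed\<close> removes e.\<close>

lemma K_pev:
  assumes h: "inM n h" "K h" "K (M *\<^sub>R fE n - h)" and M: "M > 0"
    and p: "\<And>t. 0 \<le> t \<Longrightarrow> t \<le> M \<Longrightarrow> poly p t \<ge> 0"
  shows "K (pev n p h)"
proof (rule K_closed[where u = "fE n"])
  fix e :: real assume e: "e > 0"
  have "\<exists>m c. (\<forall>i\<le>m. c i \<ge> 0) \<and>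
    p + [:e:] = (\<Sum>i\<le>m. smult (c i) ([:0, 1:] ^ i * [:M, - 1:] ^ (m - i)))"
  proof (rule bernstein_positive[OF M])
    fix t assume "0 \<le> t" "t \<le> M"
    then show "poly (p + [:e:]) t > 0" using p[of t] e by simp
  qed
  then obtain m c where mc: "\<forall>i\<le>m. c i \<ge> 0"
    "p + [:e:] = (\<Sum>i\<le>m. smult (c i) ([:0, 1:] ^ i * [:M, - 1:] ^ (m - i)))" by blast
  have "K (pev n (p + [:e:]) h)"
    unfolding mc(2) pev_sum pev_smult using mc(1)
    by (intro K_sum K_scaleR K_pev_monomial[OF h M]) auto
  then show "K (pev n p h + e *\<^sub>R fE n)" by (simp add: pev_add)
qed simp

text \<open>Apply \<open>K_pev\<close> to C - p and C + p. This estimate replaces the spectral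
  theorem in the construction of the functional calculus.\<close>

lemma N_pev_le:
  assumes h: "inM n h" "K h" "N h \<le> M"
    and p: "\<And>t. 0 \<le> t \<Longrightarrow> t \<le> M \<Longrightarrow> \<bar>poly p t\<bar> \<le> C"
  shows "N (pev n p h) \<le> C"
proof (cases "M > 0")
  case True
  have C: "C \<ge> 0" using p[of 0] True by simp
  have kh: "K (M *\<^sub>R fE n - h)" using h by (intro K_norm_minus) (auto simp: K_sa)
  have "K (pev n ([:C:] - p) h)"
    by (rule K_pev[OF h(1,2) kh True]) (use p in \<open>auto simp: abs_le_iff\<close>)
  moreover have "K (pev n ([:C:] + p) h)"
    by (rule K_pev[OF h(1,2) kh True]) (use p in \<open>fastforce simp: abs_le_iff\<close>)
  ultimately show ?thesis using C
    by (intro N_sa_le[of n]) (auto simp: pev_diff pev_add intro: inM_pev h)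
next
  case False
  \<comment> \<open>Bernstein's theorem needs M > 0; for M = 0 the element h vanishes and only p(0)
    is left.\<close>
  then have "N h = 0" and M: "M = 0" using h(3) N_nonneg[of h] by linarith+
  then have "h = 0" by (intro N_eq_0)
  moreover have "\<bar>poly p 0\<bar> * N (fE n) \<le> C * 1" using p[of 0] M by (intro mult_mono N_fE_le) auto
  ultimately show ?thesis by (simp add: pev_zero N_scaleR)
qed

section \<open>Neumann series and spectral radius\<close>

lemma neumann_right:
  assumes x: "inM n x" "N x < 1"
  obtains z where "inM n z" "(fE n - x) * z = fE n"
proof -
  define q where "q = N x"
  have q: "0 \<le> q" "q < 1" using x by (auto simp: q_def)
  \<comment> \<open>Partial sums of the Neumann series, as iterates of the map whose fixed point
    solves z = 1 + x z.\<close>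
  define S where "S k = ((\<lambda>y. fE n + x * y) ^^ k) 0" for k
  have S0: "S 0 = 0" and SS: "S (Suc k) = fE n + x * S k" for k by (simp_all add: S_def)
  have Sn: "inM n (S k)" for k by (induction k) (auto simp: S0 SS intro!: inM_add inM_mult x)
  have NS: "N (S k) \<le> 1 / (1 - q)" for k
  proof (induction k)
    case (Suc k)
    have "N (S (Suc k)) \<le> N (fE n) + N (x * S k)" unfolding SS by (rule N_triangle)
    also have "\<dots> \<le> 1 + q * (1 / (1 - q))"
      using Suc q by (intro add_mono N_fE_le order.trans[OF N_mult] mult_mono) (auto simp: q_def)
    also have "\<dots> = 1 / (1 - q)" using q by (simp add: field_simps)
    finally show ?case .
  qed (use q in \<open>simp add: S0\<close>)
  have diff: "N (S (k + m) - S k) \<le> q ^ k * (1 / (1 - q))" for k m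
  proof (induction k)
    case (Suc k)
    have "S (Suc k + m) - S (Suc k) = x * (S (k + m) - S k)" by (simp add: SS algebra_simps)
    also have "N \<dots> \<le> q * (q ^ k * (1 / (1 - q)))"
      using Suc q by (intro order.trans[OF N_mult] mult_mono) (auto simp: q_def)
    finally show ?case by simp
  qed (use NS in \<open>simp add: S0\<close>)
  have small: "\<exists>k. q ^ k * (1 / (1 - q)) < e" if "e > 0" for e
  proof -
    have "(\<lambda>k. q ^ k * (1 / (1 - q))) \<longlonglongrightarrow> 0 * (1 / (1 - q))"
      using q by (intro tendsto_intros LIMSEQ_power_zero) auto
    then have "eventually (\<lambda>k. q ^ k * (1 / (1 - q)) < e) sequentially"
      using that by (intro order_tendstoD(2)) auto
    then show ?thesis by (rule eventually_happens'[rotated]) simp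
  qed
  have "\<exists>m. \<forall>k\<ge>m. \<forall>l\<ge>m. N (S k - S l) < e" if e: "e > 0" for e
  proof -
    obtain m where m: "q ^ m * (1 / (1 - q)) < e / 2" using small[of "e / 2"] e by auto
    have "N (S k - S l) < e" if "k \<ge> m" "l \<ge> m" for k l
    proof -
      have "N (S k - S m) < e / 2"
        using diff[of m "k - m"] that(1) m by (simp only: le_add_diff_inverse)
      moreover have "N (S m - S l) < e / 2"
        using diff[of m "l - m"] that(2) m by (simp only: le_add_diff_inverse N_diff_commute[of "S m"])
      ultimately show ?thesis using N_diff_triangle[of "S k" "S l" "S m"] by linarith
    qed
    then show ?thesis by blast
  qed
  from N_complete[of n S, OF Sn this] obtain z where z: "inM n z" "(\<lambda>k. N (S k - z)) \<longlonglongrightarrow> 0" by blast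
  have "N (fE n + x * z - z) \<le> N (S (Suc k) - z) + q * N (S k - z)" for k
  proof -
    have "fE n + x * z - z = (S (Suc k) - z) - x * (S k - z)" by (simp add: SS algebra_simps)
    also have "N \<dots> \<le> N (S (Suc k) - z) + N (x * (S k - z))" by (rule N_diff)
    also have "N (x * (S k - z)) \<le> q * N (S k - z)" unfolding q_def by (rule N_mult)
    finally show ?thesis by simp
  qed
  moreover have "(\<lambda>k. N (S (Suc k) - z) + q * N (S k - z)) \<longlonglongrightarrow> 0 + q * 0"
    by (intro tendsto_intros z(2) LIMSEQ_Suc)
  ultimately have "N (fE n + x * z - z) \<le> 0"
    using LIMSEQ_le_const[of "\<lambda>k. N (S (Suc k) - z) + q * N (S k - z)" 0] by auto
  then have "fE n + x * z - z = 0" by (intro N_eq_0) (use N_nonneg in \<open>auto intro: antisym\<close>)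
  then have "(fE n - x) * z = fE n" using fE_left[OF z(1)] by (simp add: algebra_simps)
  then show thesis using that z(1) by blast
qed

text \<open>A left inverse comes from a right inverse of the adjoint, and the two inverses
  coincide.\<close>

lemma neumann:
  assumes x: "inM n x" "N x < 1"
  obtains z where "inM n z" "(fE n - x) * z = fE n" "z * (fE n - x) = fE n"
proof -
  obtain z where z: "inM n z" "(fE n - x) * z = fE n" using neumann_right[OF x] by blast
  obtain w where w: "inM n w" "(fE n - star x) * w = fE n"
    using neumann_right[of n "star x"] x by (auto simp: inM_star N_star)
  have w2: "star w * (fE n - x) = fE n"
    using arg_cong[OF w(2), of star] by (simp add: star_mult star_diff)
  have "star w = star w * ((fE n - x) * z)" using fE_right[OF inM_star[OF w(1)]] z by simp
  also have "\<dots> = z" using w2 fE_left[OF z(1)] by (simp flip: mult.assoc)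
  finally show thesis using that z w2 by simp
qed

lemma invertible_in_ent:
  fixes y :: "'a fmat"
  shows "invertible_in n (ent y) \<longleftrightarrow> (\<exists>z. inM n z \<and> y * z = fE n \<and> z * y = fE n)"
proof -
  have *: "\<exists>w. z = ent w" if "bounded_by n z" for z :: "nat \<Rightarrow> nat \<Rightarrow> 'a"
  proof -
    have "ent (Fmat z) = z" by (rule ent_Fmat) (use that in \<open>auto simp: fin_mat_def\<close>)
    then show ?thesis by metis
  qed
  have "invertible_in n (ent y) \<longleftrightarrow>
    (\<exists>z. bounded_by n (ent z) \<and> mmul (ent y) (ent z) = eye n \<and> mmul (ent z) (ent y) = eye n)"
  proof
    assume "invertible_in n (ent y)"
    then obtain z where z: "bounded_by n z" "mmul (ent y) z = eye n" "mmul z (ent y) = eye n"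
      unfolding invertible_in_def by blast
    obtain w where "z = ent w" using *[OF z(1)] by blast
    with z show "\<exists>z. bounded_by n (ent z) \<and> mmul (ent y) (ent z) = eye n \<and> mmul (ent z) (ent y) = eye n"
      by blast
  qed (auto simp: invertible_in_def)
  then show ?thesis
    by (simp add: inM_def ent_inject[symmetric] times_fmat.rep_eq fE.rep_eq)
qed

lemma mspec_ent: "mspec sc n (ent y) = {z. \<not> (\<exists>w. inM n w \<and> (cs z (fE n) - y) * w = fE n \<and> w * (cs z (fE n) - y) = fE n)}"
  unfolding mspec_def invertible_in_ent[symmetric] minus_fmat.rep_eq ent_cs fE.rep_eq ..

lemma spec_bound:
  assumes h: "inM n h" and z: "z \<in> mspec sc n (ent h)"
  shows "cmod z \<le> N h"
proof (rule ccontr)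
  assume "\<not> cmod z \<le> N h"
  then have gt: "N h < cmod z" by simp
  then have z0: "z \<noteq> 0" using N_nonneg[of h] by (auto simp del: N_nonneg)
  define x where "x = cs (1 / z) h"
  have "N x < 1" using gt z0 by (simp add: x_def N_scaleC norm_divide divide_less_eq)
  then obtain w where w: "inM n w" "(fE n - x) * w = fE n" "w * (fE n - x) = fE n"
    using neumann[of n x] h by (auto simp: x_def inM_cs)
  have one: "cs 1 y = y" for y using cs_of_real[of 1 y] by simp
  have e: "cs z (fE n) - h = cs z (fE n - x)" using z0 by (simp add: x_def cs_diff cs_cs one)
  have "(cs z (fE n) - h) * cs (1 / z) w = fE n" "cs (1 / z) w * (cs z (fE n) - h) = fE n"
    unfolding e using w z0 by (simp_all add: cs_mult_left cs_mult_right cs_cs one)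
  then show False using z inM_cs[OF w(1), of "1 / z"] unfolding mspec_ent by blast
qed

lemma N_power_two:
  assumes "inM n h" "star h = h"
  shows "N (pev n ([:0, 1:] ^ (2 ^ j)) h) = N h ^ (2 ^ j)"
proof (induction j)
  case 0
  then show ?case using pev_X[OF assms(1)] by (simp del: pev_pCons)
next
  case (Suc j)
  define P where "P = pev n ([:0, 1:] ^ (2 ^ j)) h"
  have "pev n ([:0, 1:] ^ (2 ^ Suc j)) h = P * P"
    unfolding P_def pev_mult[OF assms(1), symmetric] by (simp only: power_Suc mult_2 power_add)
  also have "\<dots> = star P * P" unfolding P_def star_pev[OF assms] ..
  finally have "N (pev n ([:0, 1:] ^ (2 ^ Suc j)) h) = (N P)\<^sup>2" by (simp only: N_cstar)
  then show ?case using Suc by (simp add: P_def flip: power_mult) (simp add: mult.commute)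
qed

text \<open>(m+1) s^m is at most the geometric sum, which telescopes against 1 - s.\<close>

lemma power_times_one_minus_le:
  fixes s :: real
  assumes "0 \<le> s" "s \<le> 1"
  shows "(1 - s) * s ^ m \<le> 1 / real (Suc m)"
proof -
  have "real (Suc m) * s ^ m = (\<Sum>i\<le>m. s ^ m)" by simp
  also have "\<dots> \<le> (\<Sum>i\<le>m. s ^ i)" using assms by (intro sum_mono power_decreasing) auto
  finally have "(1 - s) * (real (Suc m) * s ^ m) \<le> (1 - s) * (\<Sum>i\<le>m. s ^ i)"
    using assms by (intro mult_left_mono) auto
  also have "\<dots> = 1 - s ^ Suc m" unfolding lessThan_Suc_atMost[symmetric] by (rule one_diff_power_eq[symmetric])
  also have "\<dots> \<le> 1" using assms by simp
  finally show ?thesis by (simp add: field_simps)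
qed

text \<open>With an inverse \<open>g\<close> of \<open>c - h\<close>, \<open>c = \<parallel>h\<parallel>\<close>, the norm \<open>c\<^sup>m\<close> of \<open>h\<^sup>m = g (c - h) h\<^sup>m\<close>
  would be at most \<open>\<parallel>g\<parallel> c\<^sup>m\<^sup>+\<^sup>1/(m+1)\<close>.\<close>
lemma spec_attained:
  assumes h: "inM n h" "K h" and n: "n > 0"
  shows "complex_of_real (N h) \<in> mspec sc n (ent h)"
proof (rule ccontr)
  assume "complex_of_real (N h) \<notin> mspec sc n (ent h)"
  then obtain g where g: "inM n g" "g * (N h *\<^sub>R fE n - h) = fE n"
    unfolding mspec_ent by (auto simp: cs_of_real)
  define c where "c = N h"
  have fE0: "fE n \<noteq> (0 :: 'a fmat)"
  proof
    assume "fE n = (0 :: 'a fmat)"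
    then have "ent (fE n) 0 0 = (0::'a)" by simp
    then show False using n by (simp add: ent_fE)
  qed
  show False
  proof (cases "c = 0")
    case True
    then have "h = 0" by (intro N_eq_0) (simp add: c_def)
    then show False using g True fE0 by (simp add: c_def)
  next
    case False
    then have c: "c > 0" using N_nonneg[of h] unfolding c_def by linarith
    have "real (Suc (2 ^ j)) \<le> N g * c" for j
    proof -
      let ?m = "2 ^ j :: nat"
      define q :: "real poly" where "q = [:0, 1:] ^ ?m"
      have "pev n q h = g * (c *\<^sub>R fE n - h) * pev n q h"
        using g fE_left[OF inM_pev[OF h(1)]] by (simp add: c_def)
      also have "\<dots> = g * pev n ([:c, - 1:] * q) h"
        using pev_mult[OF h(1), of "[:c, - 1:]" q] fE_right[OF h(1)] by (simp add: mult.assoc)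
      finally have "N (pev n q h) \<le> N g * N (pev n ([:c, - 1:] * q) h)" by (metis N_mult)
      also have "N (pev n ([:c, - 1:] * q) h) \<le> c ^ Suc ?m / real (Suc ?m)"
      proof (rule N_pev_le[OF h order.refl])
        fix t assume t: "0 \<le> t" "t \<le> N h"
        define s where "s = t / c"
        have s: "0 \<le> s" "s \<le> 1" "t = c * s" using t c by (auto simp: s_def c_def)
        have "poly ([:c, - 1:] * q) t = c ^ Suc ?m * ((1 - s) * s ^ ?m)"
          unfolding s(3) q_def by (simp add: algebra_simps power_mult_distrib)
        moreover have "0 \<le> (1 - s) * s ^ ?m" using s by simp
        moreover have "c ^ Suc ?m * ((1 - s) * s ^ ?m) \<le> c ^ Suc ?m * (1 / real (Suc ?m))"
          using c s by (intro mult_left_mono power_times_one_minus_le) auto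
        ultimately show "\<bar>poly ([:c, - 1:] * q) t\<bar> \<le> c ^ Suc ?m / real (Suc ?m)"
          using c by (metis abs_of_nonneg less_imp_le mult.right_neutral times_divide_eq_right
              mult_nonneg_nonneg zero_le_power)
      qed
      finally have "N (pev n q h) \<le> N g * (c ^ Suc ?m / real (Suc ?m))" by (simp add: mult_left_mono)
      moreover have "N (pev n q h) = c ^ ?m"
        unfolding q_def c_def by (rule N_power_two[OF h(1) K_sa[OF h(2)]])
      ultimately have "c ^ ?m * real (Suc ?m) \<le> c ^ ?m * (N g * c)"
        by (simp add: pos_le_divide_eq ac_simps del: of_nat_Suc)
      then show ?thesis by (rule mult_left_le_imp_le) (use c in simp)
    qed
    moreover obtain k :: nat where k: "N g * c < real k" using reals_Archimedean2 by blast
    moreover have "real k \<le> real (Suc (2 ^ k))"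
      by (rule of_nat_mono) (use less_exp[of k] in linarith)
    ultimately show False by (meson not_le order.strict_trans2 order.trans)
  qed
qed

text \<open>The supremum in \<open>mnorm\<close> is a maximum: \<open>spec_bound\<close> bounds it
  by the order norm of \<open>star x * x\<close>, and \<open>spec_attained\<close> puts that value
  into the spectrum.\<close>

theorem mnorm_ent: "mnorm sc st (ent x) = N x"
proof -
  define n where "n = msize (ent x)"
  have n: "inM n x" unfolding n_def inM_def by (rule bounded_by_msize[OF fin_ent])
  define h where "h = star x * x"
  have h: "inM n h" "K h" using n by (auto simp: h_def inM_mult inM_star K_sq)
  have e: "mmul (mstar st (ent x)) (ent x) = ent h"
    by (simp add: h_def times_fmat.rep_eq ent_star)
  have "Sup ({0} \<union> cmod ` mspec sc n (ent h)) = N h"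
  proof (rule cSup_eq_maximum)
    show "N h \<in> {0} \<union> cmod ` mspec sc n (ent h)"
    proof (cases "n = 0")
      \<comment> \<open>In the corner of size 0 every element is invertible and the spectrum is
        empty; the value 0 comes from the \<open>{0}\<close> in \<open>mnorm\<close>.\<close>
      case True
      then have "x = 0" using n by (intro fmat_eqI) (auto simp: inM_def bounded_by_def)
      then show ?thesis by (simp add: h_def)
    next
      case False
      then have "complex_of_real (N h) \<in> mspec sc n (ent h)" using h by (intro spec_attained) auto
      then have "cmod (complex_of_real (N h)) \<in> cmod ` mspec sc n (ent h)" by (rule imageI)
      then show ?thesis by simp
    qed
  qed (use spec_bound[OF h(1)] in auto)
  then show ?thesis unfolding mnorm_def n_def[symmetric] e by (simp add: h_def N_cstar)
qed

end

section \<open>Continuous functional calculus and Cuntz comparison\<close>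

text \<open>Weierstrass within e/2; removing the constant term costs another e/2, because f 0 =
  0.\<close>

lemma poly_approx_zero:
  fixes f :: "real \<Rightarrow> real"
  assumes f: "continuous_on {0..M} f" "f 0 = 0" and M: "M \<ge> 0" and e: "e > 0"
  obtains p :: "real poly" where "poly p 0 = 0" "\<And>t. 0 \<le> t \<Longrightarrow> t \<le> M \<Longrightarrow> \<bar>poly p t - f t\<bar> \<le> e"
proof -
  obtain g where g: "real_polynomial_function g" "\<And>x. x \<in> {0..M} \<Longrightarrow> \<bar>f x - g x\<bar> < e / 2"
    using Stone_Weierstrass_real_polynomial_function[OF compact_Icc f(1), of "e / 2"] e by auto
  obtain a n where an: "g = (\<lambda>x. \<Sum>i\<le>n. a i * x ^ i)"
    using g(1) unfolding real_polynomial_function_iff_sum by blast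
  define q where "q = (\<Sum>i\<le>n. monom (a i) i)"
  have q: "poly q x = g x" for x by (simp add: q_def an poly_sum poly_monom)
  define p where "p = q - [:g 0:]"
  show thesis
  proof
    show "poly p 0 = 0" by (simp add: p_def q)
    fix t assume t: "0 \<le> t" "t \<le> M"
    have "poly p t = g t - g 0" by (simp add: p_def q)
    moreover have "\<bar>f t - g t\<bar> < e / 2" "\<bar>f 0 - g 0\<bar> < e / 2" using g(2) t M by auto
    ultimately show "\<bar>poly p t - f t\<bar> \<le> e" using f(2) by linarith
  qed
qed

section \<open>Functional calculus for functions vanishing at 0\<close>

context cstar begin

text \<open>Determines f(a) by the estimate it should satisfy against all polynomials at once, so
  that no approximating sequence has to be carried along.\<close>

definition isfc :: "(real \<Rightarrow> real) \<Rightarrow> 'a fmat \<Rightarrow> nat \<Rightarrow> 'a fmat \<Rightarrow> bool" where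
  "isfc f a n c \<longleftrightarrow> (\<forall>p C. poly p 0 = 0 \<and> (\<forall>t. 0 \<le> t \<and> t \<le> N a \<longrightarrow> \<bar>poly p t - f t\<bar> \<le> C) \<longrightarrow>
     N (pev n p a - c) \<le> C)"

definition fcont :: "(real \<Rightarrow> real) \<Rightarrow> 'a fmat \<Rightarrow> bool" where
  "fcont f a \<longleftrightarrow> continuous_on {0..N a} f \<and> f 0 = 0"

definition fc :: "(real \<Rightarrow> real) \<Rightarrow> 'a fmat \<Rightarrow> 'a fmat" where
  "fc f a = (SOME c. inM (msize (ent a)) c \<and> isfc f a (msize (ent a)) c)"

text \<open>By \<open>N_pev_le\<close>, polynomials that approximate f have Cauchy values at a; the
  estimate for an arbitrary q passes to the limit.\<close>

lemma isfc_exists: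
  assumes a: "inM n a" "K a" and f: "fcont f a"
  obtains c where "inM n c" "isfc f a n c"
proof -
  have "\<exists>p. poly p 0 = 0 \<and> (\<forall>t. 0 \<le> t \<and> t \<le> N a \<longrightarrow> \<bar>poly p t - f t\<bar> \<le> 1 / real (Suc k))" for k
    using poly_approx_zero[of "N a" f "1 / real (Suc k)"] f
    unfolding fcont_def by (metis N_nonneg of_nat_0_less_iff zero_less_Suc zero_less_divide_1_iff)
  then obtain p where p: "\<And>k. poly (p k) 0 = 0"
    "\<And>k t. 0 \<le> t \<Longrightarrow> t \<le> N a \<Longrightarrow> \<bar>poly (p k) t - f t\<bar> \<le> 1 / real (Suc k)" by metis
  have close: "N (pev n (p k) a - pev n q a) \<le> 1 / real (Suc k) + C"
    if "\<And>t. 0 \<le> t \<Longrightarrow> t \<le> N a \<Longrightarrow> \<bar>poly q t - f t\<bar> \<le> C" for k q C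
    unfolding pev_diff[symmetric]
  proof (rule N_pev_le[OF a order.refl])
    fix t assume t: "0 \<le> t" "t \<le> N a"
    show "\<bar>poly (p k - q) t\<bar> \<le> 1 / real (Suc k) + C"
      using p(2)[OF t, of k] that[OF t] unfolding poly_diff by linarith
  qed
  have small: "\<exists>m. 1 / real (Suc m) < e" if "e > 0" for e
    using reals_Archimedean[OF that] by (simp add: inverse_eq_divide)
  have dec: "1 / real (Suc k) \<le> 1 / real (Suc m)" if "m \<le> k" for k m
    using that by (intro divide_left_mono) auto
  have "\<exists>m. \<forall>k\<ge>m. \<forall>l\<ge>m. N (pev n (p k) a - pev n (p l) a) < e" if e: "e > 0" for e
  proof -
    obtain m where m: "1 / real (Suc m) < e / 2" using small[of "e / 2"] e by auto
    have "N (pev n (p k) a - pev n (p l) a) < e" if "k \<ge> m" "l \<ge> m" for k l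
      using close[of "p l" "1 / real (Suc l)" k] p(2) dec[OF that(1)] dec[OF that(2)] m by fastforce
    then show ?thesis by blast
  qed
  from N_complete[of n "\<lambda>k. pev n (p k) a", OF inM_pev[OF a(1)] this]
  obtain c where c: "inM n c" "(\<lambda>k. N (pev n (p k) a - c)) \<longlonglongrightarrow> 0" by blast
  have "N (pev n q a - c) \<le> C"
    if q: "poly q 0 = 0" "\<And>t. 0 \<le> t \<Longrightarrow> t \<le> N a \<Longrightarrow> \<bar>poly q t - f t\<bar> \<le> C" for q C
  proof (rule field_le_epsilon)
    fix e :: real assume e: "e > 0"
    have "eventually (\<lambda>k. N (pev n (p k) a - c) < e / 2) sequentially"
      using c(2) e by (intro order_tendstoD(2)) auto
    then obtain m1 where m1: "\<And>k. k \<ge> m1 \<Longrightarrow> N (pev n (p k) a - c) < e / 2"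
      by (auto simp: eventually_sequentially)
    obtain m2 where m2: "1 / real (Suc m2) < e / 2" using small[of "e / 2"] e by auto
    define k where "k = max m1 m2"
    have "N (pev n q a - c) \<le> N (pev n q a - pev n (p k) a) + N (pev n (p k) a - c)"
      by (rule N_diff_triangle)
    moreover have "N (pev n q a - pev n (p k) a) \<le> 1 / real (Suc k) + C"
      using close[of q C k] q(2) by (simp add: N_diff_commute)
    moreover have "N (pev n (p k) a - c) < e / 2" by (rule m1) (simp add: k_def)
    moreover have "1 / real (Suc k) \<le> 1 / real (Suc m2)" by (rule dec) (simp add: k_def)
    ultimately show "N (pev n q a - c) \<le> C + e" using m2 by linarith
  qed
  then have "isfc f a n c" unfolding isfc_def by blast
  with c(1) show thesis using that by blast
qed

lemma
  assumes a: "inM n a" "K a" and f: "fcont f a"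
  shows inM_fc: "inM n (fc f a)" and isfc_fc: "isfc f a n (fc f a)"
proof -
  define m where "m = msize (ent a)"
  have m: "inM m a" "m \<le> n"
    unfolding m_def inM_def using a(1) by (auto simp: inM_def intro: bounded_by_msize fin_ent msize_le)
  have "\<exists>c. inM m c \<and> isfc f a m c" using isfc_exists[OF m(1) a(2) f] by blast
  then have *: "inM m (fc f a)" "isfc f a m (fc f a)"
    unfolding fc_def m_def[symmetric] by (metis (mono_tags, lifting) someI_ex)+
  show "inM n (fc f a)" using * m inM_mono by blast
  show "isfc f a n (fc f a)" using *(2) pev_indep[OF m] unfolding isfc_def by metis
qed

lemma fc_le:
  assumes "inM n a" "K a" "fcont f a" "poly p 0 = 0"
    "\<And>t. 0 \<le> t \<Longrightarrow> t \<le> N a \<Longrightarrow> \<bar>poly p t - f t\<bar> \<le> C"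
  shows "N (pev n p a - fc f a) \<le> C"
  using isfc_fc[OF assms(1-3)] assms(4,5) unfolding isfc_def by blast

lemma fc_approx:
  assumes "inM n a" "K a" "fcont f a" "e > 0"
  obtains p where "poly p 0 = 0" "\<And>t. 0 \<le> t \<Longrightarrow> t \<le> N a \<Longrightarrow> \<bar>poly p t - f t\<bar> \<le> e"
    "N (pev n p a - fc f a) \<le> e"
proof -
  obtain p where "poly p 0 = 0" "\<And>t. 0 \<le> t \<Longrightarrow> t \<le> N a \<Longrightarrow> \<bar>poly p t - f t\<bar> \<le> e"
    using poly_approx_zero[of "N a" f e] assms unfolding fcont_def by (metis N_nonneg)
  then show thesis using that fc_le[OF assms(1-3)] by blast
qed

lemma N_eqI: "(\<And>e. e > 0 \<Longrightarrow> N (x - y) \<le> e) \<Longrightarrow> x = y"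
  using field_le_epsilon[of "N (x - y)" 0] N_eq_0[of "x - y"] N_nonneg[of "x - y"] by force

lemma fc_eqI:
  assumes "inM n a" "K a" "fcont f a"
    and "\<And>e. e > 0 \<Longrightarrow> \<exists>p. poly p 0 = 0 \<and> (\<forall>t. 0 \<le> t \<and> t \<le> N a \<longrightarrow> \<bar>poly p t - f t\<bar> \<le> e)
        \<and> N (pev n p a - c) \<le> e"
  shows "fc f a = c"
proof (rule N_eqI)
  fix e :: real assume "e > 0"
  then have "e / 2 > 0" by simp
  from assms(4)[OF this] obtain p where p: "poly p 0 = 0"
    "\<And>t. 0 \<le> t \<Longrightarrow> t \<le> N a \<Longrightarrow> \<bar>poly p t - f t\<bar> \<le> e / 2" "N (pev n p a - c) \<le> e / 2" by blast
  have "N (pev n p a - fc f a) \<le> e / 2" using p by (intro fc_le assms(1-3)) auto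
  then show "N (fc f a - c) \<le> e"
    using N_diff_triangle[of "fc f a" c "pev n p a"] p(3) by (simp add: N_diff_commute)
qed

lemma fcont_poly: "poly p 0 = 0 \<Longrightarrow> fcont (poly p) a"
  unfolding fcont_def by (auto intro!: continuous_intros)

lemma fc_poly:
  assumes "inM n a" "K a" "poly p 0 = 0" shows "fc (poly p) a = pev n p a"
  by (rule fc_eqI[OF assms(1,2) fcont_poly[OF assms(3)]], rule exI[of _ p]) (use assms in auto)

lemma fc_cong:
  assumes "K a" "fcont f a" "\<And>t. 0 \<le> t \<Longrightarrow> t \<le> N a \<Longrightarrow> f t = g t"
  shows "fc f a = fc g a"
proof -
  obtain n where n: "inM n a" by (metis inM_ex)
  have "continuous_on {0..N a} f \<longleftrightarrow> continuous_on {0..N a} g"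
    by (intro continuous_on_cong refl) (use assms(3) in auto)
  then have "continuous_on {0..N a} g" using assms(2) unfolding fcont_def by blast
  moreover have "g 0 = 0" using assms(2) assms(3)[of 0] by (simp add: fcont_def)
  ultimately have g: "fcont g a" by (simp add: fcont_def)
  show ?thesis
  proof (rule fc_eqI[OF n assms(1,2)])
    fix e :: real assume "e > 0"
    then obtain p where "poly p 0 = 0" "\<And>t. 0 \<le> t \<Longrightarrow> t \<le> N a \<Longrightarrow> \<bar>poly p t - g t\<bar> \<le> e"
      "N (pev n p a - fc g a) \<le> e" using fc_approx[OF n assms(1) g] by metis
    then show "\<exists>p. poly p 0 = 0 \<and> (\<forall>t. 0 \<le> t \<and> t \<le> N a \<longrightarrow> \<bar>poly p t - f t\<bar> \<le> e)
        \<and> N (pev n p a - fc g a) \<le> e" using assms(3) by auto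
  qed
qed

lemma fc_id:
  assumes "K a" shows "fc (\<lambda>t. t) a = a"
proof -
  obtain n where n: "inM n a" by (metis inM_ex)
  have "fc (poly [:0, 1:]) a = pev n [:0, 1:] a" by (rule fc_poly[OF n assms]) simp
  moreover have "poly [:0, 1:] = (\<lambda>t::real. t)" by auto
  ultimately show ?thesis by (simp add: pev_X[OF n] del: pev_pCons)
qed

lemma N_fc_le:
  assumes "K a" "fcont f a" "\<And>t. 0 \<le> t \<Longrightarrow> t \<le> N a \<Longrightarrow> \<bar>f t\<bar> \<le> C"
  shows "N (fc f a) \<le> C"
proof -
  obtain n where n: "inM n a" by (metis inM_ex)
  show ?thesis using fc_le[OF n assms(1,2), of 0 C] assms(3) by (simp add: N_minus)
qed

lemma fcont_diff: "fcont f a \<Longrightarrow> fcont g a \<Longrightarrow> fcont (\<lambda>t. f t - g t) a"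
  and fcont_mult: "fcont f a \<Longrightarrow> fcont g a \<Longrightarrow> fcont (\<lambda>t. f t * g t) a"
  and fcont_id: "fcont (\<lambda>t. t) a"
  unfolding fcont_def by (auto intro!: continuous_intros)

lemma fc_diff:
  assumes a: "K a" and f: "fcont f a" and g: "fcont g a"
  shows "fc (\<lambda>t. f t - g t) a = fc f a - fc g a"
proof -
  obtain n where n: "inM n a" by (metis inM_ex)
  show ?thesis
  proof (rule fc_eqI[OF n a fcont_diff[OF f g]])
    fix e :: real assume e: "e > 0"
    obtain p where p: "poly p 0 = 0" "\<And>t. 0 \<le> t \<Longrightarrow> t \<le> N a \<Longrightarrow> \<bar>poly p t - f t\<bar> \<le> e / 2"
      "N (pev n p a - fc f a) \<le> e / 2" using fc_approx[OF n a f, of "e / 2"] e by auto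
    obtain q where q: "poly q 0 = 0" "\<And>t. 0 \<le> t \<Longrightarrow> t \<le> N a \<Longrightarrow> \<bar>poly q t - g t\<bar> \<le> e / 2"
      "N (pev n q a - fc g a) \<le> e / 2" using fc_approx[OF n a g, of "e / 2"] e by auto
    have "\<bar>poly (p - q) t - (f t - g t)\<bar> \<le> e" if "0 \<le> t" "t \<le> N a" for t
      using p(2)[OF that] q(2)[OF that] unfolding poly_diff by linarith
    moreover have "N (pev n (p - q) a - (fc f a - fc g a)) \<le> e"
      using N_diff[of "pev n p a - fc f a" "pev n q a - fc g a"] p(3) q(3)
      by (simp add: pev_diff algebra_simps)
    ultimately show "\<exists>p. poly p 0 = 0 \<and> (\<forall>t. 0 \<le> t \<and> t \<le> N a \<longrightarrow> \<bar>poly p t - (f t - g t)\<bar> \<le> e)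
        \<and> N (pev n p a - (fc f a - fc g a)) \<le> e"
      using p(1) q(1) by (intro exI[of _ "p - q"]) auto
  qed
qed

lemma fcont_bound:
  assumes "fcont f a"
  obtains L where "L \<ge> 0" "\<And>t. 0 \<le> t \<Longrightarrow> t \<le> N a \<Longrightarrow> \<bar>f t\<bar> \<le> L"
proof -
  have "compact (f ` {0..N a})" using assms unfolding fcont_def by (intro compact_continuous_image) auto
  then obtain L where L: "\<forall>x\<in>f ` {0..N a}. norm x \<le> L" using compact_imp_bounded bounded_iff by metis
  show thesis by (rule that[of "max L 0"]) (use L in \<open>auto intro: le_max_iff_disj[THEN iffD2]\<close>)
qed

lemma fc_mult:
  assumes a: "K a" and f: "fcont f a" and g: "fcont g a"
  shows "fc (\<lambda>t. f t * g t) a = fc f a * fc g a"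
proof -
  obtain n where n: "inM n a" by (metis inM_ex)
  obtain L1 where L1: "L1 \<ge> 0" "\<And>t. 0 \<le> t \<Longrightarrow> t \<le> N a \<Longrightarrow> \<bar>f t\<bar> \<le> L1" using fcont_bound[OF f] by metis
  obtain L2 where L2: "L2 \<ge> 0" "\<And>t. 0 \<le> t \<Longrightarrow> t \<le> N a \<Longrightarrow> \<bar>g t\<bar> \<le> L2" using fcont_bound[OF g] by metis
  show ?thesis
  proof (rule fc_eqI[OF n a fcont_mult[OF f g]])
    fix e :: real assume e: "e > 0"
    \<comment> \<open>Keeps the product error (L1 + 1) d + d L2 at most e, and d \<le> 1 keeps p
      bounded by L1 + 1.\<close>
    define d where "d = min 1 (e / (L1 + 1 + L2))"
    have d: "d > 0" "d \<le> 1" using e L1 L2 by (auto simp: d_def)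
    have de: "(L1 + 1) * d + d * L2 \<le> e"
    proof -
      have "(L1 + 1) * d + d * L2 = (L1 + 1 + L2) * d" by (simp add: algebra_simps)
      also have "\<dots> \<le> (L1 + 1 + L2) * (e / (L1 + 1 + L2))"
        using L1 L2 by (intro mult_left_mono) (auto simp: d_def)
      also have "\<dots> = e" using L1 L2 by simp
      finally show ?thesis .
    qed
    obtain p where p: "poly p 0 = 0" "\<And>t. 0 \<le> t \<Longrightarrow> t \<le> N a \<Longrightarrow> \<bar>poly p t - f t\<bar> \<le> d"
      "N (pev n p a - fc f a) \<le> d" using fc_approx[OF n a f d(1)] by metis
    obtain q where q: "poly q 0 = 0" "\<And>t. 0 \<le> t \<Longrightarrow> t \<le> N a \<Longrightarrow> \<bar>poly q t - g t\<bar> \<le> d"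
      "N (pev n q a - fc g a) \<le> d" using fc_approx[OF n a g d(1)] by metis
    have pb: "\<bar>poly p t\<bar> \<le> L1 + 1" if "0 \<le> t" "t \<le> N a" for t
      using p(2)[OF that] L1(2)[OF that] d by linarith
    have "\<bar>poly (p * q) t - f t * g t\<bar> \<le> e" if t: "0 \<le> t" "t \<le> N a" for t
    proof -
      have "poly (p * q) t - f t * g t = poly p t * (poly q t - g t) + (poly p t - f t) * g t"
        by (simp add: algebra_simps)
      also have "\<bar>\<dots>\<bar> \<le> \<bar>poly p t\<bar> * \<bar>poly q t - g t\<bar> + \<bar>poly p t - f t\<bar> * \<bar>g t\<bar>"
        unfolding abs_mult[symmetric] by (rule abs_triangle_ineq)
      also have "\<dots> \<le> (L1 + 1) * d + d * L2"
        using pb[OF t] p(2)[OF t] q(2)[OF t] L2(2)[OF t] L1(1) d by (intro add_mono mult_mono) auto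
      finally show ?thesis using de by simp
    qed
    moreover have "N (pev n (p * q) a - fc f a * fc g a) \<le> e"
    proof -
      have "pev n (p * q) a - fc f a * fc g a =
        pev n p a * (pev n q a - fc g a) + (pev n p a - fc f a) * fc g a"
        by (simp add: pev_mult[OF n] algebra_simps)
      also have "N \<dots> \<le> N (pev n p a) * N (pev n q a - fc g a) + N (pev n p a - fc f a) * N (fc g a)"
        by (intro order.trans[OF N_triangle] add_mono N_mult)
      also have "\<dots> \<le> (L1 + 1) * d + d * L2"
        using p(3) q(3) L1(1) L2(1) d N_pev_le[OF n a order.refl pb] N_fc_le[OF a g L2(2)]
        by (intro add_mono mult_mono) auto
      finally show ?thesis using de by simp
    qed
    ultimately show "\<exists>p. poly p 0 = 0 \<and> (\<forall>t. 0 \<le> t \<and> t \<le> N a \<longrightarrow> \<bar>poly p t - f t * g t\<bar> \<le> e)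
        \<and> N (pev n p a - fc f a * fc g a) \<le> e"
      using p(1) q(1) by (intro exI[of _ "p * q"]) auto
  qed
qed

lemma star_fc:
  assumes "K a" "fcont f a" shows "star (fc f a) = fc f a"
proof -
  obtain n where n: "inM n a" by (metis inM_ex)
  have "fc f a = star (fc f a)"
  proof (rule fc_eqI[OF n assms])
    fix e :: real assume "e > 0"
    then obtain p where p: "poly p 0 = 0" "\<And>t. 0 \<le> t \<Longrightarrow> t \<le> N a \<Longrightarrow> \<bar>poly p t - f t\<bar> \<le> e"
      "N (pev n p a - fc f a) \<le> e" using fc_approx[OF n assms] by metis
    have "N (pev n p a - star (fc f a)) = N (star (pev n p a - fc f a))"
      by (simp add: star_diff star_pev[OF n K_sa[OF assms(1)]])
    then show "\<exists>p. poly p 0 = 0 \<and> (\<forall>t. 0 \<le> t \<and> t \<le> N a \<longrightarrow> \<bar>poly p t - f t\<bar> \<le> e)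
        \<and> N (pev n p a - star (fc f a)) \<le> e" using p by (auto simp: N_star)
  qed
  then show ?thesis by simp
qed

section \<open>Square roots and cut-downs\<close>

lemma fcont_sqrt: "fcont sqrt a"
  unfolding fcont_def by (auto intro!: continuous_intros)

definition rt :: "'a fmat \<Rightarrow> 'a fmat" where "rt a = fc sqrt a"

lemma star_rt: "K a \<Longrightarrow> star (rt a) = rt a"
  unfolding rt_def by (intro star_fc fcont_sqrt)

lemma rt_sq: assumes "K a" shows "rt a * rt a = a"
proof -
  have "rt a * rt a = fc (\<lambda>t. sqrt t * sqrt t) a"
    unfolding rt_def by (rule fc_mult[OF assms fcont_sqrt fcont_sqrt, symmetric])
  also have "\<dots> = fc (\<lambda>t. t) a"
    by (rule fc_cong[OF assms fcont_mult[OF fcont_sqrt fcont_sqrt]]) auto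
  finally show ?thesis by (simp add: fc_id assms)
qed

text \<open>Positivity as a product \<open>star b * b\<close> agrees with positivity tested on
  columns: one direction is \<open>K_sq\<close>, the other takes the square root for b.\<close>

lemma mpos_ent: "mpos st (ent a) \<longleftrightarrow> K a"
proof
  assume "mpos st (ent a)"
  then obtain b where b: "fin_mat b" "ent a = mmul (mstar st b) b" unfolding mpos_def by blast
  define b' where "b' = Fmat b"
  have "ent b' = b" using b(1) by (simp add: b'_def ent_Fmat)
  then have "a = star b' * b'" using b(2) by (simp add: ent_inject[symmetric] times_fmat.rep_eq ent_star)
  then show "K a" using K_sq by simp
next
  assume "K a"
  then have "a = star (rt a) * rt a" by (simp add: star_rt rt_sq)
  then have "ent a = mmul (mstar st (ent (rt a))) (ent (rt a))"
    by (metis times_fmat.rep_eq ent_star)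
  then show "mpos st (ent a)" unfolding mpos_def using fin_ent by blast
qed

lemma K_fc_nonneg:
  assumes a: "K a" and f: "fcont f a" "\<And>t. 0 \<le> t \<Longrightarrow> t \<le> N a \<Longrightarrow> f t \<ge> 0"
  shows "K (fc f a)"
proof -
  have g: "fcont (\<lambda>t. sqrt (f t)) a" using f unfolding fcont_def by (auto intro!: continuous_intros)
  have "fc f a = fc (\<lambda>t. sqrt (f t) * sqrt (f t)) a" by (rule fc_cong[OF a f(1)]) (use f(2) in auto)
  also have "\<dots> = fc (\<lambda>t. sqrt (f t)) a * fc (\<lambda>t. sqrt (f t)) a" by (rule fc_mult[OF a g g])
  finally show ?thesis using K_sa_sq[OF star_fc[OF a g]] by simp
qed

definition ep :: "real \<Rightarrow> 'a fmat \<Rightarrow> 'a fmat" where "ep e a = fc (f_eps e) a"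

lemma fcont_f_eps: "e \<ge> 0 \<Longrightarrow> fcont (f_eps e) a"
  unfolding fcont_def f_eps_def by (auto intro!: continuous_intros)

lemma K_ep: "K a \<Longrightarrow> e \<ge> 0 \<Longrightarrow> K (ep e a)"
  unfolding ep_def by (intro K_fc_nonneg fcont_f_eps) (auto simp: f_eps_def)

lemma N_minus_ep: assumes "K a" "e \<ge> 0" shows "N (a - ep e a) \<le> e"
proof -
  have "a - ep e a = fc (\<lambda>t. t - f_eps e t) a"
    unfolding ep_def using fc_diff[OF assms(1) fcont_id fcont_f_eps[OF assms(2)]] fc_id[OF assms(1)] by simp
  also have "N \<dots> \<le> e"
    by (rule N_fc_le[OF assms(1) fcont_diff[OF fcont_id fcont_f_eps[OF assms(2)]]])
       (use assms(2) in \<open>auto simp: f_eps_def\<close>)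
  finally show ?thesis .
qed

lemma fpos_ent:
  assumes a: "K a" and e: "e \<ge> 0"
  shows "fpos sc st e (ent a) = ent (ep e a)"
proof -
  obtain n where n: "inM n a" by (metis inM_ex)
  have pe: "mnorm sc st (mdiff (peval p (ent a)) (ent c)) = N (pev n p a - c)" if "poly p 0 = 0" for p c
    by (simp add: peval_pev[OF n that] minus_fmat.rep_eq[symmetric] mnorm_ent)
  have good: "\<exists>\<eta>>0. \<forall>p::real poly. poly p 0 = 0 \<and>
        (\<forall>t\<in>{0..mnorm sc st (ent a)}. \<bar>poly p t - f_eps e t\<bar> < \<eta>) \<longrightarrow>
        mnorm sc st (mdiff (peval p (ent a)) (ent (ep e a))) < \<delta>" if "\<delta> > 0" for \<delta>
  proof (intro exI[of _ "\<delta> / 2"] conjI allI impI)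
    fix p :: "real poly"
    assume p: "poly p 0 = 0 \<and> (\<forall>t\<in>{0..mnorm sc st (ent a)}. \<bar>poly p t - f_eps e t\<bar> < \<delta> / 2)"
    have "N (pev n p a - ep e a) \<le> \<delta> / 2"
      unfolding ep_def by (rule fc_le[OF n a fcont_f_eps[OF e]]) (use p in \<open>auto simp: mnorm_ent less_imp_le\<close>)
    then show "mnorm sc st (mdiff (peval p (ent a)) (ent (ep e a))) < \<delta>"
      using p that by (simp add: pe)
  qed (use that in auto)
  show ?thesis
    unfolding fpos_def
  proof (rule the_equality)
    fix c assume c: "fin_mat c \<and> (\<forall>\<delta>>0. \<exists>\<eta>>0. \<forall>p::real poly. poly p 0 = 0 \<and>
        (\<forall>t\<in>{0..mnorm sc st (ent a)}. \<bar>poly p t - f_eps e t\<bar> < \<eta>) \<longrightarrow>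
        mnorm sc st (mdiff (peval p (ent a)) c) < \<delta>)"
    define c' where "c' = Fmat c"
    have c': "ent c' = c" using c by (simp add: c'_def ent_Fmat)
    have "c' = ep e a"
    proof (rule N_eqI)
      fix \<delta> :: real assume d: "\<delta> > 0"
      then have d2: "\<delta> / 2 > 0" by simp
      obtain \<eta> where \<eta>: "\<eta> > 0" "\<And>p::real poly. poly p 0 = 0 \<Longrightarrow>
        (\<forall>t\<in>{0..mnorm sc st (ent a)}. \<bar>poly p t - f_eps e t\<bar> < \<eta>) \<Longrightarrow>
        mnorm sc st (mdiff (peval p (ent a)) c) < \<delta> / 2" using c d2 by blast
      \<comment> \<open>A single polynomial has to meet the specification of c, through \<eta>, and
        to be close to \<open>ep e a\<close>.\<close>
      define r where "r = min (\<eta> / 2) (\<delta> / 2)"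
      have r: "r > 0" using \<eta>(1) d by (simp add: r_def)
      obtain p where p: "poly p 0 = 0" "\<And>t. 0 \<le> t \<Longrightarrow> t \<le> N a \<Longrightarrow> \<bar>poly p t - f_eps e t\<bar> \<le> r"
         "N (pev n p a - fc (f_eps e) a) \<le> r"
        using fc_approx[OF n a fcont_f_eps[OF e] r] by metis
      have "mnorm sc st (mdiff (peval p (ent a)) c) < \<delta> / 2"
      proof (rule \<eta>(2)[OF p(1)], rule ballI)
        fix t assume "t \<in> {0..mnorm sc st (ent a)}"
        then have "\<bar>poly p t - f_eps e t\<bar> \<le> r" using p(2) by (simp add: mnorm_ent)
        also have "r < \<eta>" using \<eta>(1) by (simp add: r_def)
        finally show "\<bar>poly p t - f_eps e t\<bar> < \<eta>" .
      qed
      then have "N (pev n p a - c') < \<delta> / 2" using pe[OF p(1), of c'] by (simp add: c')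
      moreover have "N (pev n p a - ep e a) \<le> \<delta> / 2" using p(3) by (simp add: ep_def r_def)
      ultimately show "N (c' - ep e a) \<le> \<delta>"
        using N_diff_triangle[of c' "ep e a" "pev n p a"] by (simp add: N_diff_commute)
    qed
    then show "c = ent (ep e a)" using c' by simp
  qed (use good fin_ent in blast)
qed

section \<open>Cuntz comparison\<close>

definition cle :: "'a fmat \<Rightarrow> 'a fmat \<Rightarrow> bool" where
  "cle a b \<longleftrightarrow> (\<forall>e>0. \<exists>r. N (r * b * star r - a) \<le> e)"

lemma cuntz_le_ent: "cuntz_le sc st (ent a) (ent b) \<longleftrightarrow> cle a b"
proof -
  have eq: "mnorm sc st (mdiff (mmul (mmul (ent r) (ent b)) (mstar st (ent r))) (ent a)) = N (r * b * star r - a)" for r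
    by (simp add: mnorm_ent[symmetric] minus_fmat.rep_eq times_fmat.rep_eq ent_star)
  show ?thesis
  proof
    assume "cuntz_le sc st (ent a) (ent b)"
    then obtain r where r: "\<And>k. fin_mat (r k)"
      "(\<lambda>k. mnorm sc st (mdiff (mmul (mmul (r k) (ent b)) (mstar st (r k))) (ent a))) \<longlonglongrightarrow> 0"
      unfolding cuntz_le_def by blast
    define s where "s k = Fmat (r k)" for k
    have s: "r k = ent (s k)" for k using r(1) by (simp add: s_def ent_Fmat)
    have lim: "(\<lambda>k. N (s k * b * star (s k) - a)) \<longlonglongrightarrow> 0" using r(2) by (simp add: s eq)
    show "cle a b"
      unfolding cle_def
    proof (intro allI impI)
      fix e :: real assume "e > 0"
      then have "eventually (\<lambda>k. N (s k * b * star (s k) - a) < e) sequentially"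
        using lim by (intro order_tendstoD(2))
      then obtain k where "N (s k * b * star (s k) - a) < e"
        using eventually_happens'[OF sequentially_bot] by blast
      then show "\<exists>r. N (r * b * star r - a) \<le> e" by (intro exI[of _ "s k"]) simp
    qed
  next
    assume "cle a b"
    then have "\<exists>r. N (r * b * star r - a) \<le> 1 / real (Suc k)" for k by (simp add: cle_def)
    then obtain r where r: "\<And>k. N (r k * b * star (r k) - a) \<le> 1 / real (Suc k)" by metis
    have "(\<lambda>k. N (r k * b * star (r k) - a)) \<longlonglongrightarrow> 0"
    proof (rule tendsto_sandwich[OF _ _ tendsto_const])
      show "(\<lambda>k. 1 / real (Suc k)) \<longlonglongrightarrow> 0"
        using LIMSEQ_inverse_real_of_nat by (simp add: inverse_eq_divide)
    qed (use r in \<open>auto intro!: always_eventually simp del: of_nat_Suc\<close>)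
    then show "cuntz_le sc st (ent a) (ent b)"
      unfolding cuntz_le_def by (intro exI[of _ "\<lambda>k. ent (r k)"]) (simp add: eq fin_ent)
  qed
qed

lemma cle_exact: "cle (r * b * star r) b"
  unfolding cle_def by (intro allI impI exI[of _ r]) simp

lemma cle_refl: "cle a a"
proof -
  obtain n where n: "inM n a" by (metis inM_ex)
  show ?thesis using cle_exact[of "fE n" a] fE_left[OF n] fE_right[OF n] by simp
qed

lemma cle_0: "cle 0 b"
  using cle_exact[of 0 b] by simp

lemma N_conj_le: "N (r * x * star r) \<le> (N r)\<^sup>2 * N x"
proof -
  have "N (r * x * star r) \<le> N (r * x) * N (star r)" by (rule N_mult)
  also have "\<dots> \<le> (N r * N x) * N r" unfolding N_star by (intro mult_right_mono N_mult) auto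
  finally show ?thesis by (simp add: power2_eq_square ac_simps)
qed

lemma small_factor:
  fixes L e :: real
  assumes "L \<ge> 0" "e > 0" obtains d where "d > 0" "L * d \<le> e"
proof
  show "e / (L + 1) > 0" using assms by simp
  have "L * (e / (L + 1)) \<le> (L + 1) * (e / (L + 1))" using assms by (intro mult_right_mono) auto
  also have "\<dots> = e" using assms by simp
  finally show "L * (e / (L + 1)) \<le> e" .
qed

lemma cle_trans:
  assumes "cle a b" "cle b c" shows "cle a c"
  unfolding cle_def
proof (intro allI impI)
  fix e :: real assume e: "e > 0"
  then obtain r where r: "N (r * b * star r - a) \<le> e / 2"
    using assms(1) unfolding cle_def by (metis half_gt_zero)
  obtain d where d: "d > 0" "(N r)\<^sup>2 * d \<le> e / 2" using small_factor[of "(N r)\<^sup>2" "e / 2"] e by auto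
  obtain s where s: "N (s * c * star s - b) \<le> d" using assms(2) d(1) unfolding cle_def by blast
  have "(r * s) * c * star (r * s) - a = r * (s * c * star s - b) * star r + (r * b * star r - a)"
    by (simp add: star_mult algebra_simps)
  also have "N \<dots> \<le> (N r)\<^sup>2 * N (s * c * star s - b) + N (r * b * star r - a)"
    by (intro order.trans[OF N_triangle] add_mono N_conj_le order.refl)
  also have "\<dots> \<le> (N r)\<^sup>2 * d + e / 2" using s r by (intro add_mono mult_left_mono) auto
  finally have "N ((r * s) * c * star (r * s) - a) \<le> e" using d(2) by linarith
  then show "\<exists>r. N (r * c * star r - a) \<le> e" by blast
qed

lemma cle_closed:
  assumes "\<And>e. e > 0 \<Longrightarrow> \<exists>a'. N (a - a') \<le> e \<and> cle a' b" shows "cle a b"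
  unfolding cle_def
proof (intro allI impI)
  fix e :: real assume e: "e > 0"
  then have e2: "e / 2 > 0" by simp
  from assms[OF this] obtain a' where a': "N (a - a') \<le> e / 2" "cle a' b" by blast
  then obtain r where r: "N (r * b * star r - a') \<le> e / 2" using e2 unfolding cle_def by blast
  have "N (r * b * star r - a) \<le> e"
    using N_diff_triangle[of "r * b * star r" a a'] a'(1) r by (simp add: N_diff_commute)
  then show "\<exists>r. N (r * b * star r - a) \<le> e" by blast
qed

text \<open>Take a polynomial p = X q close to the square root on [0, N y]. With r = q(y) one gets r
  y^2 r = p(y)^2, which is close to y.\<close>

lemma cle_square:
  assumes y: "K y" shows "cle y (y * y)"
  unfolding cle_def
proof (intro allI impI)
  fix e :: real assume e: "e > 0"
  obtain n where n: "inM n y" by (metis inM_ex)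
  define s where "s = rt y"
  obtain d0 where d0: "d0 > 0" "(2 * N s + 1) * d0 \<le> e" using small_factor[of "2 * N s + 1" e] e by auto
  define d where "d = min d0 1"
  have d: "d > 0" "d \<le> 1" "(2 * N s + 1) * d \<le> e"
  proof -
    have "(2 * N s + 1) * d \<le> (2 * N s + 1) * d0" by (intro mult_left_mono) (auto simp: d_def)
    then show "(2 * N s + 1) * d \<le> e" using d0 by linarith
  qed (use d0 in \<open>auto simp: d_def\<close>)
  obtain p where p: "poly p 0 = 0" "N (pev n p y - fc sqrt y) \<le> d"
    using fc_approx[OF n y fcont_sqrt d(1)] by metis
  obtain q where q: "p = [:0, 1:] * q" using p(1) by (cases p) auto
  define r where "r = pev n q y"
  define P where "P = pev n p y"
  have sr: "star r = r" unfolding r_def by (rule star_pev[OF n K_sa[OF y]])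
  have "P = y * r" unfolding P_def q r_def pev_mult[OF n] pev_X[OF n] ..
  moreover have "P = r * y"
    unfolding P_def q r_def by (subst mult.commute) (simp only: pev_mult[OF n] pev_X[OF n])
  ultimately have rr: "r * (y * y) * star r = P * P" unfolding sr by (metis mult.assoc)
  have Ps: "N (P - s) \<le> d" using p(2) by (simp add: P_def s_def rt_def)
  have NP: "N P \<le> N s + d" using N_triangle[of "P - s" s] Ps by simp
  have "P * P - y = P * (P - s) + (P - s) * s"
    using rt_sq[OF y] by (simp add: s_def algebra_simps)
  also have "N \<dots> \<le> N P * N (P - s) + N (P - s) * N s"
    by (intro order.trans[OF N_triangle] add_mono N_mult)
  also have "\<dots> \<le> (N s + 1) * d + d * N s"
    using Ps NP d by (intro add_mono mult_mono) auto
  also have "\<dots> = (2 * N s + 1) * d" by (simp add: algebra_simps)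
  finally have "N (r * (y * y) * star r - y) \<le> e" using d(3) rr by simp
  then show "\<exists>r. N (r * (y * y) * star r - y) \<le> e" by blast
qed

text \<open>The square of \<open>x * star x\<close> is the conjugate of \<open>star x * x\<close> by
  x, and \<open>cle_square\<close> removes the square.\<close>

lemma cle_swap: "cle (x * star x) (star x * x)"
proof (rule cle_trans)
  have "K (x * star x)" using K_sq[of "star x"] by simp
  then show "cle (x * star x) ((x * star x) * (x * star x))" by (rule cle_square)
  show "cle ((x * star x) * (x * star x)) (star x * x)"
    using cle_exact[of x "star x * x"] by (simp add: mult.assoc)
qed

text \<open>Writing \<open>b = g\<^sup>2\<close>, \<open>P = c g\<close> and \<open>Q = g d\<close>, one has
  \<open>y \<precsim> y y\<^sup>* = (P Q) (P Q)\<^sup>* \<precsim> Q\<^sup>* (P\<^sup>* P) Q \<precsim> P\<^sup>* P \<precsim> P P\<^sup>* = c b c\<^sup>* \<precsim> b\<close>.\<close>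
lemma cle_factor:
  assumes y: "K y" "y = c * b * d" and b: "K b"
  shows "cle y b"
proof -
  define g where "g = rt b"
  have g: "star g = g" "g * g = b" using b by (auto simp: g_def star_rt rt_sq)
  define P where "P = c * g"
  define Q where "Q = g * d"
  have "y = P * Q" unfolding P_def Q_def y(2) g(2)[symmetric] by (simp only: mult.assoc)
  moreover have "star y = y" using y(1) by (rule K_sa)
  ultimately have "y * y = (P * Q) * star (P * Q)" by simp
  then have 1: "cle y ((P * Q) * star (P * Q))" using cle_square[OF y(1)] by simp
  have 2: "cle ((P * Q) * star (P * Q)) (star (P * Q) * (P * Q))" by (rule cle_swap)
  have 3: "cle (star (P * Q) * (P * Q)) (star P * P)"
    using cle_exact[of "star Q" "star P * P"] by (simp add: star_mult mult.assoc)
  have 4: "cle (star P * P) (P * star P)" using cle_swap[of "star P"] by simp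
  have 5: "cle (P * star P) b"
  proof -
    have "P * star P = c * b * star c"
      unfolding P_def star_mult g(1) g(2)[symmetric] by (simp only: mult.assoc)
    then show ?thesis using cle_exact[of c b] by simp
  qed
  show ?thesis using 1 2 3 4 5 by (meson cle_trans)
qed

text \<open>Choose \<open>k\<close> with \<open>k(t)\<^sup>2 t = 1\<close> for \<open>t \<ge> e\<close> and let \<open>s\<^sup>2 = (a - e)\<^sub>+\<close>. The element
  \<open>x = k (b - a) k\<close> has norm less than 1 and \<open>s (1 + x) = s k b k\<close>, so that
  \<open>(a - e)\<^sub>+ = s k b k (1 + x)\<^sup>-\<^sup>1 s\<close> factors through \<open>b\<close>.\<close>
lemma cle_ep_near:
  assumes a: "K a" and b: "K b" and e: "N (a - b) < e"
  shows "cle (ep e a) b"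
proof -
  obtain n where n: "inM n a" "inM n b" by (rule inM_ex2)
  have e0: "e > 0" using e N_nonneg[of "a - b"] by linarith
  \<comment> \<open>Equal to 1 / sqrt t for t \<ge> e, continued to vanish at 0, and bounded by 1 /
    sqrt e; hence \<open>x\<close> below has norm at most N (b - a) / e.\<close>
  define kf where "kf t = sqrt t / max t e" for t
  define sf where "sf t = sqrt (f_eps e t)" for t
  have fk: "fcont kf a" unfolding fcont_def kf_def using e0 by (auto intro!: continuous_intros)
  have fs: "fcont sf a" unfolding fcont_def sf_def f_eps_def using e0 by (auto intro!: continuous_intros)
  define k where "k = fc kf a"
  define s where "s = fc sf a"
  have kn: "inM n k" "inM n s" unfolding k_def s_def by (auto intro: inM_fc n a fk fs)
  have sk: "star k = k" "star s = s" unfolding k_def s_def by (auto intro: star_fc a fk fs)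
  have Nk: "(N k)\<^sup>2 \<le> 1 / e"
  proof -
    have "N k \<le> sqrt (1 / e)"
      unfolding k_def
    proof (rule N_fc_le[OF a fk])
      fix t :: real assume t: "0 \<le> t" "t \<le> N a"
      have "kf t \<ge> 0" using t e0 by (simp add: kf_def)
      have "(kf t)\<^sup>2 = t / (max t e)\<^sup>2" using t by (simp add: kf_def power_divide)
      also have "\<dots> \<le> max t e / (max t e)\<^sup>2" using e0 by (intro divide_right_mono) auto
      also have "\<dots> = 1 / max t e" using e0 by (simp add: power2_eq_square)
      also have "\<dots> \<le> 1 / e" using e0 by (intro divide_left_mono) auto
      finally show "\<bar>kf t\<bar> \<le> sqrt (1 / e)" using \<open>kf t \<ge> 0\<close> by (simp add: real_le_rsqrt)
    qed
    then have "(N k)\<^sup>2 \<le> (sqrt (1 / e))\<^sup>2" by (intro power_mono) auto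
    then show ?thesis using e0 by simp
  qed
  have skak: "s * k * a * k = s"
  proof -
    have "s * k * a * k = fc (\<lambda>t. sf t * kf t * t * kf t) a"
      unfolding s_def k_def
      by (simp add: fc_mult[OF a] fcont_mult fs fk fcont_id fc_id[OF a])
    also have "\<dots> = fc sf a"
    proof (rule fc_cong[OF a])
      show "fcont (\<lambda>t. sf t * kf t * t * kf t) a" by (intro fcont_mult fs fk fcont_id)
      fix t :: real assume t: "0 \<le> t"
      show "sf t * kf t * t * kf t = sf t"
      proof (cases "t \<le> e")
        case False
        then have "kf t * t * kf t = 1" using t e0 by (simp add: kf_def max_def)
        then show ?thesis by (metis mult.assoc mult.right_neutral)
      qed (simp add: sf_def f_eps_def)
    qed
    finally show ?thesis by (simp add: s_def)
  qed
  define x where "x = k * (b - a) * k"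
  have xn: "inM n x" using kn n by (simp add: x_def inM_mult inM_diff)
  have "N x \<le> (N k)\<^sup>2 * N (b - a)" using N_conj_le[of k "b - a"] sk by (simp add: x_def)
  also have "\<dots> \<le> (1 / e) * N (b - a)" using Nk by (rule mult_right_mono) simp
  also have "\<dots> < 1" using e e0 by (simp add: N_diff_commute)
  finally have "N (- x) < 1" by (simp add: N_minus)
  then obtain z where z: "inM n z" "(fE n + x) * z = fE n"
    using neumann_right[of n "- x"] xn by (auto simp: inM_minus)
  have "s * (fE n + x) = s + s * k * b * k - s * k * a * k"
    using fE_right[OF kn(2)] by (simp add: x_def algebra_simps)
  then have "s * (fE n + x) = s * k * b * k" by (simp add: skak)
  then have "s = s * k * b * k * z"
    using z(2) fE_right[OF kn(2)] by (metis mult.assoc)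
  then have "s * s = (s * k) * b * (k * z * s)" by (metis mult.assoc)
  moreover have "s * s = ep e a"
  proof -
    have "s * s = fc (\<lambda>t. sf t * sf t) a" unfolding s_def by (rule fc_mult[OF a fs fs, symmetric])
    also have "\<dots> = fc (f_eps e) a"
      by (rule fc_cong[OF a fcont_mult[OF fs fs]]) (auto simp: sf_def f_eps_def)
    finally show ?thesis by (simp add: ep_def)
  qed
  ultimately show ?thesis using a b e0 by (intro cle_factor[of "ep e a" "s * k" b "k * z * s"] K_ep) auto
qed

lemma ep_cle: "K a \<Longrightarrow> e > 0 \<Longrightarrow> cle (ep e a) a"
  by (rule cle_ep_near) auto

lemma ep_mono:
  assumes "K a" "0 \<le> d" "d < e" shows "cle (ep e a) (ep d a)"
  using assms N_minus_ep[of a d] by (intro cle_ep_near K_ep) auto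

text \<open>If the conjugate of b by r is within e/3 of a, then for small d the conjugate of the
  cut-down of b is within 2e/3, and \<open>cle_ep_near\<close> applies.\<close>

lemma cle_ep:
  assumes "cle a b" "K a" "K b" "e > 0"
  obtains d where "d > 0" "cle (ep e a) (ep d b)"
proof -
  obtain r where r: "N (r * b * star r - a) \<le> e / 3"
    using assms(1,4) unfolding cle_def by (metis divide_pos_pos zero_less_numeral)
  obtain d where d: "d > 0" "(N r)\<^sup>2 * d \<le> e / 3" using small_factor[of "(N r)\<^sup>2" "e / 3"] assms(4) by auto
  define a' where "a' = r * ep d b * star r"
  have "K a'" unfolding a'_def using assms d by (intro K_conj' K_ep) auto
  have "a - a' = r * (b - ep d b) * star r - (r * b * star r - a)" by (simp add: a'_def algebra_simps)
  also have "N \<dots> \<le> (N r)\<^sup>2 * N (b - ep d b) + N (r * b * star r - a)"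
    by (intro order.trans[OF N_diff] add_mono N_conj_le order.refl)
  also have "\<dots> \<le> (N r)\<^sup>2 * d + e / 3"
    using r d N_minus_ep[OF assms(3), of d] by (intro add_mono mult_left_mono) auto
  finally have "N (a - a') < e" using d assms(4) by linarith
  then have "cle (ep e a) a'" by (rule cle_ep_near[OF assms(2) \<open>K a'\<close>])
  then have "cle (ep e a) (ep d b)" using cle_trans cle_exact[of r "ep d b"] by (simp add: a'_def) 
  with d(1) show thesis using that by blast
qed

lemma pev_orth:
  fixes a b :: "'a fmat"
  assumes n: "inM n a" "inM n b" and ab: "a * b = 0" "b * a = 0" and p: "poly p 0 = 0"
  shows "pev n p (a + b) = pev n p a + pev n p b"
proof -
  have *: "a * pev n q (a + b) = a * pev n q a" if "inM n a" "inM n b" "a * b = 0" for a b :: "'a fmat" and q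
  proof (induction q)
    case (pCons c q)
    have "a * pev n (pCons c q) (a + b) = c *\<^sub>R (a * fE n) + a * (a * pev n q (a + b)) + (a * b) * pev n q (a + b)"
      by (simp add: algebra_simps)
    also have "\<dots> = a * pev n (pCons c q) a" using pCons that by (simp add: algebra_simps)
    finally show ?case .
  qed auto
  obtain q where q: "p = pCons 0 q" using p by (cases p) auto
  show ?thesis
    using *[OF n ab(1), of q] *[OF n(2,1) ab(2), of q] by (simp add: q distrib_right add.commute)
qed

lemma fc_orth:
  assumes "K a" "fcont f a" "a * b = 0" shows "fc f a * b = 0"
proof -
  obtain n where n: "inM n a" by (metis inM_ex)
  show ?thesis
  proof (rule N_eqI)
    fix e :: real assume e: "e > 0"
    obtain d where d: "d > 0" "N b * d \<le> e" using small_factor[of "N b" e] e by auto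
    obtain p where p: "poly p 0 = 0" "N (pev n p a - fc f a) \<le> d"
      using fc_approx[OF n assms(1,2) d(1)] by metis
    obtain q where q: "p = pCons 0 q" using p(1) by (cases p) auto
    have "pev n p a = pev n q a * a"
      using pev_commute[OF n, of "[:0, 1:]" q] by (simp add: q pev_X[OF n] fE_right[OF n])
    then have "pev n p a * b = 0" using assms(3) by (simp add: mult.assoc)
    then have "fc f a * b - 0 = - ((pev n p a - fc f a) * b)" by (simp add: algebra_simps)
    then have "N (fc f a * b - 0) = N ((pev n p a - fc f a) * b)" by (simp only: N_minus)
    also have "\<dots> \<le> d * N b" using p(2) by (intro order.trans[OF N_mult] mult_right_mono) auto
    finally show "N (fc f a * b - 0) \<le> e" using d(2) by (simp add: mult.commute)
  qed
qed

lemma orth_commute: "K a \<Longrightarrow> K b \<Longrightarrow> a * b = 0 \<Longrightarrow> b * a = 0"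
  using star_mult[of a b] by (simp add: K_sa)

text \<open>Polynomials without constant term are additive on orthogonal pairs
  (\<open>pev_orth\<close>), and so are their limits.\<close>

lemma
  assumes a: "K a" and b: "K b" and ab: "a * b = 0" and e: "e \<ge> 0"
  shows ep_orth: "ep e a * ep e b = 0" and ep_add: "ep e (a + b) = ep e a + ep e b"
proof -
  have "ep e a * b = 0" unfolding ep_def by (rule fc_orth[OF a fcont_f_eps[OF e] ab])
  then have "b * ep e a = 0" by (rule orth_commute[OF K_ep[OF a e] b])
  then have "ep e b * ep e a = 0" unfolding ep_def[of e b] by (rule fc_orth[OF b fcont_f_eps[OF e]])
  then show "ep e a * ep e b = 0" by (rule orth_commute[OF K_ep[OF b e] K_ep[OF a e]])
  obtain n where n: "inM n a" "inM n b" by (rule inM_ex2)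
  have le: "N x \<le> N (x + y)" if "K x" "K y" "inM n x" "inM n y" for x y
  proof (rule N_K_bound[OF that(3,1)])
    have "K (N (x + y) *\<^sub>R fE n - (x + y))"
      using that by (intro K_norm_minus) (auto simp: K_sa star_add inM_add)
    from K_add[OF this that(2)] show "K (N (x + y) *\<^sub>R fE n - x)" by simp
  qed simp
  \<comment> \<open>The polynomial is chosen on [0, N (a + b)], so this interval must contain
    [0, N a] and [0, N b].\<close>
  have lea: "N a \<le> N (a + b)" "N b \<le> N (a + b)"
    using le[OF a b n] le[OF b a n(2,1)] by (auto simp: add.commute)
  show "ep e (a + b) = ep e a + ep e b"
    unfolding ep_def[of e "a + b"]
  proof (rule fc_eqI[OF inM_add[OF n] K_add[OF a b] fcont_f_eps[OF e]])
    fix d :: real assume d: "d > 0"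
    then have d2: "d / 2 > 0" by simp
    obtain p where p: "poly p 0 = 0" "\<And>t. 0 \<le> t \<Longrightarrow> t \<le> N (a + b) \<Longrightarrow> \<bar>poly p t - f_eps e t\<bar> \<le> d / 2"
      using fc_approx[OF inM_add[OF n] K_add[OF a b] fcont_f_eps[OF e] d2] by metis
    have "N (pev n p a - ep e a) \<le> d / 2"
      unfolding ep_def by (rule fc_le[OF n(1) a fcont_f_eps[OF e] p(1)]) (use p(2) lea in auto)
    moreover have "N (pev n p b - ep e b) \<le> d / 2"
      unfolding ep_def by (rule fc_le[OF n(2) b fcont_f_eps[OF e] p(1)]) (use p(2) lea in auto)
    moreover have eq: "pev n p (a + b) - (ep e a + ep e b) = (pev n p a - ep e a) + (pev n p b - ep e b)"
      using pev_orth[OF n ab orth_commute[OF a b ab] p(1)] by simp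
    ultimately have "N (pev n p (a + b) - (ep e a + ep e b)) \<le> d"
      using N_triangle[of "pev n p a - ep e a" "pev n p b - ep e b"] unfolding eq by linarith
    moreover have "\<bar>poly p t - f_eps e t\<bar> \<le> d" if "0 \<le> t" "t \<le> N (a + b)" for t
      using p(2)[OF that] d by linarith
    ultimately show "\<exists>p. poly p 0 = 0 \<and> (\<forall>t. 0 \<le> t \<and> t \<le> N (a + b) \<longrightarrow> \<bar>poly p t - f_eps e t\<bar> \<le> d)
        \<and> N (pev n p (a + b) - (ep e a + ep e b)) \<le> d"
      using p(1) by blast
  qed
qed

end

section \<open>States on preordered cones\<close>

text \<open>Multisets form the free commutative monoid, so a preorder on them stands for an ordered
  semigroup without forming a quotient.\<close>

locale unit_preorder =
  fixes le :: "'b multiset \<Rightarrow> 'b multiset \<Rightarrow> bool" and u :: "'b multiset"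
  assumes le_refl: "le x x"
    and le_trans: "le x y \<Longrightarrow> le y z \<Longrightarrow> le x z"
    and le_add: "le x y \<Longrightarrow> le (x + z) (y + z)"
    and le_zero: "le {#} x"
    and le_unit: "\<exists>n. le x (repeat_mset n u)"
begin

lemma le_plus: "le x y \<Longrightarrow> le x' y' \<Longrightarrow> le (x + x') (y + y')"
  by (metis add.commute le_add le_trans)

lemma le_repeat: "le x y \<Longrightarrow> le (repeat_mset n x) (repeat_mset n y)"
  by (induction n) (auto intro: le_plus le_refl)

lemma le_left: "le x (x + y)"
  using le_plus[OF le_refl[of x] le_zero[of y]] by simp

lemma le_repeat_mono: "m \<le> n \<Longrightarrow> le (repeat_mset m x) (repeat_mset n x)"
  using le_left[of "repeat_mset m x" "repeat_mset (n - m) x"]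
  by (simp flip: repeat_mset_distrib)

definition state :: "('b multiset \<Rightarrow> real) \<Rightarrow> bool" where
  "state f \<longleftrightarrow> (\<forall>x y. f (x + y) = f x + f y) \<and> (\<forall>x. 0 \<le> f x) \<and> (\<forall>x y. le x y \<longrightarrow> f x \<le> f y) \<and> f u = 1"

text \<open>The exact rule in the direction u survives infima and gives p u = 1, so normalization
  never has to be restored.\<close>

definition sublin :: "('b multiset \<Rightarrow> real) \<Rightarrow> bool" where
  "sublin p \<longleftrightarrow> (\<forall>x. 0 \<le> p x) \<and> (\<forall>x y. p (x + y) \<le> p x + p y) \<and>
     (\<forall>n x. p (repeat_mset n x) = real n * p x) \<and> (\<forall>x y. le x y \<longrightarrow> p x \<le> p y) \<and>
     (\<forall>x m. p (x + repeat_mset m u) = p x + real m)"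

lemma sublinD:
  assumes "sublin p"
  shows "0 \<le> p x" "p (x + y) \<le> p x + p y" "p (repeat_mset n x) = real n * p x"
    "le x y \<Longrightarrow> p x \<le> p y" "p (x + repeat_mset m u) = p x + real m"
  using assms unfolding sublin_def by blast+

text \<open>Rational upper bounds for x measured in units of u. The copies of u on the left take the
  place of cancellation, which the preorder need not have.\<close>

definition adm :: "'b multiset \<Rightarrow> real \<Rightarrow> bool" where
  "adm x r \<longleftrightarrow> (\<exists>n i j. n \<ge> 1 \<and> r = (real j - real i) / real n \<and>
     le (repeat_mset n x + repeat_mset i u) (repeat_mset j u))"

lemma adm_ex: "\<exists>r. adm x r"
proof -
  obtain j where "le x (repeat_mset j u)" using le_unit by blast
  then have "adm x (real j)" unfolding adm_def by (intro exI[of _ 1] exI[of _ 0] exI[of _ j]) auto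
  then show ?thesis ..
qed

lemma adm_add:
  assumes "adm x r" "adm y s" shows "adm (x + y) (r + s)"
proof -
  obtain n i j where 1: "n \<ge> 1" "r = (real j - real i) / real n"
    "le (repeat_mset n x + repeat_mset i u) (repeat_mset j u)" using assms(1) unfolding adm_def by blast
  obtain n' i' j' where 2: "n' \<ge> 1" "s = (real j' - real i') / real n'"
    "le (repeat_mset n' y + repeat_mset i' u) (repeat_mset j' u)" using assms(2) unfolding adm_def by blast
  have "le (repeat_mset n' (repeat_mset n x + repeat_mset i u) + repeat_mset n (repeat_mset n' y + repeat_mset i' u))
     (repeat_mset n' (repeat_mset j u) + repeat_mset n (repeat_mset j' u))"
    by (intro le_plus le_repeat 1 2)
  moreover have "repeat_mset n' (repeat_mset n x + repeat_mset i u) + repeat_mset n (repeat_mset n' y + repeat_mset i' u)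
     = repeat_mset (n * n') (x + y) + repeat_mset (n' * i + n * i') u"
    by (rule multiset_eqI) (simp add: algebra_simps)
  moreover have "repeat_mset n' (repeat_mset j u) + repeat_mset n (repeat_mset j' u) = repeat_mset (n' * j + n * j') u"
    by (rule multiset_eqI) (simp add: algebra_simps)
  moreover have "r + s = (real (n' * j + n * j') - real (n' * i + n * i')) / real (n * n')"
    unfolding 1(2) 2(2) using 1(1) 2(1) by (simp add: field_simps)
  moreover have "n * n' \<ge> 1" using 1(1) 2(1) by simp
  ultimately show ?thesis unfolding adm_def by metis
qed

lemma adm_repeat:
  assumes "k \<ge> 1" shows "adm (repeat_mset k x) r \<longleftrightarrow> adm x (r / real k)"
proof
  assume "adm (repeat_mset k x) r"
  then obtain n i j where 1: "n \<ge> 1" "r = (real j - real i) / real n"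
    "le (repeat_mset n (repeat_mset k x) + repeat_mset i u) (repeat_mset j u)" unfolding adm_def by blast
  then have "n * k \<ge> 1" "r / real k = (real j - real i) / real (n * k)" using assms by auto
  with 1(3) show "adm x (r / real k)" unfolding adm_def repeat_mset_right by metis
next
  assume "adm x (r / real k)"
  then obtain n i j where 1: "n \<ge> 1" "r / real k = (real j - real i) / real n"
    "le (repeat_mset n x + repeat_mset i u) (repeat_mset j u)" unfolding adm_def by blast
  have "le (repeat_mset k (repeat_mset n x + repeat_mset i u)) (repeat_mset k (repeat_mset j u))"
    by (intro le_repeat 1)
  moreover have "repeat_mset k (repeat_mset n x + repeat_mset i u) = repeat_mset n (repeat_mset k x) + repeat_mset (k * i) u"
    by (rule multiset_eqI) (simp add: algebra_simps)
  moreover have "r = (real (k * j) - real (k * i)) / real n" using 1 assms by (simp add: field_simps)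
  ultimately show "adm (repeat_mset k x) r" unfolding adm_def using 1(1) repeat_mset_right by metis
qed

lemma adm_mono: assumes "le x y" "adm y r" shows "adm x r"
proof -
  obtain n i j where 1: "n \<ge> 1" "r = (real j - real i) / real n"
    "le (repeat_mset n y + repeat_mset i u) (repeat_mset j u)" using assms(2) unfolding adm_def by blast
  have "le (repeat_mset n x + repeat_mset i u) (repeat_mset j u)"
    by (rule le_trans[OF _ 1(3)]) (intro le_add le_repeat assms)
  with 1 show ?thesis unfolding adm_def by blast
qed

lemma adm_unit: "adm (x + repeat_mset m u) (r + real m) \<longleftrightarrow> adm x r"
proof
  assume "adm (x + repeat_mset m u) (r + real m)"
  then obtain n i j where 1: "n \<ge> 1" "r + real m = (real j - real i) / real n"
    "le (repeat_mset n (x + repeat_mset m u) + repeat_mset i u) (repeat_mset j u)" unfolding adm_def by blast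
  have "repeat_mset n (x + repeat_mset m u) + repeat_mset i u = repeat_mset n x + repeat_mset (n * m + i) u"
    by (rule multiset_eqI) (simp add: algebra_simps)
  moreover have "r = (real j - real (n * m + i)) / real n" using 1 by (simp add: field_simps)
  ultimately show "adm x r" unfolding adm_def using 1 by metis
next
  assume "adm x r"
  then obtain n i j where 1: "n \<ge> 1" "r = (real j - real i) / real n"
    "le (repeat_mset n x + repeat_mset i u) (repeat_mset j u)" unfolding adm_def by blast
  have "le (repeat_mset n x + repeat_mset i u + repeat_mset (n * m) u) (repeat_mset j u + repeat_mset (n * m) u)"
    by (intro le_add 1)
  moreover have "repeat_mset n x + repeat_mset i u + repeat_mset (n * m) u = repeat_mset n (x + repeat_mset m u) + repeat_mset i u"
    by (rule multiset_eqI) (simp add: algebra_simps)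
  moreover have "repeat_mset j u + repeat_mset (n * m) u = repeat_mset (j + n * m) u"
    by (rule multiset_eqI) (simp add: algebra_simps)
  moreover have "r + real m = (real (j + n * m) - real i) / real n" using 1 by (simp add: field_simps)
  ultimately show "adm (x + repeat_mset m u) (r + real m)" unfolding adm_def using 1(1) by metis
qed

lemma Inf_le_affine:
  fixes S T :: "real set"
  assumes "T \<noteq> {}" "bdd_below S" "k > 0" "\<And>t. t \<in> T \<Longrightarrow> k * t + c \<in> S"
  shows "Inf S \<le> k * Inf T + c"
proof -
  have "(Inf S - c) / k \<le> Inf T"
  proof (rule cInf_greatest[OF assms(1)])
    fix t assume "t \<in> T"
    then have "Inf S \<le> k * t + c" using assms by (intro cInf_lower)
    then show "(Inf S - c) / k \<le> t" using assms(3) by (simp add: field_simps)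
  qed
  then show ?thesis using assms(3) by (simp add: field_simps)
qed

text \<open>The infimum of the admissible bounds. The hypothesis makes these nonnegative:
  admissibility of r for x gives i u \<le> j u, hence i \<le> j.\<close>

lemma exists_sublin:
  assumes nontriv: "\<And>n j. le (repeat_mset n u) (repeat_mset j u) \<Longrightarrow> n \<le> j"
  shows "\<exists>p. sublin p"
proof -
  have adm_nonneg: "0 \<le> r" if adm: "adm x r" for x r
  proof -
    obtain n i j where 1: "n \<ge> 1" "r = (real j - real i) / real n"
      "le (repeat_mset n x + repeat_mset i u) (repeat_mset j u)" using adm unfolding adm_def by blast
    have "le (repeat_mset i u) (repeat_mset n x + repeat_mset i u)"
      using le_left[of "repeat_mset i u" "repeat_mset n x"] by (simp add: add.commute)
    then have "i \<le> j" using nontriv le_trans 1(3) by blast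
    then show ?thesis using 1 by simp
  qed
  define p where "p x = Inf {r. adm x r}" for x
  have bdd: "bdd_below {r. adm x r}" for x using adm_nonneg by (intro bdd_belowI[of _ 0]) auto
  have ne: "{r. adm x r} \<noteq> {}" for x using adm_ex by blast
  have p0: "0 \<le> p x" for x unfolding p_def using adm_nonneg by (intro cInf_greatest[OF ne]) auto
  have padd: "p (x + y) \<le> p x + p y" for x y
  proof -
    have "p (x + y) - r \<le> p y" if "adm x r" for r
      unfolding p_def
    proof (rule cInf_greatest[OF ne])
      fix s assume "s \<in> {r. adm y r}"
      then have "Inf {r. adm (x + y) r} \<le> r + s" using adm_add[OF that] by (intro cInf_lower bdd) auto
      then show "Inf {r. adm (x + y) r} - r \<le> s" by simp
    qed
    then have "p (x + y) - p y \<le> Inf {r. adm x r}" by (intro cInf_greatest[OF ne]) (force simp: algebra_simps)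
    then show ?thesis by (simp add: p_def)
  qed
  have pmono: "p x \<le> p y" if "le x y" for x y
    unfolding p_def using adm_mono[OF that] by (intro cInf_superset_mono ne bdd) auto
  have punit: "p (x + repeat_mset m u) = p x + real m" for x m
  proof (rule antisym)
    show "p (x + repeat_mset m u) \<le> p x + real m"
      unfolding p_def using Inf_le_affine[OF ne[of x] bdd[of "x + repeat_mset m u"], of 1 "real m"]
      by (simp add: adm_unit)
    show "p x + real m \<le> p (x + repeat_mset m u)"
      unfolding p_def using Inf_le_affine[OF ne[of "x + repeat_mset m u"] bdd[of x], of 1 "- real m"]
        adm_unit[of x m "_ - real m"] by simp
  qed
  have prep: "p (repeat_mset k x) = real k * p x" for k x
  proof (cases "k = 0")
    case True
    have "adm {#} 0" unfolding adm_def by (intro exI[of _ 1] exI[of _ 0]) (auto simp: le_refl)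
    then have "p {#} \<le> 0" unfolding p_def by (intro cInf_lower bdd) auto
    then show ?thesis using True p0[of "{#}"] by simp
  next
    case False
    then have k: "k \<ge> 1" by simp
    show ?thesis
    proof (rule antisym)
      show "p (repeat_mset k x) \<le> real k * p x"
      proof -
        have "p (repeat_mset k x) \<le> real k * p x + 0"
          unfolding p_def by (rule Inf_le_affine[OF ne bdd]) (use k in \<open>auto simp: adm_repeat[OF k]\<close>)
        then show ?thesis by simp
      qed
      have "p x \<le> (1 / real k) * p (repeat_mset k x) + 0"
        unfolding p_def by (rule Inf_le_affine[OF ne bdd]) (use k in \<open>auto simp: adm_repeat[OF k]\<close>)
      then show "real k * p x \<le> p (repeat_mset k x)" using k by (simp add: field_simps)
    qed
  qed
  show ?thesis unfolding sublin_def using p0 padd pmono punit prep by blast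
qed

text \<open>\<open>\<lambda>x. inf\<^sub>n (p (x + n a) - n p a)\<close> is again sublinear and lies below \<open>p\<close>;
  if \<open>p\<close> is minimal the two agree, which makes \<open>p\<close> superadditive in the direction \<open>a\<close>.\<close>
lemma sublin_tilt:
  fixes a :: "'b multiset"
  assumes p: "sublin p"
  defines "q \<equiv> \<lambda>x. INF n. p (x + repeat_mset n a) - real n * p a"
  shows "sublin q" "\<And>x. q x \<le> p x" "\<And>x. q x \<le> p (x + a) - p a"
proof -
  define g where "g x n = p (x + repeat_mset n a) - real n * p a" for x n
  have q: "q x = Inf (range (g x))" for x by (simp add: q_def g_def)
  have g0: "g x n \<ge> 0" for x n
  proof -
    have "le (repeat_mset n a) (x + repeat_mset n a)"
      using le_left[of "repeat_mset n a" x] by (simp add: add.commute)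
    then have "p (repeat_mset n a) \<le> p (x + repeat_mset n a)" by (rule sublinD(4)[OF p])
    then show ?thesis by (simp add: g_def sublinD(3)[OF p])
  qed
  have bdd: "bdd_below (range (g x))" for x using g0 by (intro bdd_belowI[of _ 0]) auto
  have low: "q x \<le> g x n" for x n unfolding q by (intro cInf_lower bdd) auto
  have great: "c \<le> q x" if "\<And>n. c \<le> g x n" for c x unfolding q using that by (intro cInf_greatest) auto
  have step: "g x (Suc n) \<le> g x n" for x n
  proof -
    have "x + repeat_mset (Suc n) a = (x + repeat_mset n a) + a"
      by (rule multiset_eqI) simp
    then have "p (x + repeat_mset (Suc n) a) \<le> p (x + repeat_mset n a) + p a"
      by (metis sublinD(2)[OF p])
    then show ?thesis by (simp add: g_def algebra_simps)
  qed
  have dec: "g x m \<le> g x n" if "n \<le> m" for x n m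
    using step that by (rule lift_Suc_antimono_le)
  have q0: "0 \<le> q x" for x by (rule great) (rule g0)
  have qadd: "q (x + y) \<le> q x + q y" for x y
  proof -
    have *: "q (x + y) \<le> g x n + g y m" for n m
    proof -
      have "q (x + y) \<le> g (x + y) (n + m)" by (rule low)
      also have "g (x + y) (n + m) \<le> g x n + g y m"
      proof -
        have e: "x + y + repeat_mset (n + m) a = (x + repeat_mset n a) + (y + repeat_mset m a)"
          by (rule multiset_eqI) (simp add: algebra_simps)
        have "real (n + m) * p a = real n * p a + real m * p a" by (simp add: algebra_simps)
        then show ?thesis
          using sublinD(2)[OF p, of "x + repeat_mset n a" "y + repeat_mset m a"] unfolding g_def e by linarith
      qed
      finally show ?thesis .
    qed
    have "q (x + y) - g x n \<le> q y" for n using *[of n] by (intro great) (simp add: algebra_simps)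
    then have "q (x + y) - q y \<le> q x" by (intro great) (simp add: algebra_simps)
    then show ?thesis by simp
  qed
  have qmono: "q x \<le> q y" if "le x y" for x y
  proof (rule great)
    fix n
    have "p (x + repeat_mset n a) \<le> p (y + repeat_mset n a)" by (rule sublinD(4)[OF p]) (rule le_add[OF that])
    then have "g x n \<le> g y n" by (simp add: g_def)
    then show "q x \<le> g y n" using low[of x n] by linarith
  qed
  have gu: "g (x + repeat_mset m u) n = g x n + real m" for x m n
  proof -
    have e: "x + repeat_mset m u + repeat_mset n a = (x + repeat_mset n a) + repeat_mset m u" by (simp add: ac_simps)
    show ?thesis unfolding g_def e sublinD(5)[OF p] by simp
  qed
  have qunit: "q (x + repeat_mset m u) = q x + real m" for x m
  proof (rule antisym)
    have "q (x + repeat_mset m u) - real m \<le> q x"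
    proof (rule great)
      fix n show "q (x + repeat_mset m u) - real m \<le> g x n" using low[of "x + repeat_mset m u" n] by (simp add: gu)
    qed
    then show "q (x + repeat_mset m u) \<le> q x + real m" by simp
    show "q x + real m \<le> q (x + repeat_mset m u)"
    proof (rule great)
      fix n show "q x + real m \<le> g (x + repeat_mset m u) n" using low[of x n] by (simp add: gu)
    qed
  qed
  have qrep: "q (repeat_mset k x) = real k * q x" for k x
  proof (cases "k = 0")
    case True
    have "g {#} 0 = 0" using sublinD(3)[OF p, of 0] by (simp add: g_def)
    then show ?thesis using True low[of "{#}" 0] q0[of "{#}"] by simp
  next
    case False
    then have k: "k \<ge> 1" by simp
    have gk: "g (repeat_mset k x) (k * n) = real k * g x n" for n
    proof -
      have e: "repeat_mset k x + repeat_mset (k * n) a = repeat_mset k (x + repeat_mset n a)" by simp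
      show ?thesis unfolding g_def e sublinD(3)[OF p] by (simp add: algebra_simps)
    qed
    show ?thesis
    proof (rule antisym)
      have "q (repeat_mset k x) / real k \<le> q x"
      proof (rule great)
        fix n show "q (repeat_mset k x) / real k \<le> g x n"
          using low[of "repeat_mset k x" "k * n"] k by (simp add: gk field_simps)
      qed
      then show "q (repeat_mset k x) \<le> real k * q x" using k by (simp add: field_simps)
      show "real k * q x \<le> q (repeat_mset k x)"
      proof (rule great)
        fix n
        have "real k * q x \<le> real k * g x n" using low by (intro mult_left_mono) auto
        also have "\<dots> = g (repeat_mset k x) (k * n)" by (simp add: gk)
        also have "\<dots> \<le> g (repeat_mset k x) n" using k by (intro dec) simp
        finally show "real k * q x \<le> g (repeat_mset k x) n" .
      qed
    qed
  qed
  show "sublin q" unfolding sublin_def using q0 qadd qmono qunit qrep by blast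
  show "q x \<le> p x" for x using low[of x 0] by (simp add: g_def)
  show "q x \<le> p (x + a) - p a" for x using low[of x 1] by (simp add: g_def)
qed

lemma sublin_chain_inf:
  assumes C: "C \<noteq> {}" "\<And>p. p \<in> C \<Longrightarrow> sublin p"
    "\<And>p q. p \<in> C \<Longrightarrow> q \<in> C \<Longrightarrow> (\<forall>x. p x \<le> q x) \<or> (\<forall>x. q x \<le> p x)"
  shows "sublin (\<lambda>x. INF p\<in>C. p x)"
proof -
  define q where "q x = (INF p\<in>C. p x)" for x
  have bdd: "bdd_below ((\<lambda>p. p x) ` C)" for x
    using sublinD(1)[OF C(2)] by (intro bdd_belowI[of _ 0]) auto
  have low: "q x \<le> p x" if "p \<in> C" for x p unfolding q_def using that by (intro cINF_lower bdd)
  have great: "c \<le> q x" if "\<And>p. p \<in> C \<Longrightarrow> c \<le> p x" for c x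
    unfolding q_def using C(1) that by (intro cINF_greatest)
  have q0: "0 \<le> q x" for x by (rule great) (use C sublinD(1) in auto)
  have qadd: "q (x + y) \<le> q x + q y" for x y
  proof -
    have *: "q (x + y) \<le> p x + r y" if pr: "p \<in> C" "r \<in> C" for p r
    proof -
      have "q (x + y) \<le> p x + p y" "q (x + y) \<le> r x + r y"
        using low[OF pr(1), of "x + y"] low[OF pr(2), of "x + y"] sublinD(2)[OF C(2)[OF pr(1)], of x y]
          sublinD(2)[OF C(2)[OF pr(2)], of x y] by linarith+
      \<comment> \<open>Subadditivity uses the chain: one of p and r lies below the other
        everywhere, so the same functional can serve both summands.\<close>
      moreover have "(p x \<le> r x \<and> p y \<le> r y) \<or> (r x \<le> p x \<and> r y \<le> p y)" using C(3)[OF pr] by blast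
      ultimately show ?thesis by linarith
    qed
    have "q (x + y) - p x \<le> q y" if "p \<in> C" for p
    proof (rule great)
      fix r assume "r \<in> C"
      from *[OF that this] show "q (x + y) - p x \<le> r y" by linarith
    qed
    then have "q (x + y) - q y \<le> q x" by (intro great) (simp add: algebra_simps)
    then show ?thesis by simp
  qed
  have qmono: "q x \<le> q y" if "le x y" for x y
  proof (rule great)
    fix p assume "p \<in> C"
    then show "q x \<le> p y" using low[of p x] sublinD(4)[OF C(2) that, of p] by simp
  qed
  have qunit: "q (x + repeat_mset m u) = q x + real m" for x m
  proof (rule antisym)
    have "q (x + repeat_mset m u) - real m \<le> q x"
    proof (rule great)
      fix p assume p: "p \<in> C"
      show "q (x + repeat_mset m u) - real m \<le> p x"
        using low[OF p, of "x + repeat_mset m u"] sublinD(5)[OF C(2)[OF p]] by simp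
    qed
    then show "q (x + repeat_mset m u) \<le> q x + real m" by simp
    show "q x + real m \<le> q (x + repeat_mset m u)"
    proof (rule great)
      fix p assume p: "p \<in> C"
      show "q x + real m \<le> p (x + repeat_mset m u)" using low[OF p, of x] sublinD(5)[OF C(2)[OF p]] by simp
    qed
  qed
  have qrep: "q (repeat_mset k x) = real k * q x" for k x
  proof (rule antisym)
    show "real k * q x \<le> q (repeat_mset k x)"
    proof (rule great)
      fix p assume p: "p \<in> C"
      show "real k * q x \<le> p (repeat_mset k x)"
        using low[OF p, of x] sublinD(3)[OF C(2)[OF p]] by (simp add: mult_left_mono)
    qed
    show "q (repeat_mset k x) \<le> real k * q x"
    proof (cases "k = 0")
      case True
      obtain p where p: "p \<in> C" using C(1) by blast
      show ?thesis using low[OF p, of "{#}"] sublinD(3)[OF C(2)[OF p], of 0] True by simp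
    next
      case False
      have "q (repeat_mset k x) / real k \<le> q x"
      proof (rule great)
        fix p assume p: "p \<in> C"
        show "q (repeat_mset k x) / real k \<le> p x"
          using low[OF p, of "repeat_mset k x"] sublinD(3)[OF C(2)[OF p]] False by (simp add: field_simps)
      qed
      then show ?thesis using False by (simp add: field_simps)
    qed
  qed
  have "sublin q" unfolding sublin_def using q0 qadd qmono qunit qrep by blast
  then show ?thesis by (simp add: q_def[abs_def])
qed

text \<open>A minimal sublinear functional exists by Zorn's lemma; \<open>sublin_tilt\<close> makes
  it superadditive, hence a state.\<close>

theorem exists_state:
  assumes nontriv: "\<And>n j. le (repeat_mset n u) (repeat_mset j u) \<Longrightarrow> n \<le> j"
  shows "\<exists>f. state f"
proof -
  \<comment> \<open>Reversed order: the maximal element in Zorn's lemma is then a minimal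
    functional.\<close>
  define P where "P p q \<longleftrightarrow> (\<forall>x. q x \<le> p x)" for p q :: "'b multiset \<Rightarrow> real"
  obtain p1 where p1: "sublin p1" using exists_sublin[OF nontriv] by blast
  have "\<exists>m\<in>{p. sublin p}. \<forall>a\<in>{p. sublin p}. P m a \<longrightarrow> a = m"
  proof (rule predicate_Zorn)
    show "partial_order_on {p. sublin p} (relation_of P {p. sublin p})"
      by (rule partial_order_on_relation_ofI) (auto simp: P_def fun_eq_iff intro: order.trans antisym)
    fix C assume "C \<in> Chains (relation_of P {p. sublin p})"
    then have C: "p \<in> C \<Longrightarrow> sublin p" "p \<in> C \<Longrightarrow> q \<in> C \<Longrightarrow> P p q \<or> P q p" for p q
      unfolding Chains_def relation_of_def by auto
    show "\<exists>q\<in>{p. sublin p}. \<forall>a\<in>C. P a q"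
    proof (cases "C = {}")
      case False
      have "sublin (\<lambda>x. INF p\<in>C. p x)"
        by (rule sublin_chain_inf[OF False]) (use C in \<open>auto simp: P_def\<close>)
      moreover have "P a (\<lambda>x. INF p\<in>C. p x)" if "a \<in> C" for a
        unfolding P_def
      proof
        fix x
        show "(INF p\<in>C. p x) \<le> a x"
          using sublinD(1)[OF C(1)] that by (intro cINF_lower bdd_belowI[of _ 0]) auto
      qed
      ultimately show ?thesis by blast
    qed (use p1 in auto)
  qed
  then obtain p where p: "sublin p" "\<And>q. sublin q \<Longrightarrow> (\<And>x. q x \<le> p x) \<Longrightarrow> q = p"
    unfolding P_def by blast
  have sup: "p x + p a \<le> p (x + a)" for x a
  proof -
    have "(\<lambda>x. INF n. p (x + repeat_mset n a) - real n * p a) = p"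
      by (rule p(2)[OF sublin_tilt(1,2)[OF p(1)]])
    from fun_cong[OF this, of x] show ?thesis using sublin_tilt(3)[OF p(1), of x a] by linarith
  qed
  have "p u = 1"
    using sublinD(5)[OF p(1), of "{#}" 1] sublinD(3)[OF p(1), of 0] by simp
  moreover have "p (x + y) = p x + p y" for x y using sup[of x y] sublinD(2)[OF p(1), of x y] by simp
  ultimately show ?thesis unfolding state_def using sublinD[OF p(1)] by blast
qed

text \<open>Otherwise adjoin the relation \<open>t \<le> s\<close>. If the enlarged preorder still
  has a state, it contradicts the hypothesis; if not, some \<open>n u + i s \<le> j u + i t\<close> with
  \<open>j < n\<close>, and iterating this inequality absorbs the error \<open>j u\<close>.\<close>
theorem state_comparison:
  assumes unperf: "\<And>k k' x y. k' < k \<Longrightarrow> le (repeat_mset k x) (repeat_mset k' y) \<Longrightarrow> le x y"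
    and ut: "le u t"
    and lt: "\<And>f. state f \<Longrightarrow> f s < f t"
  shows "le s t"
proof (rule ccontr)
  assume nst: "\<not> le s t"
  \<comment> \<open>Forces t below s by allowing i copies of s on the left against i copies of t on
    the right; under transitivity the counts add up.\<close>
  define le' where "le' x y \<longleftrightarrow> (\<exists>i. le (x + repeat_mset i s) (y + repeat_mset i t))" for x y
  have le_le': "le' x y" if "le x y" for x y
    unfolding le'_def using that by (intro exI[of _ 0]) simp
  interpret L: unit_preorder le' u
  proof
    show "le' x x" for x by (rule le_le') (rule le_refl)
    show "le' {#} x" for x by (rule le_le') (rule le_zero)
    show "\<exists>n. le' x (repeat_mset n u)" for x using le_unit le_le' by blast
    show "le' (x + z) (y + z)" if xy: "le' x y" for x y z
    proof -
      obtain i where "le (x + repeat_mset i s) (y + repeat_mset i t)" using xy unfolding le'_def by blast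
      then have "le (x + repeat_mset i s + z) (y + repeat_mset i t + z)" by (rule le_add)
      then show ?thesis unfolding le'_def by (intro exI[of _ i]) (simp add: ac_simps)
    qed
    show "le' x z" if xy: "le' x y" and yz: "le' y z" for x y z
    proof -
      obtain i where i: "le (x + repeat_mset i s) (y + repeat_mset i t)" using xy unfolding le'_def by blast
      obtain j where j: "le (y + repeat_mset j s) (z + repeat_mset j t)" using yz unfolding le'_def by blast
      have 1: "le (x + repeat_mset i s + repeat_mset j s) (y + repeat_mset i t + repeat_mset j s)" using i by (rule le_add)
      have 2: "le (y + repeat_mset j s + repeat_mset i t) (z + repeat_mset j t + repeat_mset i t)"
        using j by (rule le_add)
      have eq: "y + repeat_mset j s + repeat_mset i t = y + repeat_mset i t + repeat_mset j s"
        by (simp only: ac_simps)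
      from le_trans[OF 1 2[unfolded eq]] show ?thesis unfolding le'_def
        by (intro exI[of _ "i + j"]) (simp add: repeat_mset_distrib ac_simps)
    qed
  qed
  have "n \<le> j" if nj: "le' (repeat_mset n u) (repeat_mset j u)" for n j
  proof (rule ccontr)
    assume "\<not> n \<le> j"
    then have jn: "j < n" by simp
    obtain i where i: "le (repeat_mset n u + repeat_mset i s) (repeat_mset j u + repeat_mset i t)"
      using nj unfolding le'_def by blast
    define w where "w = repeat_mset j u"
    define X where "X = u + repeat_mset i s"
    define Y where "Y = repeat_mset i t"
    \<comment> \<open>Just one surplus copy of u is kept: n > j gives w + X \<le> w + Y with the
      same w on both sides, so the inequality can be iterated.\<close>
    have e: "w + X = repeat_mset (Suc j) u + repeat_mset i s" by (simp add: w_def X_def ac_simps)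
    have "le (repeat_mset (Suc j) u + repeat_mset i s) (w + Y)"
      unfolding w_def Y_def by (rule le_trans[OF le_add[OF le_repeat_mono] i]) (use jn in simp)
    then have wX: "le (w + X) (w + Y)" by (simp only: e)
    have it: "le (w + repeat_mset m X) (w + repeat_mset m Y)" for m
    proof (induction m)
      case (Suc m)
      have 1: "le (w + repeat_mset m X + X) (w + repeat_mset m Y + X)" by (rule le_add[OF Suc])
      have 2: "le (w + X + repeat_mset m Y) (w + Y + repeat_mset m Y)" by (rule le_add[OF wX])
      have eq: "w + X + repeat_mset m Y = w + repeat_mset m Y + X" by (simp only: ac_simps)
      from le_trans[OF 1 2[unfolded eq]] show ?case by (simp add: ac_simps)
    qed (simp add: le_refl)
    obtain l where l: "le s (repeat_mset l u)" using le_unit by blast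
    \<comment> \<open>After m iterations the m surplus copies of u dominate Suc j copies of s, one
      more than the j copies of t that absorb w through u \<le> t.\<close>
    define m where "m = l * Suc j"
    have 1: "le (repeat_mset (Suc j + m * i) s) (repeat_mset m X)"
    proof -
      have "le (repeat_mset (Suc j) s + repeat_mset (m * i) s) (repeat_mset (Suc j) (repeat_mset l u) + repeat_mset (m * i) s)"
        by (intro le_add le_repeat l)
      moreover have "repeat_mset (Suc j) (repeat_mset l u) + repeat_mset (m * i) s = repeat_mset m X"
        unfolding X_def m_def by (rule multiset_eqI) (simp add: algebra_simps)
      ultimately show ?thesis by (simp only: repeat_mset_distrib)
    qed

    have 2: "le (repeat_mset m X) (w + repeat_mset m X)"
      using le_left[of "repeat_mset m X" w] by (simp add: add.commute)
    have 3: "le (w + repeat_mset m Y) (repeat_mset (j + m * i) t)"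
    proof -
      have "le (w + repeat_mset m Y) (repeat_mset j t + repeat_mset m Y)"
        unfolding w_def by (intro le_add le_repeat ut)
      then show ?thesis by (simp add: Y_def repeat_mset_distrib)
    qed
    have "le (repeat_mset (Suc j + m * i) s) (repeat_mset (j + m * i) t)"
      by (rule le_trans[OF 1 le_trans[OF 2 le_trans[OF it 3]]])
    then have "le s t" by (rule unperf[rotated]) simp
    then show False using nst by simp
  qed
  then obtain f where f: "L.state f" using L.exists_state by blast
  have "state f" using f le_le' unfolding state_def L.state_def by blast
  then have "f s < f t" by (rule lt)
  moreover have "le' t s" unfolding le'_def by (intro exI[of _ 1]) (simp add: add.commute le_refl)
  then have "f t \<le> f s" using f unfolding L.state_def by blast
  ultimately show False by simp
qed

end

section \<open>Direct sums and dimension functions\<close>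

lift_definition osum :: "'a::zero fmat \<Rightarrow> 'a fmat \<Rightarrow> 'a fmat" is mdsum
proof -
  fix a b :: "nat \<Rightarrow> nat \<Rightarrow> 'a"
  assume "fin_mat b"
  then obtain n where "bounded_by n b" by (auto simp: fin_mat_def)
  then have "bounded_by (msize a + n) (mdsum a b)" by (auto simp: bounded_by_def mdsum_def)
  then show "fin_mat (mdsum a b)" by (auto simp: fin_mat_def)
qed

lift_definition shift :: "nat \<Rightarrow> nat \<Rightarrow> 'a::real_algebra_1 fmat" is
  "\<lambda>m n i j. if i = j + m \<and> j < n then 1 else 0"
proof -
  fix m n
  have "bounded_by (m + n) (\<lambda>i j. if i = j + m \<and> j < n then 1 else 0 :: 'a)" by (auto simp: bounded_by_def)
  then show "fin_mat (\<lambda>i j. if i = j + m \<and> j < n then 1 else 0 :: 'a)" by (auto simp: fin_mat_def)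
qed

lemma ent_shift: "ent (shift m n) i j = (if i = j + m \<and> j < n then 1 else 0)"
  by transfer simp

lemma inM_shift: "inM (m + n) (shift m n)"
  by (auto simp: inM_def bounded_by_def ent_shift)

lemma mult_shift_eq_0:
  assumes "inM m a" shows "a * shift m n = 0"
  by (rule fmat_eqI) (auto simp: ent_mult[OF assms] ent_shift intro!: sum.neutral)

lemma ent_shift_mult:
  assumes "inM n b"
  shows "ent (shift m n * b) i j = (if m \<le> i then ent b (i - m) j else 0)"
proof -
  have "ent (shift m n * b) i j = (\<Sum>k<m + n. if k = i - m then (if m \<le> i \<and> k < n then ent b k j else 0) else 0)"
    unfolding ent_mult[OF inM_shift] by (intro sum.cong refl) (auto simp: ent_shift)
  also have "\<dots> = (if m \<le> i then ent b (i - m) j else 0)"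
    using assms by (auto simp: inM_def bounded_by_def)
  finally show ?thesis .
qed

context cstar begin

lemma star_shift_mult_shift: "star (shift m n) * shift m n = fE n"
proof (rule fmat_eqI)
  fix i j
  have "ent (star (shift m n) * shift m n) i j =
    (\<Sum>k<m + n. if k = i + m then (if i < n \<and> k = j + m \<and> j < n then 1 else 0) else 0)"
    unfolding ent_mult[OF inM_star[OF inM_shift]] by (intro sum.cong refl) (auto simp: ent_shift ent_star')
  also have "\<dots> = ent (fE n) i j" by (auto simp: ent_fE)
  finally show "ent (star (shift m n) * shift m n) i j = ent (fE n) i j" .
qed

lemma star_shift_mult_eq_0: "inM m a \<Longrightarrow> star (shift m n) * a = 0"
  using arg_cong[OF mult_shift_eq_0[OF inM_star], of m a star] by (simp add: star_mult)

lemma N_shift_sq_le: "(N (shift m n))\<^sup>2 \<le> 1"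
  using N_fE_le[of n] by (simp flip: N_cstar add: star_shift_mult_shift)

lemma osum_eq:
  assumes b: "inM n b" and m: "m = msize (ent a)"
  shows "osum a b = a + shift m n * b * star (shift m n)"
proof (rule fmat_eqI)
  fix i j
  have b': "inM (m + n) b" by (rule inM_mono[OF b]) simp
  have "ent (shift m n * b * star (shift m n)) i j =
    (\<Sum>k<m + n. if k = j - m then (if m \<le> i \<and> m \<le> j \<and> k < n then ent b (i - m) k else 0) else 0)"
    unfolding ent_mult[OF inM_mult[OF inM_shift b']]
    by (intro sum.cong refl) (auto simp: ent_shift ent_star' ent_shift_mult[OF b])
  also have "\<dots> = (if m \<le> i \<and> m \<le> j then ent b (i - m) (j - m) else 0)"
    using b by (auto simp: inM_def bounded_by_def)
  finally have 1: "ent (shift m n * b * star (shift m n)) i j = (if m \<le> i \<and> m \<le> j then ent b (i - m) (j - m) else 0)" .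
  have a: "bounded_by m (ent a)" unfolding m by (rule bounded_by_msize[OF fin_ent])
  show "ent (osum a b) i j = ent (a + shift m n * b * star (shift m n)) i j"
    unfolding ent_add 1 osum.rep_eq mdsum_def m[symmetric] using a by (auto simp: bounded_by_def)
qed

text \<open>\<open>S\<close> is the isometry that shifts past the block of \<open>a\<close>.\<close>
lemma osum_shift:
  obtains S m n where "osum a b = a + S * b * star S" "star S * S = fE n" "inM n b" "inM m a"
    "a * S = 0" "star S * a = 0" "fE m * S = 0" "star S * fE m = 0" "(N S)\<^sup>2 \<le> 1"
proof -
  obtain n where n: "inM n b" by (metis inM_ex)
  define m where "m = msize (ent a)"
  have m: "inM m a" unfolding m_def inM_def by (rule bounded_by_msize[OF fin_ent])
  show thesis
    by (rule that[of "shift m n" n m])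
       (use n m in \<open>auto simp: osum_eq[OF n m_def] star_shift_mult_shift mult_shift_eq_0
          star_shift_mult_eq_0 N_shift_sq_le\<close>)
qed

lemma cle_unshift: "star S * S = fE n \<Longrightarrow> inM n b \<Longrightarrow> cle b (S * b * star S)"
proof -
  assume S: "star S * S = fE n" and b: "inM n b"
  have "star S * (S * b * star S) * star (star S) = (star S * S) * b * (star S * S)"
    by (simp only: mult.assoc star_star)
  also have "\<dots> = b" using b by (simp add: S fE_left fE_right)
  finally show ?thesis using cle_exact[of "star S" "S * b * star S"] by simp
qed

text \<open>Replaces b by an orthogonal copy T, turning the direct sum into a sum of orthogonal
  elements.\<close>

lemma osum_split:
  assumes "K b"
  obtains T where "osum a b = a + T" "K T" "a * T = 0" "cle T b" "cle b T"
proof -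
  obtain S m n where S: "osum a b = a + S * b * star S" "star S * S = fE n" "inM n b" "inM m a"
    "a * S = 0" "star S * a = 0" "fE m * S = 0" "star S * fE m = 0" "(N S)\<^sup>2 \<le> 1"
    by (rule osum_shift)
  have "a * (S * b * star S) = 0" using S(5) by (simp flip: mult.assoc)
  then show thesis using that[of "S * b * star S"] S assms
    by (auto simp: K_conj' cle_exact cle_unshift)
qed

lemma K_osum: "K a \<Longrightarrow> K b \<Longrightarrow> K (osum a b)"
  by (metis osum_split K_add)

text \<open>Conjugating the diagonal matrix of a and b by the row (1, 1) yields a + b.\<close>

lemma cle_add_osum: "cle (a + b) (osum a b)"
proof -
  obtain S m n where S: "osum a b = a + S * b * star S" "star S * S = fE n" "inM n b" "inM m a"
    "a * S = 0" "star S * a = 0" "fE m * S = 0" "star S * fE m = 0" "(N S)\<^sup>2 \<le> 1"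
    by (rule osum_shift)
  define R where "R = fE m + star S"
  have sR: "star R = fE m + S" by (simp add: R_def star_add)
  have "R * osum a b = (fE m * a + star S * a) + ((fE m * S) * b * star S + (star S * S) * b * star S)"
    by (simp add: R_def S(1) algebra_simps)
  also have "\<dots> = a + b * star S" using S by (simp add: fE_left)
  finally have "R * osum a b * star R = (a * fE m + a * S) + (b * (star S * fE m) + b * (star S * S))"
    by (simp add: sR algebra_simps)
  also have "\<dots> = a + b" using S by (simp add: fE_right)
  finally show ?thesis using cle_exact[of R "osum a b"] by simp
qed

lemma cle_osum:
  assumes "cle a a'" "cle b b'" shows "cle (osum a b) (osum a' b')"
  unfolding cle_def
proof (intro allI impI)
  fix e :: real assume "e > 0"
  then obtain r q where r: "N (r * a' * star r - a) \<le> e / 2" and q: "N (q * b' * star q - b) \<le> e / 2"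
    using assms unfolding cle_def by (meson half_gt_zero)
  obtain S m n where S: "osum a b = a + S * b * star S" "star S * S = fE n" "inM n b" "inM m a"
    "a * S = 0" "star S * a = 0" "fE m * S = 0" "star S * fE m = 0" "(N S)\<^sup>2 \<le> 1"
    by (rule osum_shift)
  obtain S' m' n' where S': "osum a' b' = a' + S' * b' * star S'" "star S' * S' = fE n'" "inM n' b'" "inM m' a'"
    "a' * S' = 0" "star S' * a' = 0" "fE m' * S' = 0" "star S' * fE m' = 0" "(N S')\<^sup>2 \<le> 1"
    by (rule osum_shift)
  \<comment> \<open>The block-diagonal matrix of r and q; the corner units trim r so that its cross
    terms with the shifts vanish.\<close>
  define R where "R = fE m * r * fE m' + S * q * star S'"
  have sR: "star R = fE m' * star r * fE m + S' * star q * star S"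
    by (simp add: R_def star_add star_mult mult.assoc)
  have "R * osum a' b' = fE m * r * (fE m' * a') + fE m * r * (fE m' * S') * b' * star S'
     + S * q * (star S' * a') + S * q * (star S' * S') * b' * star S'"
    by (simp add: R_def S'(1) algebra_simps)
  also have "\<dots> = fE m * r * a' + S * q * b' * star S'"
    using S' fE_left[OF S'(3)] by (simp add: fE_left mult.assoc)
  finally have "R * osum a' b' * star R = fE m * r * (a' * fE m') * star r * fE m + fE m * r * (a' * S') * star q * star S
     + S * q * b' * (star S' * fE m') * star r * fE m + S * q * b' * (star S' * S') * star q * star S"
    by (simp add: sR algebra_simps)
  also have "\<dots> = fE m * (r * a' * star r) * fE m + S * (q * (b' * fE n') * star q) * star S"
    using S' by (simp add: fE_right mult.assoc)
  finally have RR: "R * osum a' b' * star R = fE m * (r * a' * star r) * fE m + S * (q * b' * star q) * star S"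
    using S' by (simp add: fE_right)
  have "a = fE m * a * fE m" using S(4) by (simp add: fE_left fE_right)
  then have "R * osum a' b' * star R - osum a b =
      (fE m * (r * a' * star r) * fE m - fE m * a * fE m) + (S * (q * b' * star q) * star S - S * b * star S)"
    using RR S(1) by simp
  also have "\<dots> = fE m * (r * a' * star r - a) * star (fE m) + S * (q * b' * star q - b) * star S"
    by (simp add: algebra_simps)
  also have "N \<dots> \<le> (N (fE m))\<^sup>2 * N (r * a' * star r - a) + (N S)\<^sup>2 * N (q * b' * star q - b)"
    by (intro order.trans[OF N_triangle] add_mono N_conj_le)
  also have "\<dots> \<le> 1 * (e / 2) + 1 * (e / 2)"
    using r q S(9) N_fE_le[of m] by (intro add_mono mult_mono) (auto simp: power_le_one)
  finally show "\<exists>r. N (r * osum a' b' * star r - osum a b) \<le> e" by auto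
qed

text \<open>y is below y^2, and y^2 below y^4 = y^3 y; \<open>cle_factor\<close> drops the last
  factor.\<close>

lemma cle_cube: assumes "K y" shows "cle y (y * y * y)"
proof -
  have K2: "K (y * y)" by (rule K_sa_sq[OF K_sa[OF assms]])
  have K3: "K (y * y * y)" using K_conj[OF assms, of y] K_sa[OF assms] by simp
  obtain n where n: "inM n y" by (metis inM_ex)
  have "cle (y * y * (y * y)) (y * y * y)"
  proof (rule cle_factor[OF _ _ K3])
    show "K (y * y * (y * y))" by (rule K_sa_sq[OF K_sa[OF K2]])
    show "y * y * (y * y) = fE n * (y * y * y) * y"
      using fE_left[OF n] by (simp flip: mult.assoc)
  qed
  then show ?thesis using cle_square[OF assms] cle_square[OF K2] cle_trans by blast
qed

text \<open>Since ab = 0, conjugating a + b by the column (a, b) gives the diagonal matrix of a^3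
  and b^3. This is the cube of the direct sum, and \<open>cle_cube\<close> removes the cube.\<close>

lemma cle_osum_add:
  assumes a: "K a" and b: "K b" and ab: "a * b = 0"
  shows "cle (osum a b) (a + b)"
proof -
  obtain S m n where S: "osum a b = a + S * b * star S" "star S * S = fE n" "inM n b" "inM m a"
    "a * S = 0" "star S * a = 0" "fE m * S = 0" "star S * fE m = 0" "(N S)\<^sup>2 \<le> 1"
    by (rule osum_shift)
  have ba: "b * a = 0" using a b ab by (rule orth_commute)
  define y where "y = osum a b"
  define T where "T = S * b * star S"
  have y: "y = a + T" by (simp add: y_def T_def S)
  have aT: "a * T = 0" unfolding T_def using S(5) by (simp flip: mult.assoc)
  have Ta: "T * a = 0" unfolding T_def using S(6) by (simp add: mult.assoc)
  have TT: "T * T = S * (b * b) * star S"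
  proof -
    have "T * T = S * b * (star S * S) * b * star S" by (simp add: T_def mult.assoc)
    then show ?thesis using fE_right[OF S(3)] by (simp add: S(2) mult.assoc)
  qed
  have TTT: "T * T * T = S * (b * b * b) * star S"
  proof -
    have "T * T * T = S * (b * b) * (star S * S) * b * star S" unfolding TT by (simp add: T_def mult.assoc)
    then show ?thesis using fE_left[OF S(3)] by (simp add: S(2) mult.assoc)
  qed
  have yy: "y * y = a * a + T * T" by (simp add: y algebra_simps aT Ta)
  have "y * y * y = (a * a + T * T) * (a + T)" unfolding yy by (simp only: y)
  also have "\<dots> = a * a * a + a * (a * T) + T * (T * a) + T * T * T"
    by (simp add: algebra_simps)
  finally have yyy: "y * y * y = a * a * a + S * (b * b * b) * star S" by (simp add: aT Ta TTT)
  define R where "R = a + S * b"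
  have sR: "star R = a + b * star S" using a b by (simp add: R_def star_add star_mult K_sa)
  have "R * (a + b) = a * a + S * (b * b)" by (simp add: R_def algebra_simps ab ba)
  then have "R * (a + b) * star R = a * a * a + a * (a * b) * star S + S * (b * (b * a)) + S * (b * b * b) * star S"
    by (simp add: sR algebra_simps)
  then have "R * (a + b) * star R = y * y * y" by (simp add: yyy ab ba)
  then have "cle (y * y * y) (a + b)" using cle_exact[of R "a + b"] by simp
  then show ?thesis using cle_cube[of y] cle_trans K_osum[OF a b] by (auto simp: y_def)
qed

lemma cle_osum_commute: assumes "K a" "K b" shows "cle (osum a b) (osum b a)"
proof -
  obtain T where T: "osum a b = a + T" "K T" "a * T = 0" "cle T b" "cle b T" by (rule osum_split[OF assms(2)])
  have "cle (T + a) (osum T a)" by (rule cle_add_osum)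
  moreover have "cle (osum T a) (osum b a)" by (rule cle_osum[OF T(4) cle_refl])
  ultimately show ?thesis using cle_trans T(1) by (metis add.commute)
qed

text \<open>A threefold direct sum is written as a plain sum a + U + V, where order and brackets do
  not matter; \<open>cle_add_osum\<close> reads it in any arrangement.\<close>

lemma cle_osum_assoc:
  assumes "K b" "K c"
  shows "cle (osum a (osum b c)) (osum b (osum a c))" "cle (osum a (osum b c)) (osum (osum a b) c)"
proof -
  obtain S m n where S: "osum a (osum b c) = a + S * (osum b c) * star S" "star S * S = fE n" "inM n (osum b c)" "inM m a"
    "a * S = 0" "star S * a = 0" "fE m * S = 0" "star S * fE m = 0" "(N S)\<^sup>2 \<le> 1"
    by (rule osum_shift)
  obtain T where T: "osum b c = b + T" "K T" "b * T = 0" "cle T c" "cle c T" by (rule osum_split[OF assms(2)])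
  define U V where "U = S * b * star S" and "V = S * T * star S"
  have e: "osum a (osum b c) = a + U + V" by (simp add: S(1)) (simp add: T(1) U_def V_def algebra_simps)
  have U: "cle U b" unfolding U_def by (rule cle_exact)
  have V: "cle V c" unfolding V_def using cle_trans[OF cle_exact T(4)] .
  have "cle (U + (a + V)) (osum U (a + V))" by (rule cle_add_osum)
  moreover have "cle (osum U (a + V)) (osum b (osum a c))"
    by (intro cle_osum U cle_trans[OF cle_add_osum] V cle_refl)
  ultimately show "cle (osum a (osum b c)) (osum b (osum a c))" unfolding e
    by (metis cle_trans add.assoc add.commute)
  have "cle (a + U + V) (osum (a + U) V)" by (rule cle_add_osum)
  moreover have "cle (osum (a + U) V) (osum (osum a b) c)"
    by (intro cle_osum V cle_trans[OF cle_add_osum[of a U]] U cle_refl)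
  ultimately show "cle (osum a (osum b c)) (osum (osum a b) c)" unfolding e by (rule cle_trans)
qed

lemma cle_osum_0: assumes "K a" shows "cle (osum a 0) a" "cle a (osum a 0)" "cle (osum 0 a) a" "cle a (osum 0 a)"
  using cle_osum_add[of a 0] cle_add_osum[of a 0] cle_osum_add[of 0 a] cle_add_osum[of 0 a] assms by auto

section \<open>Iterated direct sums and multisets\<close>

primrec ds :: "'a fmat list \<Rightarrow> 'a fmat" where
  "ds [] = 0"
| "ds (x # xs) = osum x (ds xs)"

definition Kl :: "'a fmat list \<Rightarrow> bool" where "Kl xs \<longleftrightarrow> (\<forall>x\<in>set xs. K x)"

lemma Kl_simps [simp]: "Kl []" "Kl (x # xs) \<longleftrightarrow> K x \<and> Kl xs" "Kl (xs @ ys) \<longleftrightarrow> Kl xs \<and> Kl ys"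
  by (auto simp: Kl_def)

lemma K_ds: "Kl xs \<Longrightarrow> K (ds xs)"
  by (induction xs) (auto intro: K_osum)

lemma ds_move:
  assumes "K x" "Kl vs" "Kl us"
  shows "cle (ds (us @ x # vs)) (ds (x # us @ vs)) \<and> cle (ds (x # us @ vs)) (ds (us @ x # vs))"
  using assms(3)
proof (induction us)
  case (Cons u us)
  have K: "K (ds (us @ vs))" using Cons.prems assms by (intro K_ds) auto
  have "cle (ds ((u # us) @ x # vs)) (osum u (osum x (ds (us @ vs))))"
    using Cons.IH Cons.prems by (auto intro: cle_osum cle_refl)
  moreover have "cle (osum u (osum x (ds (us @ vs)))) (osum x (osum u (ds (us @ vs))))"
    by (rule cle_osum_assoc(1)[OF assms(1) K])
  ultimately have 1: "cle (ds ((u # us) @ x # vs)) (ds (x # (u # us) @ vs))" by (auto intro: cle_trans)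
  have "cle (osum x (osum u (ds (us @ vs)))) (osum u (osum x (ds (us @ vs))))"
    using Cons.prems by (intro cle_osum_assoc(1) K) auto
  moreover have "cle (osum u (osum x (ds (us @ vs)))) (ds ((u # us) @ x # vs))"
    using Cons.IH Cons.prems by (auto intro: cle_osum cle_refl)
  ultimately have "cle (ds (x # (u # us) @ vs)) (ds ((u # us) @ x # vs))" by (auto intro: cle_trans)
  with 1 show ?case by blast
qed (auto intro: cle_refl)

text \<open>Justifies passing from lists to multisets.\<close>

lemma ds_perm: "mset xs = mset ys \<Longrightarrow> Kl xs \<Longrightarrow> cle (ds xs) (ds ys)"
proof (induction xs arbitrary: ys)
  case (Cons x xs)
  then have "x \<in> set ys" by (metis list.set_intros(1) set_mset_mset)
  then obtain us vs where ys: "ys = us @ x # vs" by (meson split_list)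
  have Ky: "Kl ys" using Cons.prems unfolding Kl_def by (metis set_mset_mset)
  have "mset xs = mset (us @ vs)" using Cons.prems ys by simp
  then have "cle (ds xs) (ds (us @ vs))" using Cons.IH Cons.prems by simp
  then have "cle (ds (x # xs)) (ds (x # us @ vs))" by (auto intro: cle_osum cle_refl)
  moreover have "cle (ds (x # us @ vs)) (ds ys)"
    unfolding ys by (rule ds_move[THEN conjunct2]) (use Ky ys in auto)
  ultimately show ?case by (rule cle_trans)
qed (auto intro: cle_refl)

lemma ds_append:
  assumes "Kl xs" "Kl ys"
  shows "cle (ds (xs @ ys)) (osum (ds xs) (ds ys)) \<and> cle (osum (ds xs) (ds ys)) (ds (xs @ ys))"
  using assms(1)
proof (induction xs)
  case Nil
  show ?case using cle_osum_0[OF K_ds[OF assms(2)]] by auto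
next
  case (Cons x xs)
  then have K: "K x" "K (ds xs)" "K (ds ys)" using assms by (auto intro: K_ds)
  have "cle (ds ((x # xs) @ ys)) (osum x (osum (ds xs) (ds ys)))"
    using Cons by (auto intro: cle_osum cle_refl)
  from cle_trans[OF this cle_osum_assoc(2)[OF K(2,3)]]
  have 1: "cle (ds ((x # xs) @ ys)) (osum (ds (x # xs)) (ds ys))" by simp
  have "cle (osum (osum x (ds xs)) (ds ys)) (osum (ds ys) (osum x (ds xs)))"
    using K by (intro cle_osum_commute K_osum)
  moreover have "cle (osum (ds ys) (osum x (ds xs))) (osum x (osum (ds ys) (ds xs)))"
    by (rule cle_osum_assoc(1)[OF K(1,2)])
  moreover have "cle (osum x (osum (ds ys) (ds xs))) (osum x (osum (ds xs) (ds ys)))"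
    using K by (intro cle_osum cle_osum_commute cle_refl)
  moreover have "cle (osum x (osum (ds xs) (ds ys))) (ds ((x # xs) @ ys))"
    using Cons by (auto intro: cle_osum cle_refl)
  ultimately have "cle (osum (osum x (ds xs)) (ds ys)) (ds ((x # xs) @ ys))"
    by (meson cle_trans)
  with 1 show ?case by simp
qed

text \<open>Connects list sums with \<open>mrep\<close>, in which almost unperforation is
  stated.\<close>

lemma ent_ds_replicate: "ent (ds (replicate k a)) = mrep k (ent a)"
  by (induction k) (auto simp: zero_fmat.rep_eq osum.rep_eq)

lemma ds_concat_replicate:
  assumes "Kl xs"
  shows "cle (ds (concat (replicate k xs))) (ds (replicate k (ds xs))) \<and>
    cle (ds (replicate k (ds xs))) (ds (concat (replicate k xs)))"
proof (induction k)
  case (Suc k)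
  have K: "Kl (concat (replicate k xs))" using assms by (auto simp: Kl_def)
  have "cle (ds (concat (replicate (Suc k) xs))) (ds (replicate (Suc k) (ds xs)))"
    using cle_trans[OF ds_append[OF assms K, THEN conjunct1] cle_osum[OF cle_refl Suc[THEN conjunct1]]] by simp
  moreover have "cle (ds (replicate (Suc k) (ds xs))) (ds (concat (replicate (Suc k) xs)))"
    using cle_trans[OF cle_osum[OF cle_refl Suc[THEN conjunct2]] ds_append[OF assms K, THEN conjunct2]] by simp
  ultimately show ?case by blast
qed (auto intro: cle_refl)

text \<open>A finite multiset stands for the sum in \<open>W(A)\<close> of the classes of its positive elements;
  other elements are ignored, so that \<open>mle\<close> is a preorder on the whole type.\<close>
definition rep :: "'a fmat multiset \<Rightarrow> 'a fmat list" where
  "rep X = (SOME xs. mset xs = filter_mset K X)"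

definition mle :: "'a fmat multiset \<Rightarrow> 'a fmat multiset \<Rightarrow> bool" where
  "mle X Y \<longleftrightarrow> cle (ds (rep X)) (ds (rep Y))"

lemma mset_rep: "mset (rep X) = filter_mset K X"
  unfolding rep_def by (rule someI_ex) (rule ex_mset)

lemma Kl_mset: "mset xs = filter_mset K X \<Longrightarrow> Kl xs"
  unfolding Kl_def by (metis mem_Collect_eq set_mset_filter set_mset_mset)

lemma Kl_rep: "Kl (rep X)"
  by (rule Kl_mset[OF mset_rep])

lemma mle_iff:
  assumes "mset xs = filter_mset K X" "mset ys = filter_mset K Y"
  shows "mle X Y \<longleftrightarrow> cle (ds xs) (ds ys)"
proof -
  have "cle (ds xs) (ds (rep X))" "cle (ds (rep X)) (ds xs)" "cle (ds ys) (ds (rep Y))" "cle (ds (rep Y)) (ds ys)"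
    using assms by (auto intro!: ds_perm simp: mset_rep Kl_mset[OF assms(1)] Kl_mset[OF assms(2)] Kl_rep)
  then show ?thesis unfolding mle_def by (meson cle_trans)
qed

lemma mle_refl: "mle X X"
  and mle_trans: "mle X Y \<Longrightarrow> mle Y Z \<Longrightarrow> mle X Z"
  and mle_zero: "mle {#} X"
  unfolding mle_def using cle_refl cle_trans cle_0 mset_rep[of "{#}"] by auto

lemma mle_add: assumes "mle X Y" shows "mle (X + Z) (Y + Z)"
proof (induction Z)
  case (add z Z)
  show ?case
  proof (cases "K z")
    case True
    have "cle (ds (z # rep (X + Z))) (ds (z # rep (Y + Z)))"
      using add unfolding mle_def by (auto intro: cle_osum cle_refl)
    moreover have "mset (z # rep (X + Z)) = filter_mset K (X + add_mset z Z)"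
      "mset (z # rep (Y + Z)) = filter_mset K (Y + add_mset z Z)"
      using True by (simp_all add: mset_rep)
    ultimately show ?thesis using mle_iff by blast
  next
    case False
    then have "mset (rep (X + Z)) = filter_mset K (X + add_mset z Z)"
      "mset (rep (Y + Z)) = filter_mset K (Y + add_mset z Z)" by (simp_all add: mset_rep)
    then show ?thesis using add mle_iff unfolding mle_def by blast
  qed
qed (use assms in simp)

lemma mle_single: assumes "K a" "K b" shows "mle {#a#} {#b#} \<longleftrightarrow> cle a b"
proof -
  have "mle {#a#} {#b#} \<longleftrightarrow> cle (ds [a]) (ds [b])" by (rule mle_iff) (use assms in auto)
  then show ?thesis using cle_osum_0[OF assms(1)] cle_osum_0[OF assms(2)] by simp (meson cle_trans)
qed

lemma mle_add_mset:
  assumes "mle X Y" "K a" "K b" "cle a b" shows "mle (add_mset a X) (add_mset b Y)"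
proof -
  have "mle ({#a#} + X) ({#b#} + X)" using assms by (intro mle_add) (simp add: mle_single)
  moreover have "mle (X + {#b#}) (Y + {#b#})" using assms by (intro mle_add)
  ultimately show ?thesis using mle_trans by simp
qed

text \<open>a is the conjugate of \<open>fE n\<close> by its own square root.\<close>

lemma cle_fE: assumes "K a" "inM n a" shows "cle a (fE n)"
proof -
  have "inM n (rt a)" unfolding rt_def by (rule inM_fc[OF assms(2,1) fcont_sqrt])
  then have "rt a * fE n * star (rt a) = a" using assms by (simp add: star_rt rt_sq fE_right)
  then show ?thesis using cle_exact[of "rt a" "fE n"] by simp
qed

lemma osum_fE: "osum (fE 1) (fE n) = (fE (Suc n) :: 'a fmat)"
proof -
  have "bounded_by m (ent (fE 1 :: 'a fmat)) \<longleftrightarrow> 1 \<le> m" for m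
    by (auto simp: bounded_by_def ent_fE not_le)
  then have "msize (ent (fE 1 :: 'a fmat)) = 1" unfolding msize_def by (auto intro: Least_equality)
  then show ?thesis
    by (intro fmat_eqI) (auto simp: osum.rep_eq mdsum_def ent_fE)
qed

lemma ds_replicate_fE: "ds (replicate n (fE 1)) = (fE n :: 'a fmat)"
proof (induction n)
  case 0
  show ?case by (rule fmat_eqI) (simp add: ent_fE)
next
  case (Suc n)
  then show ?case using osum_fE[of n] by simp
qed

abbreviation uu :: "'a fmat multiset" where "uu \<equiv> {#fE 1#}"

lemma filter_repeat_mset: "filter_mset P (repeat_mset k X) = repeat_mset k (filter_mset P X)"
  by (induction k) auto

lemma mle_single_unit:
  assumes "K a" "inM n a" shows "mle {#a#} (repeat_mset n uu)"
proof -
  have "mle {#a#} (repeat_mset n uu) \<longleftrightarrow> cle (ds [a]) (ds (replicate n (fE 1)))"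
    by (rule mle_iff) (use assms in \<open>simp_all only: filter_repeat_mset, simp_all\<close>)
  moreover have "cle (ds [a]) (ds (replicate n (fE 1)))"
    unfolding ds_replicate_fE using cle_trans[OF cle_osum_0(1)[OF assms(1)] cle_fE[OF assms]] by simp
  ultimately show ?thesis by (rule iffD2)
qed

lemma mle_unit: "\<exists>n. mle X (repeat_mset n uu)"
proof (induction X)
  case empty
  then show ?case using mle_zero by blast
next
  case (add x X)
  then obtain n where n: "mle X (repeat_mset n uu)" by blast
  obtain m where m: "mle {#x#} (repeat_mset m uu)"
  proof (cases "K x")
    case True
    obtain m where "inM m x" by (metis inM_ex)
    then show thesis using mle_single_unit[OF True] that by blast
  next
    case False
    then have "mle {#x#} {#} \<longleftrightarrow> cle (ds []) (ds [])" by (intro mle_iff) auto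
    then show thesis using that[of 0] cle_refl by simp
  qed
  have 1: "mle ({#x#} + X) (repeat_mset m uu + X)" by (rule mle_add[OF m])
  have 2: "mle (repeat_mset m uu + X) (repeat_mset (n + m) uu)"
    using mle_add[OF n, of "repeat_mset m uu"] by (simp only: repeat_mset_distrib add.commute)
  show ?case using mle_trans[OF 1 2]
    by (intro exI[of _ "n + m"]) (simp del: repeat_mset_replicate_mset repeat_mset_distrib_add_mset)
qed

interpretation W: unit_preorder mle uu
  by unfold_locales (fact mle_refl, erule (1) mle_trans, erule mle_add, rule mle_zero, rule mle_unit)

lemma mset_concat_replicate: "mset (concat (replicate k xs)) = repeat_mset k (mset xs)"
  by (induction k) auto

lemma mle_unperforated:
  assumes W: "W_almost_unperforated sc st TYPE('a)"
    and k: "k' < k" and le: "mle (repeat_mset k X) (repeat_mset k' Y)"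
  shows "mle X Y"
proof -
  define a b where "a = ds (rep X)" and "b = ds (rep Y)"
  have "mle (repeat_mset k X) (repeat_mset k' Y) \<longleftrightarrow>
    cle (ds (concat (replicate k (rep X)))) (ds (concat (replicate k' (rep Y))))"
    by (rule mle_iff) (simp_all add: mset_concat_replicate filter_repeat_mset mset_rep)
  then have "cle (ds (replicate k a)) (ds (replicate k' b))"
    using le ds_concat_replicate[OF Kl_rep[of X], of k] ds_concat_replicate[OF Kl_rep[of Y], of k']
    unfolding a_def b_def by (meson cle_trans)
  then have "cuntz_le sc st (mrep k (ent a)) (mrep k' (ent b))"
    by (simp add: cuntz_le_ent flip: ent_ds_replicate)
  moreover have "mpos st (ent a)" "mpos st (ent b)" by (simp_all add: mpos_ent a_def b_def K_ds Kl_rep)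
  ultimately have "cuntz_le sc st (ent a) (ent b)" using W k unfolding W_almost_unperforated_def by blast
  then show ?thesis by (simp add: cuntz_le_ent mle_def a_def b_def)
qed

lemma ep_mono': "K a \<Longrightarrow> 0 < d \<Longrightarrow> d \<le> e \<Longrightarrow> cle (ep e a) (ep d a)"
  using ep_mono[of a d e] cle_refl by (cases "d = e") auto

text \<open>The direct sum is written as x + T, a norm limit of cut-downs of x plus T, and the left
  side of a Cuntz comparison may pass to the limit.\<close>

lemma mle_ep_single:
  assumes x: "K x" and le: "\<And>e. e > 0 \<Longrightarrow> mle (add_mset (ep e x) Z) Y"
  shows "mle (add_mset x Z) Y"
proof -
  define b where "b = ds (rep Z)"
  have b: "K b" unfolding b_def by (intro K_ds Kl_rep)
  have eq: "mle (add_mset y Z) Y \<longleftrightarrow> cle (osum y b) (ds (rep Y))" if "K y" for y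
  proof -
    have "mle (add_mset y Z) Y \<longleftrightarrow> cle (ds (y # rep Z)) (ds (rep Y))"
      by (rule mle_iff) (use that in \<open>auto simp: mset_rep\<close>)
    then show ?thesis by (simp add: b_def)
  qed
  obtain T where T: "osum x b = x + T" "K T" "x * T = 0" "cle T b" "cle b T" by (rule osum_split[OF b])
  have "cle (osum x b) (ds (rep Y))"
  proof (rule cle_closed)
    fix e :: real assume e: "e > 0"
    have "cle (ep e x + T) (osum (ep e x) T)" by (rule cle_add_osum)
    moreover have "cle (osum (ep e x) T) (osum (ep e x) b)" by (intro cle_osum cle_refl T)
    moreover have "cle (osum (ep e x) b) (ds (rep Y))" using le[OF e] eq[OF K_ep[OF x]] e by simp
    ultimately have "cle (ep e x + T) (ds (rep Y))" by (meson cle_trans)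
    moreover have "N (osum x b - (ep e x + T)) \<le> e" using N_minus_ep[OF x, of e] e by (simp add: T(1))
    ultimately show "\<exists>a'. N (osum x b - a') \<le> e \<and> cle a' (ds (rep Y))" by blast
  qed
  then show ?thesis using eq[OF x] by simp
qed

lemma mle_ep_image:
  assumes "\<forall>x\<in>#X. K x" "0 < d" "d \<le> e"
  shows "mle (image_mset (ep e) X) (image_mset (ep d) X)"
  using assms(1)
proof (induction X)
  case (add x X)
  then show ?case using assms(2,3) by (auto intro!: mle_add_mset K_ep ep_mono')
qed (simp add: mle_refl)

text \<open>The hypothesis has one e for all summands, while the induction releases them one by one,
  each with its own e; the minimum of the two reconciles them.\<close>

lemma mle_ep:
  assumes "\<forall>x\<in>#X. K x" "\<And>e. e > 0 \<Longrightarrow> mle (image_mset (ep e) X + Z) Y"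
  shows "mle (X + Z) Y"
  using assms
proof (induction X arbitrary: Z)
  case empty
  from empty.prems(2)[of 1] show ?case by simp
next
  case (add x X)
  have x: "K x" and X: "\<forall>x\<in>#X. K x" using add.prems(1) by auto
  have "mle (add_mset (ep e1 x) (X + Z)) Y" if e1: "e1 > 0" for e1
  proof -
    have "mle (X + add_mset (ep e1 x) Z) Y"
    proof (rule add.IH[OF X])
      fix e2 :: real assume e2: "e2 > 0"
      define e where "e = min e1 e2"
      have e: "e > 0" "e \<le> e1" "e \<le> e2" using e1 e2 by (auto simp: e_def)
      have "mle (add_mset (ep e1 x) (image_mset (ep e2) X)) (add_mset (ep e x) (image_mset (ep e) X))"
        using e e1 by (intro mle_add_mset mle_ep_image X K_ep x ep_mono') auto
      from mle_add[OF this, of Z] add.prems(2)[OF e(1)]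
      have "mle (add_mset (ep e1 x) (image_mset (ep e2) X) + Z) Y" by (auto intro: mle_trans)
      then show "mle (image_mset (ep e2) X + add_mset (ep e1 x) Z) Y" by simp
    qed
    then show ?thesis by simp
  qed
  from mle_ep_single[OF x this] show ?case by simp
qed

section \<open>Dimension functions\<close>

definition df :: "('a fmat \<Rightarrow> real) \<Rightarrow> bool" where
  "df d \<longleftrightarrow> (\<forall>a. K a \<longrightarrow> 0 \<le> d a) \<and> d (fE 1) = 1 \<and>
     (\<forall>a b. K a \<and> K b \<and> a * b = 0 \<longrightarrow> d (a + b) = d a + d b) \<and>
     (\<forall>a b. K a \<and> K b \<and> cle a b \<longrightarrow> d a \<le> d b)"

lemma dfD:
  assumes "df d"
  shows "K a \<Longrightarrow> 0 \<le> d a" "d (fE 1) = 1" "K a \<Longrightarrow> K b \<Longrightarrow> a * b = 0 \<Longrightarrow> d (a + b) = d a + d b"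
    "K a \<Longrightarrow> K b \<Longrightarrow> cle a b \<Longrightarrow> d a \<le> d b"
  using assms unfolding df_def by blast+

lemma mpos_imp_ent: assumes "mpos st a" shows "\<exists>a'. a = ent a' \<and> K a'"
proof -
  have "ent (Fmat a) = a" using assms by (intro ent_Fmat) (simp add: mpos_def)
  then show ?thesis using assms mpos_ent[of "Fmat a"] by metis
qed

lemma is_dimfun_ent: "is_dimfun sc st d \<longleftrightarrow> df (\<lambda>a. d (ent a))"
proof -
  have all: "(\<forall>a. mpos st a \<longrightarrow> P a) \<longleftrightarrow> (\<forall>a. K a \<longrightarrow> P (ent a))" for P
    using mpos_imp_ent mpos_ent by metis
  have all2: "(\<forall>a b. mpos st a \<and> mpos st b \<and> Q a b \<longrightarrow> P a b) \<longleftrightarrow>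
     (\<forall>a b. K a \<and> K b \<and> Q (ent a) (ent b) \<longrightarrow> P (ent a) (ent b))" for P Q
    using mpos_imp_ent mpos_ent by metis
  show ?thesis
    unfolding is_dimfun_def df_def all all2 cuntz_le_ent fE.rep_eq[symmetric]
      zero_fmat.rep_eq[symmetric] times_fmat.rep_eq[symmetric] plus_fmat.rep_eq[symmetric] ent_inject ..
qed

text \<open>The supremum in \<open>LDF\<close> written with an error e, a form that convex
  combinations respect.\<close>

definition ldf :: "('a fmat \<Rightarrow> real) \<Rightarrow> bool" where
  "ldf d \<longleftrightarrow> df d \<and> (\<forall>a e. K a \<and> e > 0 \<longrightarrow> (\<exists>\<epsilon>>0. d a - e \<le> d (ep \<epsilon> a)))"

lemma df_ep_le: "df d \<Longrightarrow> K a \<Longrightarrow> e > 0 \<Longrightarrow> d (ep e a) \<le> d a"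
  by (rule dfD(4)) (auto intro: K_ep ep_cle)

lemma df_ep_mono: "df d \<Longrightarrow> K a \<Longrightarrow> 0 < e \<Longrightarrow> e \<le> e' \<Longrightarrow> d (ep e' a) \<le> d (ep e a)"
  by (rule dfD(4)) (auto intro: K_ep ep_mono')

lemma bdd_ep: "df d \<Longrightarrow> K a \<Longrightarrow> bdd_above ((\<lambda>e. d (ep e a)) ` {0<..})"
  using df_ep_le by (intro bdd_aboveI[of _ "d a"]) auto

lemma ldf_sup:
  assumes "ldf d" "K a" shows "d a = (SUP e\<in>{0<..}. d (ep e a))"
proof (rule antisym)
  have d: "df d" using assms(1) by (simp add: ldf_def)
  show "d a \<le> (SUP e\<in>{0<..}. d (ep e a))"
  proof (rule field_le_epsilon)
    fix e :: real assume "e > 0"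
    then obtain \<epsilon> where "\<epsilon> > 0" "d a - e \<le> d (ep \<epsilon> a)" using assms unfolding ldf_def by blast
    moreover have "d (ep \<epsilon> a) \<le> (SUP e\<in>{0<..}. d (ep e a))"
      using \<open>\<epsilon> > 0\<close> by (intro cSUP_upper bdd_ep d assms(2)) auto
    ultimately show "d a \<le> (SUP e\<in>{0<..}. d (ep e a)) + e" by linarith
  qed
  show "(SUP e\<in>{0<..}. d (ep e a)) \<le> d a"
    using df_ep_le[OF d assms(2)] by (intro cSUP_least) (auto simp: exI[of _ 1])
qed

lemma LDF_ent:
  assumes "ldf d" shows "(\<lambda>a. d (Fmat a)) \<in> LDF sc st"
proof -
  have e: "(\<lambda>a. d (Fmat (ent a))) = d" by (simp add: ent_inverse)
  have "is_dimfun sc st (\<lambda>a. d (Fmat a))" using assms by (simp add: is_dimfun_ent e ldf_def)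
  moreover have "d (Fmat a) = (SUP \<epsilon>\<in>{0<..}. d (Fmat (fpos sc st \<epsilon> a)))" if pos: "mpos st a" for a
  proof -
    obtain a' where a': "a = ent a'" "K a'" using mpos_imp_ent[OF pos] by blast
    have "d (Fmat (fpos sc st \<epsilon> a)) = d (ep \<epsilon> a')" if "\<epsilon> \<in> {0<..}" for \<epsilon>
      using that by (simp add: a' fpos_ent ent_inverse)
    then show ?thesis using ldf_sup[OF assms a'(2)] by (simp add: a'(1) ent_inverse)
  qed
  ultimately show ?thesis by (simp add: LDF_def DF_def)
qed

text \<open>The cut-down is within 1/2 of the corner unit, hence invertible in the corner. This
  keeps the regularization of a dimension function normalized.\<close>

lemma fE_cle_ep: "cle (fE n) (ep (1/2) (fE n))"
proof -
  define c where "c = ep (1/2) (fE n)"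
  have Kc: "K c" unfolding c_def by (rule K_ep) auto
  have cn: "inM n c" unfolding c_def ep_def by (rule inM_fc) (auto intro: fcont_f_eps)
  have "N (fE n - c) \<le> 1/2" unfolding c_def by (rule N_minus_ep) auto
  then have "N (fE n - c) < 1" by simp
  then obtain z where z: "inM n z" "(fE n - (fE n - c)) * z = fE n"
    using neumann_right[OF inM_diff[OF inM_fE cn]] by blast
  then have "fE n = fE n * c * z" using fE_left[OF cn] by simp
  then show ?thesis unfolding c_def[symmetric] by (rule cle_factor[OF K_fE _ Kc])
qed

section \<open>Lower semicontinuous regularization\<close>

definition lsr :: "('a fmat \<Rightarrow> real) \<Rightarrow> 'a fmat \<Rightarrow> real" where
  "lsr d a = (SUP e\<in>{0<..}. d (ep e a))"

lemma lsr_upper: "df d \<Longrightarrow> K a \<Longrightarrow> e > 0 \<Longrightarrow> d (ep e a) \<le> lsr d a"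
  unfolding lsr_def by (intro cSUP_upper bdd_ep) auto

lemma lsr_least: "(\<And>e. e > 0 \<Longrightarrow> d (ep e a) \<le> c) \<Longrightarrow> lsr d a \<le> c"
  unfolding lsr_def by (intro cSUP_least) (auto simp: exI[of _ 1])

lemma lsr_le: "df d \<Longrightarrow> K a \<Longrightarrow> lsr d a \<le> d a"
  by (intro lsr_least df_ep_le)

lemma lsr_approx:
  assumes "df d" "K a" "e > 0" shows "\<exists>\<epsilon>>0. lsr d a - e \<le> d (ep \<epsilon> a)"
proof (rule ccontr)
  assume "\<not> ?thesis"
  then have "d (ep \<epsilon> a) \<le> lsr d a - e" if "\<epsilon> > 0" for \<epsilon> using that by (meson linear)
  then have "lsr d a \<le> lsr d a - e" by (rule lsr_least)
  then show False using assms(3) by simp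
qed

lemma lsr_mono:
  assumes d: "df d" and a: "K a" and b: "K b" and le: "cle a b" shows "lsr d a \<le> lsr d b"
proof (rule lsr_least)
  fix e :: real assume e: "e > 0"
  obtain \<delta> where \<delta>: "\<delta> > 0" "cle (ep e a) (ep \<delta> b)" using cle_ep[OF le a b e] by blast
  then have "d (ep e a) \<le> d (ep \<delta> b)" using e by (intro dfD(4)[OF d] K_ep a b) auto
  then show "d (ep e a) \<le> lsr d b" using lsr_upper[OF d b \<delta>(1)] by linarith
qed

lemma df_lsr: assumes d: "df d" shows "df (lsr d)"
  unfolding df_def
proof (intro conjI allI impI)
  fix a assume a: "K a"
  have "0 \<le> d (ep 1 a)" using a by (intro dfD(1)[OF d] K_ep) auto
  then show "0 \<le> lsr d a" using lsr_upper[OF d a, of 1] by simp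
next
  have "d (fE 1) \<le> d (ep (1/2) (fE 1))" by (intro dfD(4)[OF d] K_ep fE_cle_ep K_fE) auto
  then show "lsr d (fE 1) = 1"
    using lsr_upper[OF d K_fE[of 1], of "1/2"] lsr_le[OF d K_fE[of 1]] dfD(2)[OF d] by simp
next
  fix a b assume "K a \<and> K b \<and> a * b = 0"
  then have a: "K a" and b: "K b" and ab: "a * b = 0" by auto
  have add: "d (ep e (a + b)) = d (ep e a) + d (ep e b)" if "e > 0" for e
    using that ep_add[OF a b ab, of e] dfD(3)[OF d K_ep[OF a] K_ep[OF b] ep_orth[OF a b ab], of e] by simp
  show "lsr d (a + b) = lsr d a + lsr d b"
  proof (rule antisym)
    show "lsr d (a + b) \<le> lsr d a + lsr d b"
      by (rule lsr_least) (auto simp: add intro!: add_mono lsr_upper d a b)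
    show "lsr d a + lsr d b \<le> lsr d (a + b)"
    proof (rule field_le_epsilon)
      fix e :: real assume "e > 0"
      then have e: "e / 2 > 0" by simp
      obtain e1 where e1: "e1 > 0" "lsr d a - e / 2 \<le> d (ep e1 a)" using lsr_approx[OF d a e] by blast
      obtain e2 where e2: "e2 > 0" "lsr d b - e / 2 \<le> d (ep e2 b)" using lsr_approx[OF d b e] by blast
      have "d (ep e1 a) \<le> d (ep (min e1 e2) a)" "d (ep e2 b) \<le> d (ep (min e1 e2) b)"
        using e1 e2 by (auto intro!: df_ep_mono d a b)
      then show "lsr d a + lsr d b \<le> lsr d (a + b) + e"
        using e1 e2 lsr_upper[OF d K_add[OF a b], of "min e1 e2"] add[of "min e1 e2"] by simp
    qed
  qed
next
  fix a b assume "K a \<and> K b \<and> cle a b"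
  then show "lsr d a \<le> lsr d b" using lsr_mono[OF d] by blast
qed

lemma ldf_lsr: assumes d: "df d" shows "ldf (lsr d)"
  unfolding ldf_def
proof (intro conjI allI impI df_lsr d)
  fix a and e :: real assume "K a \<and> e > 0"
  then have a: "K a" and e: "e > 0" by auto
  obtain \<epsilon> where \<epsilon>: "\<epsilon> > 0" "lsr d a - e \<le> d (ep \<epsilon> a)" using lsr_approx[OF d a e] by blast
  \<comment> \<open>Cutting down by \<epsilon>/2 and then by \<epsilon>/4 stays within 3\<epsilon>/4
    of a, strictly less than \<epsilon>, as \<open>cle_ep_near\<close> demands.\<close>
  define b where "b = ep (\<epsilon> / 2) a"
  have b: "K b" unfolding b_def using \<epsilon> by (intro K_ep a) auto
  have "N (a - ep (\<epsilon> / 4) b) \<le> N (a - b) + N (b - ep (\<epsilon> / 4) b)" by (rule N_diff_triangle)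
  also have "\<dots> \<le> \<epsilon> / 2 + \<epsilon> / 4" using \<epsilon> unfolding b_def by (intro add_mono N_minus_ep K_ep a) auto
  also have "\<dots> < \<epsilon>" using \<epsilon> by simp
  finally have "cle (ep \<epsilon> a) (ep (\<epsilon> / 4) b)" using \<epsilon> by (intro cle_ep_near a K_ep b) auto
  then have "d (ep \<epsilon> a) \<le> d (ep (\<epsilon> / 4) b)" using \<epsilon> by (intro dfD(4)[OF d] K_ep a b) auto
  also have "\<dots> \<le> lsr d b" using \<epsilon> by (intro lsr_upper d b) auto
  finally have "lsr d a - e \<le> lsr d (ep (\<epsilon> / 2) a)" using \<epsilon> by (simp add: b_def)
  then show "\<exists>\<epsilon>>0. lsr d a - e \<le> lsr d (ep \<epsilon> a)" using \<epsilon> by (intro exI[of _ "\<epsilon> / 2"]) auto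
qed

lemma ldf_convex:
  assumes f: "ldf f" and g: "ldf g" and t: "0 \<le> t" "t \<le> 1"
  shows "ldf (\<lambda>a. (1 - t) * f a + t * g a)"
proof -
  have df: "df f" "df g" using f g by (auto simp: ldf_def)
  have "df (\<lambda>a. (1 - t) * f a + t * g a)"
    unfolding df_def
  proof (intro conjI allI impI)
    fix a assume "K a"
    then show "0 \<le> (1 - t) * f a + t * g a" using t dfD(1)[OF df(1)] dfD(1)[OF df(2)] by simp
  next
    show "(1 - t) * f (fE 1) + t * g (fE 1) = 1" using dfD(2)[OF df(1)] dfD(2)[OF df(2)] by simp
  next
    fix a b assume "K a \<and> K b \<and> a * b = 0"
    then show "(1 - t) * f (a + b) + t * g (a + b) = (1 - t) * f a + t * g a + ((1 - t) * f b + t * g b)"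
      using dfD(3)[OF df(1)] dfD(3)[OF df(2)] by (simp add: algebra_simps)
  next
    fix a b assume "K a \<and> K b \<and> cle a b"
    then show "(1 - t) * f a + t * g a \<le> (1 - t) * f b + t * g b"
      using t dfD(4)[OF df(1)] dfD(4)[OF df(2)] by (intro add_mono mult_left_mono) auto
  qed
  moreover have "\<exists>\<epsilon>>0. (1 - t) * f a + t * g a - e \<le> (1 - t) * f (ep \<epsilon> a) + t * g (ep \<epsilon> a)"
    if a: "K a" and e: "e > 0" for a e
  proof -
    obtain e1 where e1: "e1 > 0" "f a - e \<le> f (ep e1 a)" using f a e unfolding ldf_def by blast
    obtain e2 where e2: "e2 > 0" "g a - e \<le> g (ep e2 a)" using g a e unfolding ldf_def by blast
    define \<epsilon> where "\<epsilon> = min e1 e2"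
    have \<epsilon>: "\<epsilon> > 0" using e1 e2 by (simp add: \<epsilon>_def)
    have "f a - e \<le> f (ep \<epsilon> a)" "g a - e \<le> g (ep \<epsilon> a)"
      using e1 e2 df_ep_mono[OF df(1) a \<epsilon>, of e1] df_ep_mono[OF df(2) a \<epsilon>, of e2] by (auto simp: \<epsilon>_def)
    then have "(1 - t) * (f a - e) + t * (g a - e) \<le> (1 - t) * f (ep \<epsilon> a) + t * g (ep \<epsilon> a)"
      using t by (intro add_mono mult_left_mono) auto
    then show ?thesis using \<epsilon> by (intro exI[of _ \<epsilon>]) (simp add: algebra_simps)
  qed
  ultimately show ?thesis unfolding ldf_def by blast
qed

section \<open>Values on multisets and their comparison\<close>

definition D :: "('a fmat \<Rightarrow> real) \<Rightarrow> 'a fmat multiset \<Rightarrow> real" where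
  "D d X = (\<Sum>x\<in>#filter_mset K X. d x)"

lemma D_simps: "D d {#} = 0" "D d (X + Y) = D d X + D d Y" "K x \<Longrightarrow> D d (add_mset x X) = d x + D d X"
  by (auto simp: D_def)

lemma D_repeat: "D d (repeat_mset n X) = real n * D d X"
  by (induction n) (auto simp: D_simps algebra_simps)

lemma D_sum: "D d (\<Sum>a\<in>F. f a) = (\<Sum>a\<in>F. D d (f a))"
  by (induction F rule: infinite_finite_induct) (auto simp: D_simps)

lemma df_osum: assumes d: "df d" and a: "K a" and b: "K b" shows "d (osum a b) = d a + d b"
proof -
  obtain T where T: "osum a b = a + T" "K T" "a * T = 0" "cle T b" "cle b T" by (rule osum_split[OF b])
  have "d T = d b" using dfD(4)[OF d] T b by (meson antisym)
  then show ?thesis using dfD(3)[OF d a T(2,3)] T(1) by simp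
qed

lemma df_0: "df d \<Longrightarrow> d 0 = 0"
  using dfD(3)[of d 0 0] by simp

lemma df_ds: "df d \<Longrightarrow> Kl xs \<Longrightarrow> d (ds xs) = (\<Sum>x\<in>#mset xs. d x)"
  by (induction xs) (auto simp: df_0 df_osum K_ds)

lemma D_mono: assumes d: "df d" and le: "mle X Y" shows "D d X \<le> D d Y"
proof -
  have "d (ds (rep X)) \<le> d (ds (rep Y))" using le unfolding mle_def by (intro dfD(4)[OF d] K_ds Kl_rep)
  then show ?thesis by (simp add: D_def df_ds[OF d Kl_rep] mset_rep)
qed

text \<open>Bounds all dimension functions uniformly at each element, as the separation argument
  requires.\<close>

lemma df_le_size:
  assumes "df d" "K a" "inM n a" shows "d a \<le> real n"
proof -
  have "D d {#a#} \<le> D d (repeat_mset n uu)" by (rule D_mono[OF assms(1) mle_single_unit[OF assms(2,3)]])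
  then show ?thesis unfolding D_repeat using assms by (simp add: D_simps dfD(2)[OF assms(1), simplified])
qed

text \<open>The direct sum of orthogonal elements is Cuntz equivalent to their sum, so additivity on
  multisets becomes additivity on orthogonal elements.\<close>

lemma state_df:
  assumes g: "W.state g" shows "df (\<lambda>a. g {#a#})" "g X = D (\<lambda>a. g {#a#}) X"
proof -
  have add: "g (X + Y) = g X + g Y" for X Y using g unfolding W.state_def by blast
  have nonneg: "0 \<le> g X" for X using g unfolding W.state_def by blast
  have mono: "mle X Y \<Longrightarrow> g X \<le> g Y" for X Y using g unfolding W.state_def by blast
  have one: "g uu = 1" using g unfolding W.state_def by blast
  have g0: "g {#} = 0" using add[of "{#}" "{#}"] by simp
  show "df (\<lambda>a. g {#a#})"
    unfolding df_def
  proof (intro conjI allI impI nonneg one)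
    fix a b assume "K a \<and> K b \<and> a * b = 0"
    then have a: "K a" and b: "K b" and ab: "a * b = 0" by auto
    have e1: "mle {#a + b#} {#a, b#} \<longleftrightarrow> cle (ds [a + b]) (ds [a, b])"
      by (rule mle_iff) (use a b in \<open>auto intro: K_add\<close>)
    have e2: "mle {#a, b#} {#a + b#} \<longleftrightarrow> cle (ds [a, b]) (ds [a + b])"
      by (rule mle_iff) (use a b in \<open>auto intro: K_add\<close>)
    have 1: "cle (osum (a + b) 0) (a + b)" "cle (a + b) (osum (a + b) 0)"
      using cle_osum_0[OF K_add[OF a b]] by auto
    have 2: "cle (osum a (osum b 0)) (osum a b)" "cle (osum a b) (osum a (osum b 0))"
      by (intro cle_osum cle_refl cle_osum_0 b)+
    have "mle {#a + b#} {#a, b#}" unfolding e1 using cle_trans[OF 1(1) cle_trans[OF cle_add_osum 2(2)]] by simp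
    moreover have "mle {#a, b#} {#a + b#}"
      unfolding e2 using cle_trans[OF 2(1) cle_trans[OF cle_osum_add[OF a b ab] 1(2)]] by simp
    ultimately have "g {#a + b#} = g {#a, b#}" using mono by (meson antisym)
    also have "{#a, b#} = {#a#} + {#b#}" by simp
    finally show "g {#a + b#} = g {#a#} + g {#b#}" by (simp only: add)
  next
    fix a b assume "K a \<and> K b \<and> cle a b"
    then show "g {#a#} \<le> g {#b#}" using mono mle_single by blast
  qed
  show "g X = D (\<lambda>a. g {#a#}) X"
  proof (induction X)
    case (add x X)
    have e: "g (add_mset x X) = g {#x#} + g X" using \<open>\<And>X Y. g (X + Y) = g X + g Y\<close>[of "{#x#}" X] by simp
    show ?case
    proof (cases "K x")
      case True
      then show ?thesis using e add by (simp add: D_simps)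
    next
      case False
      \<comment> \<open>\<open>rep\<close> drops x, so x lies below the empty sum and the state
        vanishes on it, in accordance with \<open>D\<close>.\<close>
      then have "mle {#x#} {#} \<longleftrightarrow> cle (ds []) (ds [])" by (intro mle_iff) auto
      then have "g {#x#} = 0" using mono[of "{#x#}" "{#}"] nonneg[of "{#x#}"] g0 cle_refl by fastforce
      then show ?thesis using e add False by (simp add: D_def)
    qed
  qed (simp add: g0 D_simps)
qed

lemma D_less:
  assumes W: "W_almost_unperforated sc st TYPE('a)"
    and X: "\<forall>x\<in>#X. K x" and Y: "\<forall>y\<in>#Y. K y"
    and lt: "\<And>f. ldf f \<Longrightarrow> D f X < D f Y" and d: "df d"
  shows "D d X \<le> D d Y"
proof -
  have "mle (image_mset (ep e) X + uu) (Y + uu)" if e: "e > 0" for e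
  proof (rule W.state_comparison)
    show "mle x y" if "k' < k" "mle (repeat_mset k x) (repeat_mset k' y)" for k k' x y
      using mle_unperforated[OF W that] .
    \<comment> \<open>The reason for adding \<open>uu\<close> on both sides: the right side now
      dominates the order unit.\<close>
    show "mle uu (Y + uu)" using W.le_left[of uu Y] by (simp add: add.commute)
    fix g assume g: "W.state g"
    define f where "f = (\<lambda>a. g {#a#})"
    have f: "df f" unfolding f_def by (rule state_df(1)[OF g])
    have gD: "g Z = D f Z" for Z unfolding f_def by (rule state_df(2)[OF g])
    have "D f (image_mset (ep e) X) \<le> D (lsr f) X"
      using X by (induction X) (use e in \<open>auto simp: D_simps K_ep intro!: add_mono lsr_upper f\<close>)
    also have "\<dots> < D (lsr f) Y" by (rule lt[OF ldf_lsr[OF f]])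
    also have "\<dots> \<le> D f Y"
      using Y by (induction Y) (auto simp: D_simps intro!: add_mono lsr_le f)
    finally show "g (image_mset (ep e) X + uu) < g (Y + uu)" by (simp add: gD D_simps)
  qed
  then have "mle (X + uu) (Y + uu)" by (rule mle_ep[OF X])
  then have "D d (X + uu) \<le> D d (Y + uu)" by (rule D_mono[OF d])
  then show ?thesis by (simp add: D_simps)
qed

end

text \<open>The functional is \<open>v - k\<^sub>0\<close> for an almost closest point \<open>k\<^sub>0\<close> of \<open>V\<close>.\<close>
lemma separate_finite:
  fixes V :: "('x \<Rightarrow> real) set" and v :: "'x \<Rightarrow> real"
  assumes F: "finite F" and V: "V \<noteq> {}"
    and conv: "\<And>f g t. f \<in> V \<Longrightarrow> g \<in> V \<Longrightarrow> 0 \<le> t \<Longrightarrow> t \<le> 1 \<Longrightarrow> (\<lambda>a. (1 - t) * f a + t * g a) \<in> V"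
    and bnd: "\<And>f a. f \<in> V \<Longrightarrow> a \<in> F \<Longrightarrow> \<bar>f a\<bar> \<le> B a"
    and e: "e > 0" and far: "\<And>f. f \<in> V \<Longrightarrow> \<exists>a\<in>F. e \<le> \<bar>f a - v a\<bar>"
  obtains w d where "d > 0" "\<And>f. f \<in> V \<Longrightarrow> d \<le> (\<Sum>a\<in>F. w a * (v a - f a))"
proof -
  define Q where "Q f = (\<Sum>a\<in>F. (v a - f a)\<^sup>2)" for f
  have Qe: "e\<^sup>2 \<le> Q f" if f: "f \<in> V" for f
  proof -
    obtain a where a: "a \<in> F" "e \<le> \<bar>f a - v a\<bar>" using far[OF f] by blast
    have "e\<^sup>2 \<le> \<bar>f a - v a\<bar>\<^sup>2" using a e by (intro power_mono) auto
    also have "\<dots> = (v a - f a)\<^sup>2" by (simp add: power2_commute)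
    also have "\<dots> \<le> Q f" unfolding Q_def using a F by (intro member_le_sum) auto
    finally show ?thesis .
  qed
  define D where "D = (INF f\<in>V. Q f)"
  have D: "D > 0"
  proof -
    have "e\<^sup>2 \<le> D" unfolding D_def using V Qe by (intro cINF_greatest)
    then show ?thesis using e by (smt (verit) zero_less_power)
  qed
  have DQ: "D \<le> Q f" if "f \<in> V" for f
    unfolding D_def using that Qe by (intro cINF_lower bdd_belowI[of _ "e\<^sup>2"]) auto
  define C where "C = (\<Sum>a\<in>F. (2 * B a)\<^sup>2)"
  have C: "C \<ge> 0" unfolding C_def by (intro sum_nonneg) auto
  \<comment> \<open>Step length from k0 towards f: with t (1 + C) \<le> D, the excess t^2 of k0 over
    the infimum and the quadratic term, at most t^2 C, together cost at most t D.\<close>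
  define t where "t = min 1 (D / (1 + C))"
  have "t \<le> D / (1 + C)" by (simp add: t_def)
  then have t: "0 < t" "t \<le> 1" "t * (1 + C) \<le> D"
    using D C pos_le_divide_eq[of "1 + C" t D] by (auto simp: t_def)
  have "\<exists>f\<in>V. Q f < D + t\<^sup>2"
  proof (rule ccontr)
    assume "\<not> ?thesis"
    then have "D + t\<^sup>2 \<le> D" unfolding D_def[symmetric] using V by (subst (2) D_def) (intro cINF_greatest, auto simp: not_less)
    then show False using t by simp
  qed
  then obtain k0 where k0: "k0 \<in> V" "Q k0 < D + t\<^sup>2" by blast
  define w where "w a = v a - k0 a" for a
  have "D / 2 \<le> (\<Sum>a\<in>F. w a * (v a - f a))" if f: "f \<in> V" for f
  proof -
    define z where "z a = f a - k0 a" for a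
    define I where "I = (\<Sum>a\<in>F. w a * z a)"
    \<comment> \<open>By convexity the moved point stays in V, so its squared distance from v is
      still at least D.\<close>
    have "D \<le> Q (\<lambda>a. (1 - t) * k0 a + t * f a)" using t by (intro DQ conv k0 f) auto
    also have "Q (\<lambda>a. (1 - t) * k0 a + t * f a) = (\<Sum>a\<in>F. (w a)\<^sup>2 - 2 * t * (w a * z a) + t\<^sup>2 * (z a)\<^sup>2)"
      unfolding Q_def by (intro sum.cong refl) (simp add: w_def z_def power2_eq_square algebra_simps)
    also have "\<dots> = Q k0 - 2 * t * I + t\<^sup>2 * (\<Sum>a\<in>F. (z a)\<^sup>2)"
      by (simp add: sum.distrib sum_subtractf sum_distrib_left Q_def w_def I_def)
    also have "(\<Sum>a\<in>F. (z a)\<^sup>2) \<le> C"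
      unfolding C_def
    proof (rule sum_mono)
      fix a assume a: "a \<in> F"
      have "\<bar>z a\<bar> \<le> 2 * B a" using bnd[OF f a] bnd[OF k0(1) a] unfolding z_def by linarith
      then show "(z a)\<^sup>2 \<le> (2 * B a)\<^sup>2" by (metis abs_ge_zero power2_abs power_mono)
    qed
    then have "t\<^sup>2 * (\<Sum>a\<in>F. (z a)\<^sup>2) \<le> t\<^sup>2 * C" by (intro mult_left_mono) auto
    finally have "2 * t * I \<le> t\<^sup>2 + t\<^sup>2 * C" using k0(2) \<open>t\<^sup>2 * (\<Sum>a\<in>F. (z a)\<^sup>2) \<le> t\<^sup>2 * C\<close> by linarith
    also have "\<dots> = t * (t * (1 + C))" by (simp add: power2_eq_square algebra_simps)
    also have "\<dots> \<le> t * D" using t by (intro mult_left_mono) auto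
    finally have I: "2 * I \<le> D" using t by simp
    have "(\<Sum>a\<in>F. w a * (v a - f a)) = Q k0 - I"
      unfolding Q_def I_def by (simp flip: sum_subtractf) (intro sum.cong refl, simp add: w_def z_def power2_eq_square algebra_simps)
    then show ?thesis using I DQ[OF k0(1)] by linarith
  qed
  then show thesis using that[of "D / 2" w] D by simp
qed

theorem theorem3p3:
  fixes sc :: "complex \<Rightarrow> 'a::{real_normed_algebra_1,banach} \<Rightarrow> 'a"
    and st :: "'a \<Rightarrow> 'a"
  assumes "cstar_algebra sc st"
    and "stably_finite st TYPE('a)"
    and "W_almost_unperforated sc st TYPE('a)"
  shows "pointwise_dense_in st (LDF sc st) (DF sc st)"
proof -
  interpret cstar sc st by unfold_locales (rule assms(1))
  have main: "\<exists>f. ldf f \<and> (\<forall>a\<in>F. \<bar>f a - d a\<bar> < e)"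
    if F: "finite F" "\<forall>a\<in>F. K a" and d: "df d" and e: "e > 0" for F d e
  proof (rule ccontr)
    assume no: "\<not> ?thesis"
    define V where "V = {f. ldf f}"
    obtain n :: "'a fmat \<Rightarrow> nat" where n: "\<And>a. inM (n a) a" using inM_ex by metis
    define B where "B a = real (n a)" for a :: "'a fmat"
    have bnd: "0 \<le> f a \<and> f a \<le> B a" if "df f" "a \<in> F" for f a
      using dfD(1)[OF that(1)] df_le_size[OF that(1) _ n] F(2) that(2) by (auto simp: B_def)
    have Vdf: "df f" if "f \<in> V" for f using that by (simp add: V_def ldf_def)
    obtain w \<delta> where w: "\<delta> > 0" "\<And>f. f \<in> V \<Longrightarrow> \<delta> \<le> (\<Sum>a\<in>F. w a * (d a - f a))"
    proof (rule separate_finite[OF F(1), of V B e d])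
      show "V \<noteq> {}" using ldf_lsr[OF d] by (auto simp: V_def)
      show "(\<lambda>a. (1 - t) * f a + t * g a) \<in> V" if "f \<in> V" "g \<in> V" "0 \<le> t" "t \<le> 1" for f g t
        using that ldf_convex by (simp add: V_def)
      show "\<bar>f a\<bar> \<le> B a" if "f \<in> V" "a \<in> F" for f a using bnd[OF Vdf[OF that(1)] that(2)] by simp
      show "\<exists>a\<in>F. e \<le> \<bar>f a - d a\<bar>" if "f \<in> V" for f using no that by (auto simp: V_def not_less)
    qed (use e in auto)
    define M where "M = (\<Sum>a\<in>F. B a)"
    \<comment> \<open>Rounding the coefficients costs at most M; the scaled gap exceeds this by 2,
      leaving room for an integer threshold.\<close>
    obtain q :: nat where q: "(M + 2) / \<delta> < real q" using reals_Archimedean2 by blast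
    then have q2: "M + 2 \<le> real q * \<delta>" using w(1) by (simp add: field_simps)
    define z where "z a = \<lfloor>real q * w a\<rfloor>" for a
    define S where "S f = (\<Sum>a\<in>F. real_of_int (z a) * f a)" for f
    have gap: "S f + 2 \<le> S d" if f: "f \<in> V" for f
    proof -
      have "real q * \<delta> \<le> real q * (\<Sum>a\<in>F. w a * (d a - f a))" using w(2)[OF f] by (intro mult_left_mono) auto
      also have "\<dots> = (\<Sum>a\<in>F. real q * w a * (d a - f a))" by (simp add: sum_distrib_left mult.assoc)
      also have "\<dots> \<le> (\<Sum>a\<in>F. real_of_int (z a) * (d a - f a) + B a)"
      proof (rule sum_mono)
        fix a assume a: "a \<in> F"
        have z: "0 \<le> real q * w a - real_of_int (z a)" "real q * w a - real_of_int (z a) \<le> 1"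
          unfolding z_def by linarith+
        have "\<bar>d a - f a\<bar> \<le> B a" using bnd[OF d a] bnd[OF Vdf[OF f] a] by linarith
        then have "\<bar>(real q * w a - real_of_int (z a)) * (d a - f a)\<bar> \<le> 1 * B a"
          unfolding abs_mult using z by (intro mult_mono) auto
        then show "real q * w a * (d a - f a) \<le> real_of_int (z a) * (d a - f a) + B a"
          by (simp add: algebra_simps)
      qed
      also have "\<dots> = S d - S f + M"
        by (simp add: S_def M_def sum.distrib sum_subtractf right_diff_distrib)
      finally show ?thesis using q2 by linarith
    qed
    \<comment> \<open>The largest integer strictly below S d. Since S d \<le> p + 1 and S f \<le> S
      d - 2, every f in V has S f < p.\<close>
    define p where "p = \<lceil>S d\<rceil> - 1"
    have p: "real_of_int p < S d" "S d \<le> real_of_int p + 1" unfolding p_def by linarith+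
    \<comment> \<open>Positive coefficients go to the left and negative ones, with changed sign, to
      the right; p becomes copies of the unit on the opposite side.\<close>
    define X where "X = (\<Sum>a\<in>F. repeat_mset (nat (z a)) {#a#}) + repeat_mset (nat (- p)) uu"
    define Y where "Y = (\<Sum>a\<in>F. repeat_mset (nat (- z a)) {#a#}) + repeat_mset (nat p) uu"
    have K_XY: "\<forall>x\<in>#(\<Sum>a\<in>F. repeat_mset (k a) {#a#}) + repeat_mset m uu. K x" for k m
      using F by (auto simp: set_mset_sum in_replicate_mset)
    have DX: "D f ((\<Sum>a\<in>F. repeat_mset (k a) {#a#}) + repeat_mset m uu) = (\<Sum>a\<in>F. real (k a) * f a) + real m"
      if f: "df f" for f k m
    proof -
      have "D f {#a#} = f a" if "a \<in> F" for a using F(2) that by (simp add: D_simps)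
      moreover have "D f uu = 1" using dfD(2)[OF f] by (simp add: D_simps)
      ultimately show ?thesis
        unfolding D_simps D_sum D_repeat by simp
    qed
    have diff: "D f X - D f Y = S f - real_of_int p" if f: "df f" for f
    proof -
      have nn: "real (nat i) - real (nat (- i)) = real_of_int i" for i by (cases "i \<ge> 0") auto
      have "D f X - D f Y = (\<Sum>a\<in>F. (real (nat (z a)) - real (nat (- z a))) * f a) - (real (nat p) - real (nat (- p)))"
        unfolding X_def Y_def DX[OF f] by (simp add: sum_subtractf left_diff_distrib)
      then show ?thesis by (simp only: nn S_def)
    qed
    have "D d X \<le> D d Y"
    proof (rule D_less[OF assms(3) _ _ _ d])
      show "\<forall>x\<in>#X. K x" "\<forall>y\<in>#Y. K y" unfolding X_def Y_def by (rule K_XY)+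
      fix f assume "ldf f"
      then have "f \<in> V" by (simp add: V_def)
      then show "D f X < D f Y" using gap[of f] diff[OF Vdf[of f]] p by linarith
    qed
    then show False using diff[OF d] p by linarith
  qed
  show ?thesis
    unfolding pointwise_dense_in_def
  proof (intro ballI allI impI)
    fix d F and e :: real
    assume d: "d \<in> DF sc st" and e: "e > 0" and F: "finite F \<and> (\<forall>a\<in>F. mpos st a)"
    have ent: "ent (Fmat a) = a" if "a \<in> F" for a using F that by (intro ent_Fmat) (auto simp: mpos_def)
    have "\<forall>a\<in>Fmat ` F. K a" using F ent mpos_ent by force
    moreover have "df (\<lambda>a. d (ent a))" using d by (simp add: DF_def is_dimfun_ent)
    ultimately obtain f where f: "ldf f" "\<forall>a\<in>Fmat ` F. \<bar>f a - d (ent a)\<bar> < e"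
      using main[of "Fmat ` F"] F e by blast
    then have "\<forall>a\<in>F. \<bar>f (Fmat a) - d a\<bar> < e" using ent by auto
    then show "\<exists>d'\<in>LDF sc st. \<forall>a\<in>F. \<bar>d' a - d a\<bar> < e"
      using LDF_ent[OF f(1)] by (intro bexI[of _ "\<lambda>a. f (Fmat a)"])
  qed
qed

end
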